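(* Assume the following conjecture (a form of the Vojta / Hall–Lang conjecture): for each $d\ge 3$ there exist constants $C_1(d),C_2(d)$ such that for every $f\in\mathbb{Z}[x]$ of degree $d$ with nonzero discriminant, if $x,y\in\mathbb{Z}$ satisfy $y^2=f(x)$, then $h(x)\le C_1(d)\,h(f)+C_2(d)$. Let $d\ge 3$ and, for $c\in\mathbb{Z}^+$, let $\phi_{(d,c)}(x)=x^d-cdx^{d-1}+c(d-1)$. Suppose that either (1) $d$ is prime, or (2) there exists a prime $q$ dividing $d-1$ such that $\gcd(d-1,v_q(d-1))=1$. Let $\mathcal{B}_d$ be the set of $c\in\mathbb{Z}^+$ such that $\phi_{(d,c)}^n(x)$ is irreducible over $\mathbb{Q}$ for all $n\ge1$ and $\gcd(c,d-1)=1$. If $c\in\mathcal{B}_d$, then $G_{\mathbb{Q}}(\phi_{(d,c)})$ has finite index in $\mathrm{Aut}(T_\infty)$. Moreover, for all but finitely many $c\in\mathcal{B}_d$, $G_{\mathbb{Q}}(\phi_{(d,c)})=\mathrm{Aut}(T_\infty)$.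
   Context: $h$ denotes the absolute logarithmic height (for a rational number $r/s$ in lowest terms, $h(r/s)=\log\max(|r|,|s|)$), and for $f\in\mathbb{Z}[x]$, $h(f)$ is the maximum of the heights of its coefficients. $v_q$ is the $q$-adic valuation. For a number field $K$ and $\varphi\in K[x]$ of degree $d\ge 2$ with all iterates $\varphi^n$ separable, the pre-image tree $T_\infty$ has vertex set $\bigsqcup_{n\ge 0}\varphi^{-n}(0)$ (with $\varphi^{-0}(0)=\{0\}$), edges joining $\beta\in\varphi^{-(n+1)}(0)$ to $\varphi(\beta)\in\varphi^{-n}(0)$; $\mathrm{Aut}(T_\infty)$ is its automorphism group, and $G_K(\varphi)$ is the image of the natural action homomorphism $\mathrm{Gal}(\overline K/K)\to\mathrm{Aut}(T_\infty)$. *)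

theory Defs
  imports "Subresultants.Resultant_Prelim" "HOL-Computational_Algebra.Computational_Algebra"
begin

definition disc :: "int poly \<Rightarrow> int" where
  "disc f = (-1) ^ (degree f * (degree f - 1) div 2) * (resultant f (pderiv f) div lead_coeff f)"

(* absolute logarithmic height of an integer x = x/1 *)
definition ht_int :: "int \<Rightarrow> real" where
  "ht_int x = ln (real_of_int (max \<bar>x\<bar> 1))"

definition ht_poly :: "int poly \<Rightarrow> real" where
  "ht_poly f = Max ((\<lambda>i. ht_int (coeff f i)) ` {0..degree f})"

definition vojta_conj :: bool where
  "vojta_conj \<longleftrightarrow> (\<forall>d::nat. d \<ge> 3 \<longrightarrow> (\<exists>C1 C2 :: real. \<forall>f :: int poly.
      degree f = d \<longrightarrow> disc f \<noteq> 0 \<longrightarrow>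
      (\<forall>x y :: int. y^2 = poly f x \<longrightarrow> ht_int x \<le> C1 * ht_poly f + C2)))"

definition phi :: "nat \<Rightarrow> int \<Rightarrow> int poly" where
  "phi d c = monom 1 d - monom (c * int d) (d - 1) + [:c * (int d - 1):]"

definition iter :: "int poly \<Rightarrow> nat \<Rightarrow> int poly" where
  "iter f n = ((\<lambda>g. pcompose f g) ^^ n) [:0, 1:]"

definition B_set :: "nat \<Rightarrow> int set" where
  "B_set d = {c. c > 0 \<and> (\<forall>n\<ge>1. irreducible (map_poly (of_int :: int \<Rightarrow> rat) (iter (phi d c) n)))
                 \<and> coprime c (int d - 1)}"

definition tree_V :: "int poly \<Rightarrow> (nat \<times> complex) set" where
  "tree_V f = {(n, b). poly (map_poly of_int (iter f n)) b = 0}"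

definition tree_edge :: "int poly \<Rightarrow> nat \<times> complex \<Rightarrow> nat \<times> complex \<Rightarrow> bool" where
  "tree_edge f u v \<longleftrightarrow> u \<in> tree_V f \<and> v \<in> tree_V f \<and>
     ((fst u = Suc (fst v) \<and> snd v = poly (map_poly of_int f) (snd u)) \<or>
      (fst v = Suc (fst u) \<and> snd u = poly (map_poly of_int f) (snd v)))"

definition tree_Aut :: "int poly \<Rightarrow> ((nat \<times> complex) \<Rightarrow> (nat \<times> complex)) set" where
  "tree_Aut f = {g. bij_betw g (tree_V f) (tree_V f) \<and> (\<forall>v. v \<notin> tree_V f \<longrightarrow> g v = v) \<and>
      (\<forall>u\<in>tree_V f. \<forall>v\<in>tree_V f. tree_edge f (g u) (g v) \<longleftrightarrow> tree_edge f u v)}"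

definition qbar :: "complex set" where "qbar = {z. algebraic z}"

definition gal_Q :: "(complex \<Rightarrow> complex) set" where
  "gal_Q = {s. bij_betw s qbar qbar \<and> (\<forall>z. z \<notin> qbar \<longrightarrow> s z = z) \<and>
      (\<forall>a\<in>qbar. \<forall>b\<in>qbar. s (a + b) = s a + s b \<and> s (a * b) = s a * s b) \<and> s 1 = 1}"

definition gal_tree :: "int poly \<Rightarrow> ((nat \<times> complex) \<Rightarrow> (nat \<times> complex)) set" where
  "gal_tree f = (\<lambda>s. \<lambda>v. if v \<in> tree_V f then (fst v, s (snd v)) else v) ` gal_Q"

definition finite_index :: "('a \<Rightarrow> 'a) set \<Rightarrow> ('a \<Rightarrow> 'a) set \<Rightarrow> bool" where
  "finite_index H G \<longleftrightarrow> finite {(\<lambda>h. g \<circ> h) ` H | g. g \<in> G}"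

end

theory Submission
  imports Defs "HOL-Computational_Algebra.Field_as_Ring" "Subresultants.Subresultant_Gcd" "Jordan_Normal_Form.Char_Poly" "HOL-Real_Asymp.Real_Asymp"
begin

text \<open>
  Let \<open>a n\<close> be the value of the \<open>n\<close>-th iterate at the critical point 0; the other critical point is
  \<open>a 1 = c (d - 1)\<close>. Up to primes dividing \<open>d\<close> or some \<open>a i\<close> with \<open>i \<le> n\<close>, the discriminant of the
  \<open>n\<close>-th iterate is \<open>a (n + 1)\<close>. If a prime outside these divides \<open>a (n + 1)\<close> to an odd power, it
  ramifies, exactly two of the roots coincide modulo a prime above it, and inertia contains a
  transposition of these two siblings. The stabiliser of a vertex acts primitively on the fibre above
  it: trivially if \<open>d\<close> is prime, and otherwise because of total ramification of degree \<open>d - 1\<close>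
  at the prime \<open>q\<close>. Conjugating the transposition therefore yields all permutations of all fibres.

  If no such prime exists, then \<open>a (n + 1) = D y\<^sup>2\<close>, where \<open>D\<close> divides a product of \<open>d\<close> and terms \<open>a i\<close>
  with \<open>2 i \<le> n + 1\<close>, because \<open>a\<close> is a divisibility sequence. The point \<open>(a n, D y)\<close> on
  \<open>Y\<^sup>2 = D \<phi>(X)\<close> violates the conjecture for all large \<open>n\<close>, uniformly in \<open>c\<close>. For a fixed \<open>n\<close>,
  regard \<open>a (n + 1)\<close> as a polynomial in \<open>c\<close>; it is squarefree since its derivative is \<open>-1\<close> modulo
  \<open>d\<close>, and the conjecture bounds \<open>c\<close>.
\<close>

section \<open>Algebraic integers\<close>

text \<open>Both critical points lie on one orbit, since \<phi>(0) = c (d - 1); this is why the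
  single sequence \<open>a\<close> governs ramification at all levels. The restriction 2 i \<le> n +
  1 decides the case of large levels: with m about n / 2, log |D| is at most about m log |a m|,
  while log |a n| is at least 2^(n/2) log |a m|. For fixed n the conjecture needs degree at least 3
  after the earlier factors are removed. This fails only for d = 3, n = 1, where 2 c^2 - 1 remains
  up to a constant and can be a square infinitely often; that level is treated through the cubic
  discriminant. Total ramification at q rests on both coprimality conditions: gcd(c, d - 1) = 1
  makes c d a unit at q, and gcd(d - 1, v_q(d - 1)) = 1 keeps the denominators of the valuations
  v_q(d - 1) / (d - 1)^i from cancelling. Integrality is handled in the subring generated by the
  roots of one level instead of the full ring of integers, and valuations at a maximal ideal M by
  equations x s = p^j t with s and t outside M.\<close>

definition zspan :: "'i set \<Rightarrow> ('i \<Rightarrow> complex) \<Rightarrow> complex set" where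
  "zspan I v = range (\<lambda>c :: 'i \<Rightarrow> int. \<Sum>j\<in>I. of_int (c j) * v j)"

lemma zspanI: "x = (\<Sum>j\<in>I. of_int (c j) * v j) \<Longrightarrow> x \<in> zspan I v"
  by (auto simp: zspan_def)

lemma zspan_add: "x \<in> zspan I v \<Longrightarrow> y \<in> zspan I v \<Longrightarrow> x + y \<in> zspan I v"
proof -
  assume "x \<in> zspan I v" "y \<in> zspan I v"
  then obtain c e where "x = (\<Sum>j\<in>I. of_int (c j) * v j)" "y = (\<Sum>j\<in>I. of_int (e j) * v j)"
    by (auto simp: zspan_def)
  then have "x + y = (\<Sum>j\<in>I. of_int (c j + e j) * v j)"
    by (simp add: sum.distrib algebra_simps)
  then show ?thesis by (simp add: zspan_def image_iff exI[of _ "\<lambda>j. c j + e j"])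
qed

lemma zspan_mult: "x \<in> zspan I v \<Longrightarrow> of_int k * x \<in> zspan I v"
proof -
  assume "x \<in> zspan I v"
  then obtain c where "x = (\<Sum>j\<in>I. of_int (c j) * v j)"
    by (auto simp: zspan_def)
  then have "of_int k * x = (\<Sum>j\<in>I. of_int (k * c j) * v j)"
    by (simp add: sum_distrib_left algebra_simps)
  then show ?thesis unfolding zspan_def by (intro image_eqI[where x = "\<lambda>j. k * c j"]) auto
qed

lemma zspan_0: "0 \<in> zspan I v"
  unfolding zspan_def by (intro image_eqI[where x = "\<lambda>j. 0"]) auto

lemma zspan_sum: "(\<And>j. j \<in> J \<Longrightarrow> f j \<in> zspan I v) \<Longrightarrow> (\<Sum>j\<in>J. f j) \<in> zspan I v"
  by (induction J rule: infinite_finite_induct) (auto intro: zspan_0 zspan_add)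

lemma zspan_base: "finite I \<Longrightarrow> i \<in> I \<Longrightarrow> v i \<in> zspan I v"
  unfolding zspan_def
  by (intro image_eqI[where x = "\<lambda>j. if j = i then 1 else 0"])
     (auto simp: if_distrib[where f = of_int] if_distrib[where f = "\<lambda>x. x * _"] sum.delta cong: if_cong)

lemma zspan_closed_mult:
  assumes "\<And>i. i \<in> I \<Longrightarrow> x * v i \<in> zspan I v" and "s \<in> zspan I v"
  shows "x * s \<in> zspan I v"
proof -
  from assms(2) obtain c where s: "s = (\<Sum>j\<in>I. of_int (c j) * v j)"
    by (auto simp: zspan_def)
  have "x * s = (\<Sum>j\<in>I. of_int (c j) * (x * v j))"
    by (simp add: s sum_distrib_left algebra_simps)
  also have "\<dots> \<in> zspan I v" by (intro zspan_sum zspan_mult assms)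
  finally show ?thesis .
qed

text \<open>The characteristic polynomial of the multiplication matrix annihilates \<open>x\<close>.\<close>

lemma algebraic_int_of_zspan:
  assumes fin: "finite I" and i0: "i0 \<in> I" "v i0 \<noteq> 0"
    and cl: "\<And>i. i \<in> I \<Longrightarrow> x * v i \<in> zspan I v"
  shows "algebraic_int x"
proof -
  define n where "n = card I"
  obtain h where h: "bij_betw h {0..<n} I"
    using ex_bij_betw_nat_finite[OF fin] n_def by blast
  have "\<forall>i\<in>I. \<exists>c :: _ \<Rightarrow> int. x * v i = (\<Sum>j\<in>I. of_int (c j) * v j)"
    using cl by (auto simp: zspan_def)
  then obtain c :: "_ \<Rightarrow> _ \<Rightarrow> int" where c: "\<And>i. i \<in> I \<Longrightarrow> x * v i = (\<Sum>j\<in>I. of_int (c i j) * v j)"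
    by metis
  define A :: "int mat" where "A = mat n n (\<lambda>(i, j). c (h i) (h j))"
  define w :: "complex vec" where "w = vec n (\<lambda>i. v (h i))"
  have A: "A \<in> carrier_mat n n" by (simp add: A_def)
  then have A': "map_mat complex_of_int A \<in> carrier_mat n n" by simp
  have hI: "h i \<in> I" if "i < n" for i using h that by (auto simp: bij_betw_def)
  have "eigenvector (map_mat complex_of_int A) w x"
    unfolding eigenvector_def
  proof (intro conjI)
    show "w \<in> carrier_vec (dim_row (map_mat complex_of_int A))" by (simp add: w_def A_def)
    obtain k where k: "k < n" "h k = i0" using h i0(1) by (auto simp: bij_betw_def image_iff)
    show "w \<noteq> 0\<^sub>v (dim_row (map_mat complex_of_int A))"
    proof
      assume "w = 0\<^sub>v (dim_row (map_mat complex_of_int A))"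
      then have "w $ k = 0" using k A by simp
      then show False using k i0 by (simp add: w_def)
    qed
    show "map_mat complex_of_int A *\<^sub>v w = x \<cdot>\<^sub>v w"
    proof (rule eq_vecI)
      fix i assume "i < dim_vec (x \<cdot>\<^sub>v w)"
      then have i: "i < n" by (simp add: w_def)
      have "(map_mat complex_of_int A *\<^sub>v w) $ i = (\<Sum>j = 0..<n. of_int (c (h i) (h j)) * v (h j))"
        using i by (simp add: A_def w_def scalar_prod_def)
      also have "\<dots> = (\<Sum>j\<in>I. of_int (c (h i) j) * v j)"
        by (rule sum.reindex_bij_betw[OF h])
      also have "\<dots> = x * v (h i)" using c hI i by simp
      finally show "(map_mat complex_of_int A *\<^sub>v w) $ i = (x \<cdot>\<^sub>v w) $ i"
        using i by (simp add: w_def)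
    qed (simp add: A_def w_def)
  qed
  then have "poly (char_poly (map_mat complex_of_int A)) x = 0"
    using eigenvalue_root_char_poly[OF A'] by (auto simp: eigenvalue_def)
  also have "char_poly (map_mat complex_of_int A) = map_poly of_int (char_poly A)"
    by (rule of_int_hom.char_poly_hom[OF A])
  finally show ?thesis
    unfolding algebraic_int_altdef_ipoly using degree_monic_char_poly[OF A] by auto
qed

lemma algebraic_int_power_span:
  fixes x :: complex
  assumes "algebraic_int x"
  obtains m where "m > 0" "x ^ m \<in> zspan {..<m} (\<lambda>i. x ^ i)"
proof -
  from assms obtain p :: "int poly" where p: "poly (map_poly of_int p) x = 0" "lead_coeff p = 1"
    by (auto simp: algebraic_int_altdef_ipoly)
  define m where "m = degree p"
  have "m > 0"
  proof (rule ccontr)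
    assume "\<not> m > 0"
    then have "degree p = 0" by (simp add: m_def)
    then obtain a where "p = [:a:]" by (metis degree_eq_zeroE)
    then have "p = 1" using p(2) by simp
    then show False using p(1) by simp
  qed
  have "0 = (\<Sum>i\<le>m. of_int (coeff p i) * x ^ i)"
    using p(1) by (simp add: poly_altdef m_def)
  also have "\<dots> = (\<Sum>i<m. of_int (coeff p i) * x ^ i) + x ^ m"
    using p(2) by (simp add: m_def lessThan_Suc_atMost[symmetric])
  finally have "x ^ m = (\<Sum>i<m. of_int (- coeff p i) * x ^ i)"
    by (simp add: sum_negf eq_neg_iff_add_eq_0 add.commute)
  then have "x ^ m \<in> zspan {..<m} (\<lambda>i. x ^ i)" by (simp add: zspan_def image_iff exI[of _ "\<lambda>i. - coeff p i"])
  with \<open>m > 0\<close> show ?thesis using that by blast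
qed

text \<open>The products x^i y^j with i < m and j < n span a nonzero finitely generated module
  stable under multiplication by x and by y, hence by x + y and x y.\<close>

lemma algebraic_int_ring:
  fixes x y :: complex
  assumes "algebraic_int x" "algebraic_int y"
  shows "algebraic_int (x + y)" "algebraic_int (x * y)"
proof -
  obtain m where m: "m > 0" "x ^ m \<in> zspan {..<m} (\<lambda>i. x ^ i)" using algebraic_int_power_span assms(1) by blast
  obtain n where n: "n > 0" "y ^ n \<in> zspan {..<n} (\<lambda>i. y ^ i)" using algebraic_int_power_span assms(2) by blast
  define I where "I = {..<m} \<times> {..<n}"
  define v where "v = (\<lambda>(i, j). x ^ i * y ^ j)"
  have fin: "finite I" by (simp add: I_def)
  have vb: "x ^ i * y ^ j \<in> zspan I v" if "i < m" "j < n" for i j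
    using zspan_base[OF fin, of "(i, j)" v] that by (simp add: I_def v_def)
  have x: "x * v k \<in> zspan I v" if "k \<in> I" for k
  proof -
    obtain i j where k: "k = (i, j)" "i < m" "j < n" using \<open>k \<in> I\<close> unfolding I_def by auto
    show ?thesis
    proof (cases "Suc i < m")
      case True
      then show ?thesis using vb[of "Suc i" j] k by (simp add: v_def mult.assoc)
    next
      case False
      then have "m = Suc i" using k by simp
      from m(2) obtain c :: "nat \<Rightarrow> int" where c: "x ^ m = (\<Sum>i<m. of_int (c i) * x ^ i)" by (auto simp: zspan_def)
      have "x * v k = x ^ m * y ^ j" using \<open>m = Suc i\<close> k by (simp add: v_def)
      also have "\<dots> = (\<Sum>i<m. of_int (c i) * (x ^ i * y ^ j))" unfolding c by (simp add: sum_distrib_right mult.assoc)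
      also have "\<dots> \<in> zspan I v" by (intro zspan_sum zspan_mult vb) (use k in auto)
      finally show ?thesis .
    qed
  qed
  have y: "y * v k \<in> zspan I v" if "k \<in> I" for k
  proof -
    obtain i j where k: "k = (i, j)" "i < m" "j < n" using \<open>k \<in> I\<close> unfolding I_def by auto
    show ?thesis
    proof (cases "Suc j < n")
      case True
      then show ?thesis using vb[of i "Suc j"] k by (simp add: v_def mult_ac)
    next
      case False
      then have "n = Suc j" using k by simp
      from n(2) obtain c :: "nat \<Rightarrow> int" where c: "y ^ n = (\<Sum>i<n. of_int (c i) * y ^ i)" by (auto simp: zspan_def)
      have "y * v k = x ^ i * y ^ n" using \<open>n = Suc j\<close> k by (simp add: v_def mult_ac)
      also have "\<dots> = (\<Sum>j<n. of_int (c j) * (x ^ i * y ^ j))" unfolding c by (simp add: sum_distrib_left mult_ac)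
      also have "\<dots> \<in> zspan I v" by (intro zspan_sum zspan_mult vb) (use k in auto)
      finally show ?thesis .
    qed
  qed
  have i0: "(0, 0) \<in> I" "v (0, 0) \<noteq> 0" using m n by (auto simp: I_def v_def)
  show "algebraic_int (x + y)"
    using x y by (intro algebraic_int_of_zspan[where I = I and v = v, OF fin i0]) (auto simp: distrib_right intro: zspan_add)
  show "algebraic_int (x * y)"
  proof (intro algebraic_int_of_zspan[where I = I and v = v, OF fin i0])
    fix i assume "i \<in> I"
    then have "x * (y * v i) \<in> zspan I v"
      using zspan_closed_mult[of I x v "y * v i"] x y by blast
    then show "x * y * v i \<in> zspan I v" by (simp add: mult.assoc)
  qed
qed

lemma algebraic_int_diff:
  fixes x y :: complex
  assumes "algebraic_int x" "algebraic_int y"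
  shows "algebraic_int (x - y)"
  using algebraic_int_ring(1)[OF assms(1) algebraic_int_minus[OF assms(2)]] by simp

lemma algebraic_int_power:
  fixes x :: complex
  assumes "algebraic_int x"
  shows "algebraic_int (x ^ n)"
  by (induction n) (auto intro: algebraic_int_ring assms)

text \<open>Multiplying the equation by l^(n - 1), with l its leading coefficient, turns it into a
  monic equation for l x.\<close>

lemma algebraic_times_lead_coeff:
  fixes p :: "int poly" and x :: complex
  assumes "poly (map_poly of_int p) x = 0" "p \<noteq> 0"
  shows "algebraic_int (of_int (lead_coeff p) * x)"
proof -
  define n where "n = degree p"
  define l where "l = lead_coeff p"
  have "l \<noteq> 0" using assms by (simp add: l_def)
  have n: "n > 0"
  proof (rule ccontr)
    assume "\<not> n > 0"
    then obtain a where "p = [:a:]" using n_def by (metis degree_eq_zeroE gr0I)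
    then show False using assms by auto
  qed
  let ?I = "{..<n}" and ?v = "\<lambda>i. (of_int l * x) ^ i"
  have pw: "of_int (l ^ (n - 1)) * (\<Sum>i\<le>n. of_int (coeff p i) * x ^ i) = 0"
    using assms(1) by (simp add: poly_altdef n_def)
  have "(\<Sum>i\<le>n. of_int (coeff p i) * x ^ i) = (\<Sum>i<n. of_int (coeff p i) * x ^ i) + of_int l * x ^ n"
    by (simp add: lessThan_Suc_atMost[symmetric] l_def n_def)
  then have "(of_int l * x) ^ n = - (of_int (l ^ (n - 1)) * (\<Sum>i<n. of_int (coeff p i) * x ^ i))"
    using pw n by (cases n) (simp_all add: algebra_simps power_mult_distrib eq_neg_iff_add_eq_0)
  also have "\<dots> = (\<Sum>i<n. of_int (- coeff p i * l ^ (n - 1 - i)) * (of_int l * x) ^ i)"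
  proof -
    have "complex_of_int l ^ (n - 1) = of_int l ^ (n - 1 - i) * of_int l ^ i" if "i < n" for i
      using that by (simp flip: power_add)
    then show ?thesis
      by (auto simp: sum_distrib_left sum_negf power_mult_distrib mult_ac intro!: sum.cong)
  qed
  finally have e: "(of_int l * x) ^ n \<in> zspan ?I ?v"
    by (rule zspanI)
  have "of_int l * x * ?v i \<in> zspan ?I ?v" if "i \<in> ?I" for i
  proof (cases "Suc i < n")
    case True
    then show ?thesis using zspan_base[of ?I "Suc i" ?v] by simp
  next
    case False
    then have "n = Suc i" using that by simp
    then show ?thesis using e by simp
  qed
  then have "algebraic_int (of_int l * x)"
    using n by (intro algebraic_int_of_zspan[of ?I 0 ?v]) auto
  then show ?thesis by (simp add: l_def)
qed

lemma algebraic_altdef_ipoly: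
  fixes x :: complex
  shows "algebraic x \<longleftrightarrow> (\<exists>p::int poly. poly (map_poly of_int p) x = 0 \<and> p \<noteq> 0)"
proof
  assume "algebraic x"
  then obtain p where p: "\<And>i. coeff p i \<in> \<int>" "p \<noteq> 0" "poly p x = 0" by (auto simp: algebraic_def)
  then obtain q :: "int poly" where "p = map_poly of_int q" 
    using intpolyE by metis
  then show "\<exists>p::int poly. poly (map_poly of_int p) x = 0 \<and> p \<noteq> 0" using p by auto
next
  assume "\<exists>p::int poly. poly (map_poly of_int p) x = 0 \<and> p \<noteq> 0"
  then show "algebraic x"
    by (auto intro!: algebraicI[where p = "map_poly of_int _"] simp: coeff_map_poly)
qed

lemma algebraicE_int:
  assumes "algebraic (x :: complex)"
  obtains p :: "int poly" where "p \<noteq> 0" "poly (map_poly of_int p) x = 0"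
  using assms that by (auto simp: algebraic_altdef_ipoly)

lemma algebraic_imp_int_multiple:
  assumes "algebraic (x :: complex)"
  obtains k :: int where "k \<noteq> 0" "algebraic_int (of_int k * x)"
proof -
  obtain p :: "int poly" where "p \<noteq> 0" "poly (map_poly of_int p) x = 0" using algebraicE_int assms by blast
  then show ?thesis using algebraic_times_lead_coeff[of p x] that[of "lead_coeff p"] by simp
qed

lemma algebraic_of_int_multiple:
  assumes "k \<noteq> 0" "algebraic_int (of_int k * (x :: complex))"
  shows "algebraic x"
proof -
  from assms(2) obtain p :: "int poly" where p: "poly (map_poly of_int p) (of_int k * x) = 0" "lead_coeff p = 1"
    by (auto simp: algebraic_int_altdef_ipoly)
  have "poly (map_poly of_int (pcompose p [:0, k:])) x = 0"
    using p(1) by (simp add: of_int_hom.map_poly_pcompose poly_pcompose mult.commute of_int_hom.map_poly_pCons_hom)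
  moreover have "pcompose p [:0, k:] \<noteq> 0" using p(2) assms(1) by (auto simp: pcompose_eq_0_iff)
  ultimately show ?thesis unfolding algebraic_altdef_ipoly by blast
qed

lemma algebraic_ring:
  assumes "algebraic (x :: complex)" "algebraic y"
  shows "algebraic (x + y)" "algebraic (x * y)"
proof -
  obtain k where k: "k \<noteq> 0" "algebraic_int (of_int k * x)" using assms algebraic_imp_int_multiple by blast
  obtain l where l: "l \<noteq> 0" "algebraic_int (of_int l * y)" using assms algebraic_imp_int_multiple by blast
  have "algebraic_int (of_int l * (of_int k * x) + of_int k * (of_int l * y))"
    by (intro algebraic_int_ring k l) auto
  then have "algebraic_int (of_int (k * l) * (x + y))" by (simp add: algebra_simps)
  then show "algebraic (x + y)" using algebraic_of_int_multiple k l by (metis mult_eq_0_iff)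
  have "algebraic_int ((of_int k * x) * (of_int l * y))"
    by (intro algebraic_int_ring k l)
  then have "algebraic_int (of_int (k * l) * (x * y))" by (simp add: algebra_simps)
  then show "algebraic (x * y)" using algebraic_of_int_multiple k l by (metis mult_eq_0_iff)
qed

lemma algebraic_of_int_complex [simp]: "algebraic (of_int k :: complex)"
  by (rule algebraic_int_imp_algebraic) simp

lemma algebraic_0_1 [simp]: "algebraic (0 :: complex)" "algebraic (1 :: complex)"
  using algebraic_of_int_complex[of 0] algebraic_of_int_complex[of 1] by auto

lemma algebraic_uminus [intro]: "algebraic (x :: complex) \<Longrightarrow> algebraic (- x)"
  using algebraic_ring(2)[of "of_int (-1)" x] by simp

lemma algebraic_diff: "algebraic (x :: complex) \<Longrightarrow> algebraic y \<Longrightarrow> algebraic (x - y)"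
  using algebraic_ring(1)[of x "- y"] by auto

lemma algebraic_of_rat_complex [simp]: "algebraic (of_rat k :: complex)"
proof -
  obtain a b where "k = of_int a / of_int b" "b \<noteq> 0" using quotient_of_div[of k] quotient_of_denom_pos[of k]
    by (metis old.prod.exhaust less_irrefl)
  then have "of_int b * (of_rat k :: complex) = of_int a" by (simp add: of_rat_divide)
  then show ?thesis using algebraic_of_int_multiple[of b "of_rat k"] \<open>b \<noteq> 0\<close> by simp
qed

section \<open>Automorphisms of the field of algebraic numbers\<close>

interpretation of_rat_poly_hom: map_poly_comm_ring_hom "of_rat :: rat \<Rightarrow> complex" ..

text \<open>A homomorphism from a ring of algebraic numbers to the complex numbers, given by its graph.\<close>

locale partial_hom =
  fixes \<Gamma> :: "(complex \<times> complex) set"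
  assumes one: "(1, 1) \<in> \<Gamma>"
    and alg: "(x, y) \<in> \<Gamma> \<Longrightarrow> algebraic x"
    and zero_unique: "(0, y) \<in> \<Gamma> \<Longrightarrow> y = 0"
    and diff: "(x, y) \<in> \<Gamma> \<Longrightarrow> (x', y') \<in> \<Gamma> \<Longrightarrow> (x - x', y - y') \<in> \<Gamma>"
    and mult: "(x, y) \<in> \<Gamma> \<Longrightarrow> (x', y') \<in> \<Gamma> \<Longrightarrow> (x * x', y * y') \<in> \<Gamma>"
begin

lemma zero: "(0, 0) \<in> \<Gamma>"
  using diff[OF one one] by simp

lemma uminus: "(x, y) \<in> \<Gamma> \<Longrightarrow> (- x, - y) \<in> \<Gamma>"
  using diff[OF zero, of x y] by simp

lemma add: "(x, y) \<in> \<Gamma> \<Longrightarrow> (x', y') \<in> \<Gamma> \<Longrightarrow> (x + x', y + y') \<in> \<Gamma>"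
  using diff[of x y "- x'" "- y'"] uminus by simp

lemma functional: "(x, y) \<in> \<Gamma> \<Longrightarrow> (x, y') \<in> \<Gamma> \<Longrightarrow> y = y'"
  using diff[of x y x y'] zero_unique by fastforce

lemma of_nat: "(of_nat n, of_nat n) \<in> \<Gamma>"
  by (induction n) (auto intro: zero one add)

lemma of_int: "(of_int n, of_int n) \<in> \<Gamma>"
  by (cases n rule: int_cases2) (use of_nat uminus in force)+

lemma sum: "(\<And>i. i \<in> A \<Longrightarrow> (f i, g i) \<in> \<Gamma>) \<Longrightarrow> (sum f A, sum g A) \<in> \<Gamma>"
  by (induction A rule: infinite_finite_induct) (auto intro: zero add)

lemma power: "(x, y) \<in> \<Gamma> \<Longrightarrow> (x ^ n, y ^ n) \<in> \<Gamma>"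
  by (induction n) (auto intro: one mult)

lemma ipoly: "(x, y) \<in> \<Gamma> \<Longrightarrow> (poly (map_poly of_int p) x, poly (map_poly of_int p) y) \<in> \<Gamma>"
proof -
  assume "(x, y) \<in> \<Gamma>"
  then have "(\<Sum>i\<le>degree p. of_int (coeff p i) * x ^ i, \<Sum>i\<le>degree p. of_int (coeff p i) * y ^ i) \<in> \<Gamma>"
    by (intro sum mult of_int power)
  then show ?thesis by (simp add: poly_altdef)
qed

lemma ipoly_root: "(x, y) \<in> \<Gamma> \<Longrightarrow> poly (map_poly of_int p) x = 0 \<Longrightarrow> poly (map_poly of_int p) y = 0"
  using ipoly[of x y p] zero_unique by simp

text \<open>If \<open>x \<noteq> 0\<close>, then \<open>x\<close> divides a nonzero integer with an algebraic cofactor in the ring.\<close>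

lemma zero_unique': "(x, 0) \<in> \<Gamma> \<Longrightarrow> x = 0"
proof (rule ccontr)
  assume x: "(x, 0) \<in> \<Gamma>" "x \<noteq> 0"
  define P where "P = (\<lambda>n. \<exists>p :: int poly. p \<noteq> 0 \<and> poly (map_poly of_int p) x = 0 \<and> degree p = n)"
  have "\<exists>n. P n" using alg[OF x(1)] unfolding P_def algebraic_altdef_ipoly by blast
  then have "P (LEAST n. P n)" by (rule LeastI_ex)
  then obtain p :: "int poly" where p: "p \<noteq> 0" "poly (map_poly of_int p) x = 0" and deg: "degree p = (LEAST n. P n)"
    unfolding P_def by blast
  obtain a q where pq: "p = pCons a q" by (cases p)
  have "a \<noteq> 0"
  proof
    assume "a = 0"
    then have "q \<noteq> 0" "poly (map_poly of_int q) x = 0"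
      using p pq x(2) by (auto simp: of_int_hom.map_poly_pCons_hom)
    then have "P (degree q)" unfolding P_def by blast
    then have "degree p \<le> degree q" unfolding deg by (rule Least_le)
    then show False using pq \<open>q \<noteq> 0\<close> by simp
  qed
  have "poly (map_poly of_int p) 0 = (0 :: complex)" using ipoly_root[OF x(1) p(2)] .
  then show False using pq \<open>a \<noteq> 0\<close> by (simp add: of_int_hom.map_poly_pCons_hom)
qed

definition pp :: "(complex poly \<times> complex poly) set" where
  "pp = {(p, q). \<forall>i. (coeff p i, coeff q i) \<in> \<Gamma>}"

lemma pp_diff: "(p, q) \<in> pp \<Longrightarrow> (p', q') \<in> pp \<Longrightarrow> (p - p', q - q') \<in> pp"
  by (auto simp: pp_def intro: diff)

lemma pp_mult: "(p, q) \<in> pp \<Longrightarrow> (p', q') \<in> pp \<Longrightarrow> (p * p', q * q') \<in> pp"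
  by (auto simp: pp_def coeff_mult intro!: sum mult)

lemma pp_const: "(x, y) \<in> \<Gamma> \<Longrightarrow> ([:x:], [:y:]) \<in> pp"
  by (auto simp: pp_def coeff_pCons zero split: nat.split)

lemma pp_X: "([:0, 1:], [:0, 1:]) \<in> pp"
  by (auto simp: pp_def coeff_pCons zero one split: nat.split)

lemma pp_monom: "(monom 1 n, monom 1 n) \<in> pp"
  by (auto simp: pp_def zero one)

lemma pp_of_int: "(map_poly of_int p, map_poly of_int p) \<in> pp"
  by (auto simp: pp_def coeff_map_poly of_int)

lemma pp_0: "(0, q) \<in> pp \<Longrightarrow> q = 0"
  by (auto simp: pp_def intro!: poly_eqI zero_unique)

lemma pp_degree: "(p, q) \<in> pp \<Longrightarrow> degree q = degree p"
proof (rule antisym)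
  assume pq: "(p, q) \<in> pp"
  show "degree q \<le> degree p"
  proof (rule degree_le, intro allI impI)
    fix i assume "degree p < i"
    moreover have "(coeff p i, coeff q i) \<in> \<Gamma>" using pq by (simp add: pp_def)
    ultimately show "coeff q i = 0" using zero_unique by (simp add: coeff_eq_0)
  qed
  show "degree p \<le> degree q"
  proof (rule degree_le, intro allI impI)
    fix i assume "degree q < i"
    moreover have "(coeff p i, coeff q i) \<in> \<Gamma>" using pq by (simp add: pp_def)
    ultimately show "coeff p i = 0" using zero_unique' by (simp add: coeff_eq_0)
  qed
qed

text \<open>\<open>m\<close> has least degree among the nonzero polynomials over the domain of
  \<Gamma> that vanish at \<open>a\<close>, and \<open>b\<close> is a root of its image
  \<open>m'\<close>. Sending \<open>poly p a\<close> to \<open>poly q b\<close> is well defined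
  because every \<open>p\<close> vanishing at \<open>a\<close> is, up to a nonzero factor, a
  multiple of \<open>m\<close>.\<close>

lemma adjoin:
  assumes "algebraic a"
  shows "\<exists>\<Gamma>'. partial_hom \<Gamma>' \<and> \<Gamma> \<subseteq> \<Gamma>' \<and> (\<exists>b. (a, b) \<in> \<Gamma>')"
proof -
  define Q where "Q = (\<lambda>n. \<exists>p q. (p, q) \<in> pp \<and> p \<noteq> 0 \<and> poly p a = 0 \<and> degree p = n)"
  obtain p0 :: "int poly" where "p0 \<noteq> 0" "poly (map_poly of_int p0) a = 0" using algebraicE_int assms by blast
  then have "\<exists>n. Q n" unfolding Q_def using pp_of_int[of p0] by (intro exI) auto
  then have "Q (LEAST n. Q n)" by (rule LeastI_ex)
  then obtain m m' where m: "(m, m') \<in> pp" "m \<noteq> 0" "poly m a = 0" and deg: "degree m = (LEAST n. Q n)"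
    unfolding Q_def by blast
  have min: "p = 0" if "(p, q) \<in> pp" "poly p a = 0" "degree p < degree m" for p q
    using that not_less_Least[of "degree p" Q] deg unfolding Q_def by metis
  have dm: "degree m > 0"
  proof (rule ccontr)
    assume "\<not> degree m > 0"
    then obtain x where "m = [:x:]" by (metis degree_eq_zeroE gr0I)
    then show False using m by auto
  qed
  have dm': "degree m' = degree m" by (rule pp_degree[OF m(1)])
  then have "\<not> constant (poly m')" using dm by (simp add: constant_degree)
  then obtain b where b: "poly m' b = 0" using fundamental_theorem_of_algebra by blast
  have key: "poly q b = 0" if "(p, q) \<in> pp" "poly p a = 0" for p q
    using that
  proof (induction "degree p" arbitrary: p q rule: less_induct)
    case less
    show ?case
    proof (cases "degree p < degree m")
      case True
      then have "p = 0" using min less.prems by blast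
      then show ?thesis using less.prems(1) pp_0[of q] by simp
    next
      case False
      define k where "k = degree p - degree m"
      define lp lq lm lm' where "lp = lead_coeff p" "lq = coeff q (degree p)" "lm = lead_coeff m" "lm' = coeff m' (degree m)"
      note l = this
      have lG: "(lp, lq) \<in> \<Gamma>" "(lm, lm') \<in> \<Gamma>" using less.prems m(1) by (auto simp: l pp_def)
      \<comment> \<open>The domain is a ring, so division by \<open>m\<close> is replaced by
        cross-multiplication with the leading coefficients; the factor \<open>lm'\<close> can be
        cancelled afterwards because the homomorphism is injective
        (\<open>zero_unique'\<close>).\<close>
      define p1 where "p1 = [:lm:] * p - [:lp:] * (monom 1 k * m)"
      define q1 where "q1 = [:lm':] * q - [:lq:] * (monom 1 k * m')"
      have pq1: "(p1, q1) \<in> pp" unfolding p1_def q1_def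
        by (intro pp_diff pp_mult pp_const lG pp_monom m less.prems)
      have p1a: "poly p1 a = 0" by (simp add: p1_def less.prems m)
      have lm': "lm' \<noteq> 0" using zero_unique'[of lm] lG(2) m(2) leading_coeff_0_iff[of m] unfolding l by metis
      have degp: "degree p > 0" using False dm by simp
      have c0: "coeff p1 i = 0" if "i \<ge> degree p" for i
      proof -
        have "coeff (monom 1 k * m) i = coeff m (i - k)"
          using that by (simp add: coeff_monom_mult k_def)
        moreover have "coeff m (i - k) = (if i = degree p then lm else 0)"
          using that False by (auto simp: k_def l intro!: coeff_eq_0)
        moreover have "coeff p i = (if i = degree p then lp else 0)"
          using that by (auto simp: l intro!: coeff_eq_0)
        ultimately show ?thesis by (simp add: p1_def)
      qed
      have "degree p1 < degree p"
        using c0 degp by (metis degree_0 leading_coeff_0_iff not_le)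
      then have "poly q1 b = 0" using less.hyps pq1 p1a by blast
      then show ?thesis using lm' b by (simp add: q1_def)
    qed
  qed
  define \<Gamma>' where "\<Gamma>' = (\<lambda>(p, q). (poly p a, poly q b)) ` pp"
  have memI: "(poly p a, poly q b) \<in> \<Gamma>'" if "(p, q) \<in> pp" for p q
    unfolding \<Gamma>'_def using that by force
  have memE: "\<exists>p q. (p, q) \<in> pp \<and> x = poly p a \<and> y = poly q b" if "(x, y) \<in> \<Gamma>'" for x y
    using that unfolding \<Gamma>'_def by auto
  have sub: "\<Gamma> \<subseteq> \<Gamma>'" using memI[OF pp_const] by auto
  have "partial_hom \<Gamma>'"
  proof
    show "(1, 1) \<in> \<Gamma>'" using sub one by blast
    show "algebraic x" if xy: "(x, y) \<in> \<Gamma>'" for x y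
    proof -
      obtain p q where p: "(p, q) \<in> pp" "x = poly p a" using memE[OF xy] by blast
      have "algebraic (\<Sum>i\<in>A. coeff p i * a ^ i)" for A
      proof (induction A rule: infinite_finite_induct)
        case (insert i A)
        have "algebraic (a ^ i)" by (induction i) (auto intro: algebraic_ring assms)
        moreover have "algebraic (coeff p i)" using p(1) alg by (auto simp: pp_def)
        ultimately show ?case using insert by (auto intro: algebraic_ring)
      qed auto
      then show ?thesis by (simp add: p(2) poly_altdef)
    qed
    show "y = 0" if "(0, y) \<in> \<Gamma>'" for y
      using memE[OF that] key by metis
    fix x y x' y' assume "(x, y) \<in> \<Gamma>'" "(x', y') \<in> \<Gamma>'"
    then obtain p q p' q' where "(p, q) \<in> pp" "x = poly p a" "y = poly q b"
      "(p', q') \<in> pp" "x' = poly p' a" "y' = poly q' b" by (metis memE)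
    then show "(x - x', y - y') \<in> \<Gamma>'" "(x * x', y * y') \<in> \<Gamma>'"
      using memI[OF pp_diff[of p q p' q']] memI[OF pp_mult[of p q p' q']] by simp_all
  qed
  moreover have "(a, b) \<in> \<Gamma>'" using memI[OF pp_X] by simp
  ultimately show ?thesis using sub by blast
qed

lemma maximal_extension:
  obtains \<Delta> where "partial_hom \<Delta>" "\<Gamma> \<subseteq> \<Delta>" "\<And>\<Delta>'. partial_hom \<Delta>' \<Longrightarrow> \<Delta> \<subseteq> \<Delta>' \<Longrightarrow> \<Delta>' = \<Delta>"
proof -
  let ?S = "{\<Delta>. partial_hom \<Delta> \<and> \<Gamma> \<subseteq> \<Delta>}"
  have ne: "?S \<noteq> {}" using partial_hom_axioms by blast
  have "\<exists>M\<in>?S. \<forall>X\<in>?S. M \<subseteq> X \<longrightarrow> X = M"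
  proof (rule subset_Zorn_nonempty[OF ne])
    fix C assume C: "C \<noteq> {}" "subset.chain ?S C"
    have "partial_hom (\<Union>C)"
    proof
      show "(1, 1) \<in> \<Union>C" using C by (auto simp: subset_chain_def partial_hom_def)
      show "algebraic x" if "(x, y) \<in> \<Union>C" for x y
        using that C partial_hom.alg by (auto simp: subset_chain_def)
      show "y = 0" if "(0, y) \<in> \<Union>C" for y
        using that C partial_hom.zero_unique by (auto simp: subset_chain_def)
      fix x y x' y' assume xy: "(x, y) \<in> \<Union>C" "(x', y') \<in> \<Union>C"
      obtain X Y where "X \<in> C" "(x, y) \<in> X" "Y \<in> C" "(x', y') \<in> Y" using xy by blast
      then obtain Z where Z: "Z \<in> C" "(x, y) \<in> Z" "(x', y') \<in> Z"
        using C(2) unfolding subset_chain_def by (metis subsetD)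
      then have "partial_hom Z" using C(2) by (auto simp: subset_chain_def)
      then show "(x - x', y - y') \<in> \<Union>C" "(x * x', y * y') \<in> \<Union>C"
        using Z partial_hom.diff partial_hom.mult by blast+
    qed
    moreover have "\<Gamma> \<subseteq> \<Union>C" using C unfolding subset_chain_def by blast
    ultimately show "\<Union>C \<in> ?S" by blast
  qed
  then show ?thesis using that by (smt (verit, best) mem_Collect_eq subset_trans)
qed

lemma total_extension:
  obtains \<Delta> where "partial_hom \<Delta>" "\<Gamma> \<subseteq> \<Delta>" "\<And>a. algebraic a \<Longrightarrow> \<exists>b. (a, b) \<in> \<Delta>"
proof -
  obtain \<Delta> where D: "partial_hom \<Delta>" "\<Gamma> \<subseteq> \<Delta>" "\<And>\<Delta>'. partial_hom \<Delta>' \<Longrightarrow> \<Delta> \<subseteq> \<Delta>' \<Longrightarrow> \<Delta>' = \<Delta>"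
    using maximal_extension by blast
  show ?thesis using that[OF D(1,2)] partial_hom.adjoin[OF D(1)] D(3) by metis
qed

text \<open>Injectivity of a total extension is \<open>zero_unique'\<close>. It is onto
  \<open>qbar\<close> because the finite set of roots of each integer polynomial is mapped
  injectively into itself.\<close>

lemma extend_to_gal_Q:
  obtains \<sigma> where "\<sigma> \<in> gal_Q" "\<And>x y. (x, y) \<in> \<Gamma> \<Longrightarrow> \<sigma> x = y"
proof -
  obtain \<Delta> where D: "partial_hom \<Delta>" "\<Gamma> \<subseteq> \<Delta>" "\<And>a. algebraic a \<Longrightarrow> \<exists>b. (a, b) \<in> \<Delta>"
    using total_extension by blast
  interpret D: partial_hom \<Delta> by fact
  define \<sigma> where "\<sigma> = (\<lambda>x. if algebraic x then THE y. (x, y) \<in> \<Delta> else x)"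
  have s: "(x, \<sigma> x) \<in> \<Delta>" if x: "algebraic x" for x
  proof -
    have "\<exists>!y. (x, y) \<in> \<Delta>" using D(3)[OF x] D.functional by blast
    then have "(x, THE y. (x, y) \<in> \<Delta>) \<in> \<Delta>" by (rule theI')
    then show ?thesis using x by (simp add: \<sigma>_def)
  qed
  have eq: "\<sigma> x = y" if "(x, y) \<in> \<Delta>" for x y
    using that s D.functional D.alg by blast
  have alg_s: "algebraic (\<sigma> x)" if "algebraic x" for x
    using that D.ipoly_root[OF s[OF that]] unfolding algebraic_altdef_ipoly by blast
  have inj: "inj_on \<sigma> qbar"
  proof (rule inj_onI)
    fix x y assume "x \<in> qbar" "y \<in> qbar" "\<sigma> x = \<sigma> y"
    then have "(x - y, 0) \<in> \<Delta>" using D.diff[OF s s, of x y] by (simp add: qbar_def)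
    then show "x = y" using D.zero_unique' by fastforce
  qed
  have surj: "\<exists>x\<in>qbar. \<sigma> x = y" if "y \<in> qbar" for y
  proof -
    have "algebraic y" using that by (simp add: qbar_def)
    then obtain p :: "int poly" where p: "p \<noteq> 0" "poly (map_poly of_int p) y = 0"
      by (rule algebraicE_int)
    define R where "R = {x. poly (map_poly of_int p) x = (0 :: complex)}"
    have fin: "finite R" unfolding R_def using p by (intro poly_roots_finite) auto
    have RA: "R \<subseteq> qbar" using p by (auto simp: R_def qbar_def algebraic_altdef_ipoly)
    have "\<sigma> ` R \<subseteq> R" using D.ipoly_root[OF s] RA by (auto simp: R_def qbar_def)
    then have "\<sigma> ` R = R" using endo_inj_surj[OF fin] inj_on_subset[OF inj RA] by blast
    moreover have "y \<in> R" using p(2) by (simp add: R_def)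
    ultimately have "y \<in> \<sigma> ` R" by simp
    then obtain x where "x \<in> R" "y = \<sigma> x" by (rule imageE)
    then show ?thesis using RA by auto
  qed
  have "\<sigma> \<in> gal_Q"
    unfolding gal_Q_def
  proof (intro CollectI conjI ballI allI impI)
    show "bij_betw \<sigma> qbar qbar"
      unfolding bij_betw_def using inj alg_s surj by (auto simp: qbar_def)
    show "\<sigma> z = z" if "z \<notin> qbar" for z using that by (simp add: \<sigma>_def qbar_def)
    show "\<sigma> (a + b) = \<sigma> a + \<sigma> b" "\<sigma> (a * b) = \<sigma> a * \<sigma> b" if "a \<in> qbar" "b \<in> qbar" for a b
      using that by (auto simp: qbar_def intro!: eq D.add D.mult s)
    show "\<sigma> 1 = 1" using eq D.one by blast
  qed
  then show ?thesis using that eq D(2) by blast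
qed

end

lemma qbar_ring: "x \<in> qbar \<Longrightarrow> y \<in> qbar \<Longrightarrow> x + y \<in> qbar" "x \<in> qbar \<Longrightarrow> y \<in> qbar \<Longrightarrow> x * y \<in> qbar"
  "x \<in> qbar \<Longrightarrow> y \<in> qbar \<Longrightarrow> x - y \<in> qbar" "x \<in> qbar \<Longrightarrow> - x \<in> qbar" "of_int k \<in> qbar" "0 \<in> qbar" "1 \<in> qbar" "of_rat r \<in> qbar"
  by (auto simp: qbar_def algebraic_ring algebraic_diff)

lemma qbar_power: "x \<in> qbar \<Longrightarrow> x ^ n \<in> qbar"
  by (induction n) (auto intro: qbar_ring)

lemma qbar_sum: "(\<And>i. i \<in> A \<Longrightarrow> f i \<in> qbar) \<Longrightarrow> sum f A \<in> qbar"
  by (induction A rule: infinite_finite_induct) (auto intro: qbar_ring)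

lemma qbar_prod: "(\<And>i. i \<in> A \<Longrightarrow> f i \<in> qbar) \<Longrightarrow> prod f A \<in> qbar"
  by (induction A rule: infinite_finite_induct) (auto intro: qbar_ring)

lemma ipoly_root_qbar: "p \<noteq> 0 \<Longrightarrow> poly (map_poly of_int (p :: int poly)) x = 0 \<Longrightarrow> x \<in> qbar"
  by (auto simp: qbar_def algebraic_altdef_ipoly)

lemma qbar_rat_poly: "x \<in> qbar \<Longrightarrow> poly (map_poly of_rat p) x \<in> qbar"
  unfolding poly_altdef by (auto intro!: qbar_sum qbar_ring qbar_power)

context
  fixes \<sigma> assumes gal: "\<sigma> \<in> gal_Q"
begin

lemma gal_add: "a \<in> qbar \<Longrightarrow> b \<in> qbar \<Longrightarrow> \<sigma> (a + b) = \<sigma> a + \<sigma> b"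
  and gal_mult: "a \<in> qbar \<Longrightarrow> b \<in> qbar \<Longrightarrow> \<sigma> (a * b) = \<sigma> a * \<sigma> b"
  and gal_1: "\<sigma> 1 = 1"
  and gal_bij: "bij_betw \<sigma> qbar qbar"
  using gal by (auto simp: gal_Q_def)

lemma gal_qbar: "a \<in> qbar \<Longrightarrow> \<sigma> a \<in> qbar"
  using gal_bij by (auto simp: bij_betw_def)

lemma gal_inj: "a \<in> qbar \<Longrightarrow> b \<in> qbar \<Longrightarrow> \<sigma> a = \<sigma> b \<longleftrightarrow> a = b"
  using gal_bij by (auto simp: bij_betw_def inj_on_def)

lemma gal_permutes: "finite S \<Longrightarrow> S \<subseteq> qbar \<Longrightarrow> \<sigma> ` S \<subseteq> S \<Longrightarrow> bij_betw \<sigma> S S"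
  using endo_inj_surj[of S \<sigma>] inj_on_subset[of \<sigma> qbar S] gal_bij by (auto simp: bij_betw_def)

lemma gal_0: "\<sigma> 0 = 0"
  using gal_add[of 0 0] qbar_ring by simp

lemma gal_uminus: "a \<in> qbar \<Longrightarrow> \<sigma> (- a) = - \<sigma> a"
  using gal_add[of a "- a"] qbar_ring gal_0 by (simp add: add_eq_0_iff)

lemma gal_diff: "a \<in> qbar \<Longrightarrow> b \<in> qbar \<Longrightarrow> \<sigma> (a - b) = \<sigma> a - \<sigma> b"
  using gal_add[of a "- b"] gal_uminus[of b] qbar_ring by simp

lemma gal_of_nat: "\<sigma> (of_nat n) = of_nat n"
proof (induction n)
  case (Suc n)
  have "of_nat n \<in> qbar" using qbar_ring(5)[of "int n"] by simp
  then show ?case using Suc gal_add[of 1 "of_nat n"] qbar_ring(7) gal_1 by simp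
qed (simp add: gal_0)

lemma gal_of_int: "\<sigma> (of_int n) = of_int n"
  by (cases n rule: int_cases2)
     (use gal_of_nat gal_uminus[OF qbar_ring(5)[of "int _"]] in auto)

lemma gal_power: "a \<in> qbar \<Longrightarrow> \<sigma> (a ^ n) = \<sigma> a ^ n"
  by (induction n) (auto simp: gal_1 gal_mult qbar_power)

lemma gal_sum: "(\<And>i. i \<in> A \<Longrightarrow> f i \<in> qbar) \<Longrightarrow> \<sigma> (sum f A) = (\<Sum>i\<in>A. \<sigma> (f i))"
  by (induction A rule: infinite_finite_induct) (auto simp: gal_0 gal_add qbar_sum)

lemma gal_prod: "(\<And>i. i \<in> A \<Longrightarrow> f i \<in> qbar) \<Longrightarrow> \<sigma> (prod f A) = (\<Prod>i\<in>A. \<sigma> (f i))"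
  by (induction A rule: infinite_finite_induct) (auto simp: gal_1 gal_mult qbar_prod)

lemma gal_fixes_sum_prod:
  assumes "finite S" "S \<subseteq> qbar" "\<sigma> ` S \<subseteq> S"
  shows "\<sigma> (\<Sum>S) = \<Sum>S" "\<sigma> (\<Prod>S) = \<Prod>S"
proof -
  note bij = gal_permutes[OF assms]
  show "\<sigma> (\<Sum>S) = \<Sum>S" using gal_sum[of S "\<lambda>x. x"] assms(2) sum.reindex_bij_betw[OF bij, of "\<lambda>x. x"] by auto
  show "\<sigma> (\<Prod>S) = \<Prod>S" using gal_prod[of S "\<lambda>x. x"] assms(2) prod.reindex_bij_betw[OF bij, of "\<lambda>x. x"] by auto
qed

lemma gal_ipoly: "x \<in> qbar \<Longrightarrow> \<sigma> (poly (map_poly of_int p) x) = poly (map_poly of_int p) (\<sigma> x)"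
  by (auto simp: poly_altdef gal_sum gal_mult gal_power gal_of_int qbar_ring qbar_power)

text \<open>The inverted graph of \<sigma> is again a partial homomorphism, so the extension result
  supplies the inverse as an element of \<open>gal_Q\<close>.\<close>

lemma gal_inv: obtains \<tau> where "\<tau> \<in> gal_Q" "\<And>x. x \<in> qbar \<Longrightarrow> \<tau> (\<sigma> x) = x" "\<And>x. x \<in> qbar \<Longrightarrow> \<sigma> (\<tau> x) = x"
proof -
  interpret partial_hom "(\<lambda>x. (\<sigma> x, x)) ` qbar"
  proof
    show "(1, 1) \<in> (\<lambda>x. (\<sigma> x, x)) ` qbar" using gal_1 qbar_ring by force
    show "algebraic x" if "(x, y) \<in> (\<lambda>x. (\<sigma> x, x)) ` qbar" for x y
      using that gal_qbar by (auto simp: qbar_def)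
    show "y = 0" if "(0, y) \<in> (\<lambda>x. (\<sigma> x, x)) ` qbar" for y
      using that gal_0 gal_inj qbar_ring by (metis (no_types, lifting) Pair_inject imageE)
    fix x y x' y' assume "(x, y) \<in> (\<lambda>x. (\<sigma> x, x)) ` qbar" "(x', y') \<in> (\<lambda>x. (\<sigma> x, x)) ` qbar"
    then have "x = \<sigma> y" "x' = \<sigma> y'" "y \<in> qbar" "y' \<in> qbar" by auto
    then show "(x - x', y - y') \<in> (\<lambda>x. (\<sigma> x, x)) ` qbar" "(x * x', y * y') \<in> (\<lambda>x. (\<sigma> x, x)) ` qbar"
      by (auto simp: gal_diff gal_mult qbar_ring intro!: image_eqI)
  qed
  obtain \<tau> where t: "\<tau> \<in> gal_Q" "\<And>x y. (x, y) \<in> (\<lambda>x. (\<sigma> x, x)) ` qbar \<Longrightarrow> \<tau> x = y"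
    using extend_to_gal_Q by blast
  have ts: "\<tau> (\<sigma> x) = x" if "x \<in> qbar" for x using t(2) that by blast
  moreover have "\<sigma> (\<tau> x) = x" if "x \<in> qbar" for x
    using that ts gal_bij by (metis bij_betw_def imageE)
  ultimately show ?thesis using t(1) that by blast
qed

end

lemma gal_comp: "\<sigma> \<in> gal_Q \<Longrightarrow> \<tau> \<in> gal_Q \<Longrightarrow> \<sigma> \<circ> \<tau> \<in> gal_Q"
  unfolding gal_Q_def by (auto intro: bij_betw_trans simp: bij_betw_apply)

lemma gal_id: "id \<in> gal_Q"
  by (auto simp: gal_Q_def)

section \<open>Conjugates and the fixed field of \<open>gal_Q\<close>\<close>

lemma rat_poly_dvd_of_common_root:
  fixes P p :: "rat poly" and x :: complex
  assumes "irreducible P" "poly (map_poly of_rat P) x = 0" "poly (map_poly of_rat p) x = 0"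
  shows "P dvd p"
proof (rule ccontr)
  assume "\<not> P dvd p"
  have "coprime P p"
    using irreducible_imp_prime_elem[OF assms(1)] prime_elem_imp_coprime[OF _ \<open>\<not> P dvd p\<close>] by blast
  then obtain u w where "u * P + w * p = 1"
    by (metis bezout_coefficients_fst_snd coprime_imp_gcd_eq_1)
  then have "poly (map_poly of_rat (u * P + w * p)) x = 1" by simp
  then show False using assms by (simp add: of_rat_poly_hom.hom_add of_rat_poly_hom.hom_mult)
qed

text \<open>The map p(x) to p(y) is well defined, since the irreducible \<open>P\<close> divides
  every rational polynomial vanishing at x; it then extends to \<open>qbar\<close>.\<close>

lemma gal_transitive:
  fixes P :: "rat poly"
  assumes "irreducible P" "poly (map_poly of_rat P) x = 0" "poly (map_poly of_rat P) y = 0" "x \<in> qbar"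
  obtains \<sigma> where "\<sigma> \<in> gal_Q" "\<sigma> x = y"
proof -
  let ?G = "range (\<lambda>p :: rat poly. (poly (map_poly of_rat p) x, poly (map_poly of_rat p) y))"
  interpret partial_hom ?G
  proof
    show "(1, 1) \<in> ?G" by (intro image_eqI[where x = 1]) auto
    show "algebraic a" if "(a, b) \<in> ?G" for a b
      using that qbar_rat_poly[OF assms(4)] by (auto simp: qbar_def)
    show "b = 0" if b: "(0, b) \<in> ?G" for b
    proof -
      obtain p where p: "poly (map_poly of_rat p) x = 0" "b = poly (map_poly of_rat p) y" using b by auto
      then have "P dvd p" using rat_poly_dvd_of_common_root assms by blast
      then show ?thesis using p(2) assms(3) by (auto simp: of_rat_poly_hom.hom_mult elim!: dvdE)
    qed
    fix a b a' b' assume "(a, b) \<in> ?G" "(a', b') \<in> ?G"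
    then obtain p p' where "a = poly (map_poly of_rat p) x" "b = poly (map_poly of_rat p) y"
      "a' = poly (map_poly of_rat p') x" "b' = poly (map_poly of_rat p') y" by auto
    then show "(a - a', b - b') \<in> ?G" "(a * a', b * b') \<in> ?G"
      using rangeI[of "\<lambda>p :: rat poly. (poly (map_poly of_rat p) x, poly (map_poly of_rat p) y)" "p - p'"]
        rangeI[of "\<lambda>p :: rat poly. (poly (map_poly of_rat p) x, poly (map_poly of_rat p) y)" "p * p'"]
      by (simp_all add: of_rat_poly_hom.hom_minus of_rat_poly_hom.hom_mult)
  qed
  obtain \<sigma> where "\<sigma> \<in> gal_Q" "\<And>a b. (a, b) \<in> ?G \<Longrightarrow> \<sigma> a = b" using extend_to_gal_Q by blast
  moreover have "(x, y) \<in> ?G"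
    by (intro image_eqI[where x = "[:0, 1:]"]) (auto simp: of_rat_hom.map_poly_pCons_hom)
  ultimately show ?thesis using that by blast
qed

lemma rat_min_poly:
  assumes "x \<in> qbar"
  obtains P :: "rat poly" where "irreducible P" "poly (map_poly of_rat P) x = 0"
    "\<And>p :: rat poly. p \<noteq> 0 \<Longrightarrow> poly (map_poly of_rat p) x = 0 \<Longrightarrow> degree P \<le> degree p"
proof -
  define Q where "Q = (\<lambda>n. \<exists>p :: rat poly. p \<noteq> 0 \<and> poly (map_poly of_rat p) x = 0 \<and> degree p = n)"
  obtain p0 :: "int poly" where p0: "p0 \<noteq> 0" "poly (map_poly of_int p0) x = 0" using algebraicE_int assms by (auto simp: qbar_def)
  have "map_poly of_rat (map_poly of_int p0 :: rat poly) = (map_poly of_int p0 :: complex poly)"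
    by (subst map_poly_map_poly) (auto simp: o_def)
  then have "\<exists>n. Q n" unfolding Q_def using p0 by (intro exI[of _ "degree p0"] exI[of _ "map_poly of_int p0"]) auto
  then have "Q (LEAST n. Q n)" by (rule LeastI_ex)
  then obtain P :: "rat poly" where P: "P \<noteq> 0" "poly (map_poly of_rat P) x = 0" and deg: "degree P = (LEAST n. Q n)"
    unfolding Q_def by blast
  have min: "degree P \<le> degree p" if "p \<noteq> 0" "poly (map_poly of_rat p) x = 0" for p :: "rat poly"
    using that Least_le[of Q "degree p"] deg unfolding Q_def by metis
  have "irreducible P"
  proof (rule irreducibleI)
    show "P \<noteq> 0" by fact
    show "\<not> P dvd 1"
    proof
      assume "P dvd 1"
      then obtain a where "P = [:a:]" "a dvd 1" by (elim is_unit_polyE)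
      then show False using P by auto
    qed
    fix a b assume ab: "P = a * b"
    then have "a \<noteq> 0" "b \<noteq> 0" using P by auto
    then have d: "degree P = degree a + degree b" using ab by (simp add: degree_mult_eq)
    have "poly (map_poly of_rat a) x = 0 \<or> poly (map_poly of_rat b) x = 0"
      using P(2) unfolding ab of_rat_poly_hom.hom_mult by simp
    then have "degree b = 0 \<or> degree a = 0" using min[of a] min[of b] \<open>a \<noteq> 0\<close> \<open>b \<noteq> 0\<close> d by auto
    then show "a dvd 1 \<or> b dvd 1" using \<open>a \<noteq> 0\<close> \<open>b \<noteq> 0\<close> is_unit_iff_degree by blast
  qed
  then show ?thesis using that P min by blast
qed

text \<open>By transitivity a fixed \<open>x\<close> is the only root of its minimal polynomial.
  That polynomial has no multiple root, because its derivative has smaller degree, so it is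
  linear.\<close>

lemma gal_fixed_rat:
  assumes x: "x \<in> qbar" and fixed: "\<And>\<sigma>. \<sigma> \<in> gal_Q \<Longrightarrow> \<sigma> x = x"
  shows "x \<in> \<rat>"
proof -
  obtain P :: "rat poly" where P: "irreducible P" "poly (map_poly of_rat P) x = 0"
    and min: "\<And>p :: rat poly. p \<noteq> 0 \<Longrightarrow> poly (map_poly of_rat p) x = 0 \<Longrightarrow> degree P \<le> degree p"
    using rat_min_poly[OF x] by blast
  have P0: "P \<noteq> 0" using P(1) by auto
  have only: "y = x" if "poly (map_poly of_rat P) y = 0" for y
    using gal_transitive[OF P(1,2) that x] fixed by metis
  obtain Q where Q: "map_poly of_rat P = [:- x, 1:] * Q" using P(2) by (metis dvdE poly_eq_0_iff_dvd)
  have Q0: "Q \<noteq> 0" using Q P0 by auto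
  have dQ: "degree P = Suc (degree Q)"
    using arg_cong[OF Q, of degree] Q0 by (simp add: degree_mult_eq del: mult_pCons_left)
  have "degree Q = 0"
  proof (rule ccontr)
    assume "degree Q \<noteq> 0"
    then have "\<not> constant (poly Q)" using constant_degree by metis
    then obtain y where "poly Q y = 0" using fundamental_theorem_of_algebra by blast
    then have "poly Q x = 0" using only[of y] Q by simp
    then have "poly (pderiv (map_poly of_rat P)) x = 0" unfolding Q by (simp add: pderiv_mult del: mult_pCons_left)
    then have "poly (map_poly of_rat (pderiv P)) x = 0" by (simp add: of_rat_hom.map_poly_pderiv)
    moreover have "pderiv P \<noteq> 0" using dQ by (simp add: pderiv_eq_0_iff)
    ultimately have "degree P \<le> degree (pderiv P)" using min by blast
    then show False using dQ degree_pderiv[of P] by simp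
  qed
  then have "degree P = 1" using dQ by simp
  then have "P = [:coeff P 0, coeff P 1:]"
    by (intro poly_eqI) (auto simp: coeff_pCons coeff_eq_0 split: nat.split)
  moreover have "coeff P 1 \<noteq> 0" using \<open>degree P = 1\<close> P0 by (metis leading_coeff_0_iff)
  ultimately obtain a b where ab: "P = [:a, b:]" "b \<noteq> 0" by metis
  then have "of_rat a + x * of_rat b = 0" using P(2) by (simp add: of_rat_hom.map_poly_pCons_hom)
  then have "x = of_rat (- a / b)" using ab(2) by (simp add: of_rat_divide of_rat_minus field_simps add_eq_0_iff)
  then show ?thesis by simp
qed

section \<open>Prime ideals, inertia and decomposition groups\<close>

text \<open>The subring generated by \<open>R\<close>. It replaces the ring of integers of the
  splitting field; an automorphism is determined on it by its values on \<open>R\<close>.\<close>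

inductive_set zring :: "complex set \<Rightarrow> complex set" for R where
  zring_base: "r \<in> R \<Longrightarrow> r \<in> zring R"
| zring_1: "1 \<in> zring R"
| zring_diff: "x \<in> zring R \<Longrightarrow> y \<in> zring R \<Longrightarrow> x - y \<in> zring R"
| zring_mult: "x \<in> zring R \<Longrightarrow> y \<in> zring R \<Longrightarrow> x * y \<in> zring R"

lemma zring_0: "0 \<in> zring R"
  using zring_diff[OF zring_1 zring_1] by simp

lemma zring_uminus: "x \<in> zring R \<Longrightarrow> - x \<in> zring R"
  using zring_diff[OF zring_0] by force

lemma zring_add: "x \<in> zring R \<Longrightarrow> y \<in> zring R \<Longrightarrow> x + y \<in> zring R"
  using zring_diff[of x R "- y"] zring_uminus by simp

lemma zring_of_nat: "of_nat n \<in> zring R"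
  by (induction n) (auto intro: zring_0 zring_1 zring_add)

lemma zring_of_int: "of_int n \<in> zring R"
  by (cases n rule: int_cases2) (use zring_of_nat zring_uminus in force)+

lemma zring_sum: "(\<And>i. i \<in> A \<Longrightarrow> f i \<in> zring R) \<Longrightarrow> sum f A \<in> zring R"
  by (induction A rule: infinite_finite_induct) (auto intro: zring_0 zring_add)

lemma zring_prod: "(\<And>i. i \<in> A \<Longrightarrow> f i \<in> zring R) \<Longrightarrow> prod f A \<in> zring R"
  by (induction A rule: infinite_finite_induct) (auto intro: zring_1 zring_mult)

lemma zring_power: "x \<in> zring R \<Longrightarrow> x ^ n \<in> zring R"
  by (induction n) (auto intro: zring_1 zring_mult)

lemma zring_ipoly: "x \<in> zring R \<Longrightarrow> poly (map_poly of_int p) x \<in> zring R"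
  by (auto simp: poly_altdef intro!: zring_sum zring_mult zring_power zring_of_int)

lemmas zring_intros = zring_base zring_1 zring_diff zring_mult zring_0 zring_uminus zring_add
  zring_of_int zring_sum zring_prod zring_power zring_ipoly

lemma gal_agree_zring:
  assumes "\<sigma> \<in> gal_Q" "\<tau> \<in> gal_Q" "R \<subseteq> qbar" "\<And>r. r \<in> R \<Longrightarrow> \<sigma> r = \<tau> r" "x \<in> zring R"
  shows "\<sigma> x = \<tau> x \<and> x \<in> qbar"
  using assms(5)
  by induction (use assms in \<open>auto simp: gal_1 gal_diff gal_mult qbar_ring\<close>)

locale galois_stable =
  fixes R :: "complex set"
  assumes finR: "finite R"
    and int: "r \<in> R \<Longrightarrow> algebraic_int r"
    and stable: "\<sigma> \<in> gal_Q \<Longrightarrow> r \<in> R \<Longrightarrow> \<sigma> r \<in> R"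
begin

lemma R_qbar: "R \<subseteq> qbar"
  using int by (auto simp: qbar_def)

lemma zring_int: "x \<in> zring R \<Longrightarrow> algebraic_int x"
  by (induction rule: zring.induct) (auto intro: int algebraic_int_ring algebraic_int_diff)

lemma zring_qbar: "x \<in> zring R \<Longrightarrow> x \<in> qbar"
  using zring_int by (auto simp: qbar_def)

lemma gal_zring: "\<sigma> \<in> gal_Q \<Longrightarrow> x \<in> zring R \<Longrightarrow> \<sigma> x \<in> zring R"
proof -
  assume s: "\<sigma> \<in> gal_Q" and "x \<in> zring R"
  from this(2) show ?thesis
    by induction (auto simp: gal_1[OF s] gal_diff[OF s] gal_mult[OF s] zring_qbar intro: zring_intros stable[OF s])
qed

lemma agree: "\<sigma> \<in> gal_Q \<Longrightarrow> \<tau> \<in> gal_Q \<Longrightarrow> (\<And>r. r \<in> R \<Longrightarrow> \<sigma> r = \<tau> r) \<Longrightarrow> x \<in> zring R \<Longrightarrow> \<sigma> x = \<tau> x"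
  using gal_agree_zring R_qbar by blast

lemma fixed_int:
  assumes "algebraic_int x" "\<And>\<sigma>. \<sigma> \<in> gal_Q \<Longrightarrow> \<sigma> x = x"
  obtains k :: int where "x = of_int k"
proof -
  have "x \<in> qbar" using assms by (auto simp: qbar_def)
  then have "x \<in> \<rat>" using gal_fixed_rat assms(2) by blast
  then show ?thesis using rational_algebraic_int_is_int assms(1) that by (auto elim: Ints_cases)
qed

text \<open>\<open>gal_Q\<close> is infinite, so sums and products over the Galois group of the
  finite extension generated by \<open>R\<close> run over one representative for each action on
  \<open>R\<close>.\<close>

lemma representatives:
  obtains S where "finite S" "S \<subseteq> gal_Q" "\<And>\<sigma>. \<sigma> \<in> gal_Q \<Longrightarrow> \<exists>\<tau>\<in>S. \<forall>r\<in>R. \<sigma> r = \<tau> r"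
    "\<And>\<sigma> \<tau>. \<sigma> \<in> S \<Longrightarrow> \<tau> \<in> S \<Longrightarrow> (\<And>r. r \<in> R \<Longrightarrow> \<sigma> r = \<tau> r) \<Longrightarrow> \<sigma> = \<tau>"
proof -
  define F where "F = (\<lambda>\<sigma>. restrict \<sigma> R) ` gal_Q"
  have "F \<subseteq> R \<rightarrow>\<^sub>E R" using stable by (auto simp: F_def)
  then have finF: "finite F" using finR by (metis finite_PiE finite_subset)
  define c where "c = (\<lambda>f. SOME \<sigma>. \<sigma> \<in> gal_Q \<and> restrict \<sigma> R = f)"
  have c: "c f \<in> gal_Q \<and> restrict (c f) R = f" if "f \<in> F" for f
  proof -
    have "\<exists>\<sigma>. \<sigma> \<in> gal_Q \<and> restrict \<sigma> R = f" using that by (auto simp: F_def)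
    then show ?thesis unfolding c_def by (rule someI_ex)
  qed
  show ?thesis
  proof (rule that[of "c ` F"])
    show "finite (c ` F)" using finF by simp
    show "c ` F \<subseteq> gal_Q" using c by auto
    show "\<exists>\<tau>\<in>c ` F. \<forall>r\<in>R. \<sigma> r = \<tau> r" if s: "\<sigma> \<in> gal_Q" for \<sigma>
    proof -
      have f: "restrict \<sigma> R \<in> F" using s by (auto simp: F_def)
      then have "restrict (c (restrict \<sigma> R)) R = restrict \<sigma> R" using c by blast
      then have "\<forall>r\<in>R. \<sigma> r = c (restrict \<sigma> R) r" by (metis restrict_apply')
      then show ?thesis using f by blast
    qed
    fix \<sigma> \<tau> assume st: "\<sigma> \<in> c ` F" "\<tau> \<in> c ` F" "\<And>r. r \<in> R \<Longrightarrow> \<sigma> r = \<tau> r"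
    then obtain f g where fg: "f \<in> F" "g \<in> F" "\<sigma> = c f" "\<tau> = c g" by auto
    have "restrict \<sigma> R = restrict \<tau> R" using st(3) by (auto intro: restrict_ext)
    then show "\<sigma> = \<tau>" using fg c by metis
  qed
qed

text \<open>Composition with \<rho> permutes the representatives up to agreement on
  \<open>R\<close>, hence permutes the summands. The condition on \<open>x\<close> is that agreement
  on \<open>R\<close> forces agreement at \<open>x\<close>, so that \<open>x\<close> may lie in the
  fraction field of \<open>zring R\<close>.\<close>

lemma trace_fixed:
  assumes S: "finite S" "S \<subseteq> gal_Q" "\<And>\<sigma>. \<sigma> \<in> gal_Q \<Longrightarrow> \<exists>\<tau>\<in>S. \<forall>r\<in>R. \<sigma> r = \<tau> r"
    "\<And>\<sigma> \<tau>. \<sigma> \<in> S \<Longrightarrow> \<tau> \<in> S \<Longrightarrow> (\<And>r. r \<in> R \<Longrightarrow> \<sigma> r = \<tau> r) \<Longrightarrow> \<sigma> = \<tau>"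
    and x: "x \<in> qbar" "\<And>\<sigma> \<tau>. \<sigma> \<in> gal_Q \<Longrightarrow> \<tau> \<in> gal_Q \<Longrightarrow> (\<And>r. r \<in> R \<Longrightarrow> \<sigma> r = \<tau> r) \<Longrightarrow> \<sigma> x = \<tau> x"
    and r: "\<rho> \<in> gal_Q"
  shows "\<rho> (\<Sum>\<sigma>\<in>S. \<sigma> x) = (\<Sum>\<sigma>\<in>S. \<sigma> x)"
proof -
  have "\<forall>\<sigma>\<in>S. \<exists>\<tau>. \<tau> \<in> S \<and> (\<forall>r\<in>R. \<rho> (\<sigma> r) = \<tau> r)"
  proof
    fix \<sigma> assume "\<sigma> \<in> S"
    then have "\<rho> \<circ> \<sigma> \<in> gal_Q" using S(2) gal_comp[OF r] by blast
    from S(3)[OF this] show "\<exists>\<tau>. \<tau> \<in> S \<and> (\<forall>r\<in>R. \<rho> (\<sigma> r) = \<tau> r)" by auto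
  qed
  from bchoice[OF this] obtain h where h: "\<And>\<sigma>. \<sigma> \<in> S \<Longrightarrow> h \<sigma> \<in> S" "\<And>\<sigma> r. \<sigma> \<in> S \<Longrightarrow> r \<in> R \<Longrightarrow> \<rho> (\<sigma> r) = h \<sigma> r"
    by auto
  have "inj_on h S"
  proof (rule inj_onI)
    fix \<sigma> \<tau> assume st: "\<sigma> \<in> S" "\<tau> \<in> S" "h \<sigma> = h \<tau>"
    show "\<sigma> = \<tau>"
    proof (rule S(4)[OF st(1,2)])
      fix z assume z: "z \<in> R"
      then have "\<rho> (\<sigma> z) = \<rho> (\<tau> z)" using h(2) st by simp
      moreover have "\<sigma> z \<in> qbar" "\<tau> z \<in> qbar" using st S(2) z R_qbar stable by blast+
      ultimately show "\<sigma> z = \<tau> z" using gal_inj[OF r] by blast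
    qed
  qed
  moreover have "h ` S \<subseteq> S" using h(1) by blast
  ultimately have bij: "bij_betw h S S" using endo_inj_surj[OF S(1)] by (auto simp: bij_betw_def)
  have "\<rho> (\<Sum>\<sigma>\<in>S. \<sigma> x) = (\<Sum>\<sigma>\<in>S. \<rho> (\<sigma> x))"
    using S(2) gal_qbar x(1) by (intro gal_sum[OF r]) blast
  also have "\<dots> = (\<Sum>\<sigma>\<in>S. h \<sigma> x)"
  proof (rule sum.cong)
    fix \<sigma> assume s: "\<sigma> \<in> S"
    then have g: "\<sigma> \<in> gal_Q" "h \<sigma> \<in> gal_Q" using S(2) h(1) by blast+
    have "(\<rho> \<circ> \<sigma>) x = h \<sigma> x"
      by (rule x(2)[OF gal_comp[OF r g(1)] g(2)]) (simp add: h(2)[OF s])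
    then show "\<rho> (\<sigma> x) = h \<sigma> x" by simp
  qed simp
  also have "\<dots> = (\<Sum>\<sigma>\<in>S. \<sigma> x)" by (rule sum.reindex_bij_betw[OF bij])
  finally show ?thesis .
qed

end

text \<open>A maximal ideal of \<open>zring R\<close> above \<open>p\<close>. Maximality is stated
  as invertibility modulo \<open>M\<close>, the form in which it proves that \<open>M\<close> is
  prime.\<close>

locale prime_over = galois_stable +
  fixes p :: nat and M :: "complex set"
  assumes prime_p: "prime p"
    and M_sub: "M \<subseteq> zring R"
    and M_diff: "x \<in> M \<Longrightarrow> y \<in> M \<Longrightarrow> x - y \<in> M"
    and M_mult: "x \<in> M \<Longrightarrow> b \<in> zring R \<Longrightarrow> b * x \<in> M"
    and M_p: "of_nat p \<in> M"
    and M_1: "1 \<notin> M"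
    and M_max: "b \<in> zring R \<Longrightarrow> b \<notin> M \<Longrightarrow> \<exists>c\<in>zring R. 1 - b * c \<in> M"
begin

lemma M_zring: "x \<in> M \<Longrightarrow> x \<in> zring R"
  using M_sub by blast

lemma M_0: "0 \<in> M"
  using M_diff[OF M_p M_p] by simp

lemma M_uminus: "x \<in> M \<Longrightarrow> - x \<in> M"
  using M_diff[OF M_0] by force

lemma M_uminus_iff: "- x \<in> M \<longleftrightarrow> x \<in> M"
  using M_uminus by fastforce

lemma M_add: "x \<in> M \<Longrightarrow> y \<in> M \<Longrightarrow> x + y \<in> M"
  using M_diff[of x "- y"] M_uminus by simp

lemma M_mult2: "x \<in> M \<Longrightarrow> b \<in> zring R \<Longrightarrow> x * b \<in> M"
  using M_mult[of x b] by (simp add: mult.commute)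

lemma M_prime: "x \<in> zring R \<Longrightarrow> y \<in> zring R \<Longrightarrow> x * y \<in> M \<Longrightarrow> x \<in> M \<or> y \<in> M"
proof (rule ccontr)
  assume xy: "x \<in> zring R" "y \<in> zring R" "x * y \<in> M" "\<not> (x \<in> M \<or> y \<in> M)"
  then obtain c where c: "c \<in> zring R" "1 - x * c \<in> M" using M_max by blast
  have "y * (1 - x * c) + c * (x * y) \<in> M" by (intro M_add M_mult xy c)
  then show False using xy by (simp add: algebra_simps)
qed

lemma M_prime_iff: "x \<in> zring R \<Longrightarrow> y \<in> zring R \<Longrightarrow> x * y \<in> M \<longleftrightarrow> x \<in> M \<or> y \<in> M"
  using M_prime M_mult M_mult2 by blast

lemma M_prod: "finite A \<Longrightarrow> (\<And>i. i \<in> A \<Longrightarrow> f i \<in> zring R) \<Longrightarrow> prod f A \<in> M \<longleftrightarrow> (\<exists>i\<in>A. f i \<in> M)"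
  by (induction A rule: finite_induct) (auto simp: M_1 M_prime_iff zring_prod)

lemma M_power: "x \<in> zring R \<Longrightarrow> x ^ n \<in> M \<longleftrightarrow> n > 0 \<and> x \<in> M"
  by (induction n) (auto simp: M_1 M_prime_iff zring_power)

lemma M_of_int: "of_int k \<in> M \<longleftrightarrow> int p dvd k"
proof
  assume k: "of_int k \<in> M"
  show "int p dvd k"
  proof (rule ccontr)
    assume "\<not> int p dvd k"
    then have "coprime (int p) k" using prime_p by (simp add: prime_imp_coprime)
    then obtain a b where "a * int p + b * k = 1" by (metis bezout_int coprime_iff_gcd_eq_1)
    then have "of_int a * of_nat p + of_int b * of_int k = (1 :: complex)"
      by (metis of_int_1 of_int_add of_int_mult of_int_of_nat_eq)
    moreover have "of_int a * of_nat p + of_int b * of_int k \<in> M"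
      by (intro M_add M_mult k M_p zring_of_int)
    ultimately show False using M_1 by simp
  qed
next
  assume "int p dvd k"
  then obtain m where "k = int p * m" by auto
  then show "of_int k \<in> M" using M_mult2[OF M_p zring_of_int] by simp
qed

lemma M_cong_ipoly: "x \<in> zring R \<Longrightarrow> y \<in> zring R \<Longrightarrow> x - y \<in> M \<Longrightarrow>
  poly (map_poly of_int f) x - poly (map_poly of_int f) y \<in> M"
proof (induction f)
  case (pCons a f)
  let ?f = "poly (map_poly of_int f)"
  have "(x * ?f x - y * ?f y) = x * (?f x - ?f y) + ?f y * (x - y)" by (simp add: algebra_simps)
  also have "\<dots> \<in> M" using pCons by (intro M_add M_mult zring_ipoly) auto
  finally show ?case by (simp add: of_int_hom.map_poly_pCons_hom)
qed (simp add: M_0)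

lemma M_ipoly_iff: "x \<in> zring R \<Longrightarrow> y \<in> zring R \<Longrightarrow> x - y \<in> M \<Longrightarrow>
  poly (map_poly of_int f) x \<in> M \<longleftrightarrow> poly (map_poly of_int f) y \<in> M"
  using M_cong_ipoly[of x y f] M_add M_diff by (metis diff_add_cancel diff_diff_eq2 add_diff_cancel_left')

text \<open>
  If no nontrivial automorphism is congruent to the identity, then a Galois-theoretic dual basis
  (Chase-Harrison-Rosenberg) exhibits the extension as unramified at \<open>M\<close>; in an unramified
  extension the square root of an integer of odd valuation cannot exist.
\<close>

lemma inertia_nontrivial:
  assumes \<delta>: "\<delta> \<in> zring R" "\<delta>\<^sup>2 = of_int D" and D: "D \<noteq> 0" "odd (multiplicity (int p) D)"
  shows "\<exists>\<sigma>\<in>gal_Q. (\<forall>r\<in>R. \<sigma> r - r \<in> M) \<and> (\<exists>r\<in>R. \<sigma> r \<noteq> r)"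
proof (rule ccontr)
  assume "\<not> ?thesis"
  then have triv: "\<sigma> r = r" if "\<sigma> \<in> gal_Q" "\<And>r. r \<in> R \<Longrightarrow> \<sigma> r - r \<in> M" "r \<in> R" for \<sigma> r
    using that by blast
  obtain S where S: "finite S" "S \<subseteq> gal_Q" "\<And>\<sigma>. \<sigma> \<in> gal_Q \<Longrightarrow> \<exists>\<tau>\<in>S. \<forall>r\<in>R. \<sigma> r = \<tau> r"
    "\<And>\<sigma> \<tau>. \<sigma> \<in> S \<Longrightarrow> \<tau> \<in> S \<Longrightarrow> (\<And>r. r \<in> R \<Longrightarrow> \<sigma> r = \<tau> r) \<Longrightarrow> \<sigma> = \<tau>"
    using representatives by blast
  have p0: "p > 0" using prime_p prime_gt_0_nat by blast
  define e where "e = multiplicity (int p) D"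
  define m where "m = e div 2"
  have em: "e = Suc (2 * m)" using D(2) by (simp add: e_def m_def)
  obtain w where w: "D = int p ^ e * w" "\<not> int p dvd w"
    using multiplicity_decompose'[of D "int p"] D(1) prime_p unfolding e_def
    by (metis not_prime_unit prime_nat_int_transfer)
  \<comment> \<open>Removing the even part of the valuation gives an \<open>x\<close> whose square
    is \<open>p\<close> times a factor prime to \<open>p\<close>. It may leave
    \<open>zring R\<close>, but it is an algebraic integer and automorphisms change it at most by a
    sign.\<close>
  define x where "x = \<delta> / of_nat p ^ m"
  have x2: "x\<^sup>2 = of_int (int p * w)"
    using \<delta>(2) p0 unfolding x_def w(1) em by (simp add: power_divide power_mult power2_eq_square field_simps power_mult_distrib)
  have xint: "algebraic_int x"
    unfolding algebraic_int_altdef_ipoly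
    by (rule exI[of _ "[:- (int p * w), 0, 1:]"]) (use x2 in \<open>simp add: of_int_hom.map_poly_pCons_hom power2_eq_square\<close>)
  then have xq: "x \<in> qbar" by (auto simp: qbar_def)
  have dx: "\<delta> = of_int (int (p ^ m)) * x" using p0 by (simp add: x_def)
  have x_agree: "\<sigma> x = \<tau> x" if "\<sigma> \<in> gal_Q" "\<tau> \<in> gal_Q" "\<And>r. r \<in> R \<Longrightarrow> \<sigma> r = \<tau> r" for \<sigma> \<tau>
  proof -
    have "\<sigma> \<delta> = \<tau> \<delta>" using agree that \<delta> by blast
    then have "of_int (int (p ^ m)) * \<sigma> x = of_int (int (p ^ m)) * \<tau> x"
      using that unfolding dx by (simp only: gal_mult[OF that(1)] gal_mult[OF that(2)] xq qbar_ring gal_of_int)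
    then show ?thesis using p0 by simp
  qed
  have x_sign: "\<sigma> x = x \<or> \<sigma> x = - x" if "\<sigma> \<in> gal_Q" for \<sigma>
  proof -
    have "(\<sigma> x)\<^sup>2 = x\<^sup>2"
      using gal_power[OF that xq, of 2] gal_of_int[OF that] x2 by metis
    then show ?thesis by (simp add: power2_eq_iff)
  qed
  \<comment> \<open>The trace of \<open>b * x\<close> is an integer equal to
    \<open>x * \<beta>\<close> with \<beta> in \<open>zring R\<close>; its square lies in
    \<open>M\<close>, so it is divisible by \<open>p\<close>.\<close>
  have trace: "\<exists>t. (\<Sum>\<sigma>\<in>S. \<sigma> b * \<sigma> x) = of_int (int p * t)" if b: "b \<in> zring R" for b
  proof -
    let ?T = "\<Sum>\<sigma>\<in>S. \<sigma> b * \<sigma> x"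
    define \<beta> where "\<beta> = (\<Sum>\<sigma>\<in>S. if \<sigma> x = x then \<sigma> b else - \<sigma> b)"
    have \<beta>: "\<beta> \<in> zring R" unfolding \<beta>_def
      using gal_zring[OF subsetD[OF S(2)] b] by (auto intro!: zring_sum zring_uminus)
    have T\<beta>: "?T = x * \<beta>" unfolding \<beta>_def sum_distrib_left
    proof (rule sum.cong)
      fix \<sigma> assume "\<sigma> \<in> S"
      then show "\<sigma> b * \<sigma> x = x * (if \<sigma> x = x then \<sigma> b else - \<sigma> b)"
        using x_sign[of \<sigma>] S(2) by auto
    qed simp
    have bx: "b * x \<in> qbar" using b zring_qbar xq qbar_ring by blast
    have T': "?T = (\<Sum>\<sigma>\<in>S. \<sigma> (b * x))"
      using S(2) gal_mult zring_qbar[OF b] xq by (intro sum.cong) auto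
    have "\<rho> ?T = ?T" if "\<rho> \<in> gal_Q" for \<rho>
      unfolding T'
    proof (rule trace_fixed[OF S bx _ that])
      fix \<sigma> \<tau> assume st: "\<sigma> \<in> gal_Q" "\<tau> \<in> gal_Q" "\<And>r. r \<in> R \<Longrightarrow> \<sigma> r = \<tau> r"
      then show "\<sigma> (b * x) = \<tau> (b * x)"
        using gal_mult[OF st(1) zring_qbar[OF b] xq] gal_mult[OF st(2) zring_qbar[OF b] xq]
          agree[OF st b] x_agree[OF st] by simp
    qed
    moreover have "algebraic_int ?T" unfolding T\<beta> by (intro algebraic_int_ring xint zring_int \<beta>)
    ultimately obtain t where t: "?T = of_int t" using fixed_int[of ?T] by blast
    have "complex_of_int (t\<^sup>2) = ?T\<^sup>2" by (simp add: t)
    also have "\<dots> = x\<^sup>2 * \<beta>\<^sup>2" unfolding T\<beta> by (rule power_mult_distrib)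
    also have "\<dots> = of_int (int p * w) * \<beta>\<^sup>2" by (simp only: x2)
    also have "\<dots> = of_nat p * (of_int w * \<beta>\<^sup>2)" by simp
    also have "\<dots> \<in> M" by (intro M_mult2 M_p zring_intros \<beta>)
    finally have "int p dvd t\<^sup>2" by (simp only: M_of_int)
    then have "int p dvd t" using prime_p by (simp add: prime_dvd_power_iff)
    then show ?thesis using t by auto
  qed
  obtain \<sigma>0 where s0: "\<sigma>0 \<in> S" "\<And>r. r \<in> R \<Longrightarrow> \<sigma>0 r = r" using S(3)[OF gal_id] by auto
  define S' where "S' = S - {\<sigma>0}"
  have finS': "finite S'" using S by (simp add: S'_def)
  have "\<exists>r\<in>R. r - \<tau> r \<notin> M" if "\<tau> \<in> S'" for \<tau>
  proof (rule ccontr)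
    assume "\<not> ?thesis"
    then have "\<tau> r - r \<in> M" if "r \<in> R" for r using that M_uminus_iff[of "r - \<tau> r"] by auto
    then have "\<tau> r = r" if "r \<in> R" for r using that triv \<open>\<tau> \<in> S'\<close> S(2) by (auto simp: S'_def)
    then have "\<tau> = \<sigma>0" using S(4)[of \<tau> \<sigma>0] s0 \<open>\<tau> \<in> S'\<close> by (auto simp: S'_def)
    then show False using \<open>\<tau> \<in> S'\<close> by (simp add: S'_def)
  qed
  then obtain z where z: "\<And>\<tau>. \<tau> \<in> S' \<Longrightarrow> z \<tau> \<in> R" "\<And>\<tau>. \<tau> \<in> S' \<Longrightarrow> z \<tau> - \<tau> (z \<tau>) \<notin> M" by metis
  have S'g: "\<tau> \<in> gal_Q" if "\<tau> \<in> S'" for \<tau> using that S(2) by (auto simp: S'_def)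
  \<comment> \<open>Expanding the product writes \<open>E \<sigma>\<close> as a combination of the
    values \<open>\<sigma> (b J)\<close>. On the representatives it vanishes except at \<sigma>0,
    which acts trivially on \<open>R\<close>; there its value \<open>u\<close> is a unit at
    \<open>M\<close>.\<close>
  define E where "E = (\<lambda>\<sigma>. \<Prod>\<tau>\<in>S'. \<sigma> (z \<tau>) - \<tau> (z \<tau>))"
  define b where "b = (\<lambda>J. \<Prod>\<tau>\<in>J. z \<tau>)"
  define c where "c = (\<lambda>J. \<Prod>\<tau>\<in>S' - J. - \<tau> (z \<tau>))"
  have bz: "b J \<in> zring R" if "J \<subseteq> S'" for J
    unfolding b_def using that z by (intro zring_intros) auto
  have cz: "c J \<in> zring R" for J
    unfolding c_def using z stable S'g by (intro zring_intros) auto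
  have E_sum: "E \<sigma> = (\<Sum>J\<in>Pow S'. c J * \<sigma> (b J))" if "\<sigma> \<in> gal_Q" for \<sigma>
  proof -
    have "E \<sigma> = (\<Prod>\<tau>\<in>S'. \<sigma> (z \<tau>) + - \<tau> (z \<tau>))" by (simp add: E_def)
    also have "\<dots> = (\<Sum>J\<in>Pow S'. (\<Prod>\<tau>\<in>J. \<sigma> (z \<tau>)) * (\<Prod>\<tau>\<in>S' - J. - \<tau> (z \<tau>)))"
      by (rule prod_add[OF finS'])
    also have "\<dots> = (\<Sum>J\<in>Pow S'. c J * \<sigma> (b J))"
    proof (rule sum.cong)
      fix J assume "J \<in> Pow S'"
      then have "\<sigma> (b J) = (\<Prod>\<tau>\<in>J. \<sigma> (z \<tau>))"
        unfolding b_def using z(1) R_qbar by (intro gal_prod[OF that]) auto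
      then show "(\<Prod>\<tau>\<in>J. \<sigma> (z \<tau>)) * (\<Prod>\<tau>\<in>S' - J. - \<tau> (z \<tau>)) = c J * \<sigma> (b J)"
        by (simp add: c_def)
    qed simp
    finally show ?thesis .
  qed
  have E0: "E \<sigma> = 0" if "\<sigma> \<in> S'" for \<sigma>
    unfolding E_def using that finS' by (intro prod_zero) auto
  define u where "u = E \<sigma>0"
  have u_eq: "u = (\<Prod>\<tau>\<in>S'. z \<tau> - \<tau> (z \<tau>))" unfolding u_def E_def using z(1) s0(2) by simp
  have zz: "z \<tau> - \<tau> (z \<tau>) \<in> zring R" if "\<tau> \<in> S'" for \<tau>
    using that z stable S'g by (intro zring_intros) auto
  have uz: "u \<in> zring R" unfolding u_eq using zz by (intro zring_prod)
  have uM: "u \<notin> M" unfolding u_eq using z(2) zz by (subst M_prod[OF finS']) auto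
  have s0x: "\<sigma>0 x = x" using x_agree[of \<sigma>0 id] s0 S(2) gal_id by auto
  have "\<forall>J\<in>Pow S'. \<exists>t. (\<Sum>\<sigma>\<in>S. \<sigma> (b J) * \<sigma> x) = of_int (int p * t)"
    using trace bz by blast
  then obtain t where t: "\<And>J. J \<subseteq> S' \<Longrightarrow> (\<Sum>\<sigma>\<in>S. \<sigma> (b J) * \<sigma> x) = of_int (int p * t J)"
    by (metis PowI)
  \<comment> \<open>Pairing \<open>E\<close> with the conjugates of \<open>x\<close> isolates
    \<open>u * x\<close> and exhibits it as \<open>p\<close> times an element of the ring; squaring
    contradicts that the square of \<open>x\<close> contains \<open>p\<close> only once.\<close>
  have "u * x = (\<Sum>\<sigma>\<in>S. E \<sigma> * \<sigma> x)"
    using E0 s0 S(1) by (subst sum.remove[OF S(1) s0(1)]) (simp add: u_def s0x S'_def)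
  also have "\<dots> = (\<Sum>\<sigma>\<in>S. \<Sum>J\<in>Pow S'. c J * \<sigma> (b J) * \<sigma> x)"
    using S(2) by (intro sum.cong) (auto simp: E_sum sum_distrib_right)
  also have "\<dots> = (\<Sum>J\<in>Pow S'. \<Sum>\<sigma>\<in>S. c J * \<sigma> (b J) * \<sigma> x)" by (rule sum.swap)
  also have "\<dots> = (\<Sum>J\<in>Pow S'. c J * of_int (int p * t J))"
  proof (rule sum.cong)
    fix J assume "J \<in> Pow S'"
    then have "c J * of_int (int p * t J) = c J * (\<Sum>\<sigma>\<in>S. \<sigma> (b J) * \<sigma> x)" by (simp only: t PowD)
    then show "(\<Sum>\<sigma>\<in>S. c J * \<sigma> (b J) * \<sigma> x) = c J * of_int (int p * t J)"
      by (simp only: sum_distrib_left mult.assoc)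
  qed simp
  also have "\<dots> = of_nat p * (\<Sum>J\<in>Pow S'. c J * of_int (t J))"
    by (simp add: sum_distrib_left mult_ac)
  finally obtain y where y: "u * x = of_nat p * y" "y \<in> zring R"
    using cz by (metis (no_types, lifting) zring_mult zring_of_int zring_sum)
  have "u\<^sup>2 * x\<^sup>2 = (of_nat p)\<^sup>2 * y\<^sup>2" using y(1) by (metis power_mult_distrib)
  then have "of_nat p * (u\<^sup>2 * of_int w) = of_nat p * (of_nat p * y\<^sup>2)"
    unfolding x2 by (simp add: power2_eq_square mult_ac)
  then have "u\<^sup>2 * of_int w = of_nat p * y\<^sup>2" using p0 by simp
  also have "\<dots> \<in> M" by (intro M_mult2 M_p zring_intros y)
  finally have "u\<^sup>2 \<in> M \<or> of_int w \<in> M" by (intro M_prime zring_intros uz)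
  then show False using uM w(2) M_power[OF uz, of 2] by (simp add: M_of_int)
qed

end

text \<open>Zorn's lemma above the ideal generated by \<open>p\<close>, which is proper because 1 /
  p is rational but not integral.\<close>

lemma (in galois_stable) prime_over_exists:
  assumes p: "prime p"
  obtains M where "prime_over R p M"
proof -
  define ideal where "ideal = (\<lambda>I. I \<subseteq> zring R \<and> (\<forall>x\<in>I. \<forall>y\<in>I. x - y \<in> I) \<and> (\<forall>x\<in>I. \<forall>b\<in>zring R. b * x \<in> I)
    \<and> of_nat p \<in> I \<and> 1 \<notin> I)"
  have p0: "p > 0" using p prime_gt_0_nat by blast
  let ?I0 = "(\<lambda>b. of_nat p * b) ` zring R"
  have "1 \<notin> ?I0"
  proof
    assume "1 \<in> ?I0"
    then obtain b where b: "b \<in> zring R" "of_nat p * b = 1" by auto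
    then have "b = of_rat (1 / of_nat p)" using p0 by (simp add: of_rat_divide field_simps)
    then have "b \<in> \<rat>" by simp
    then have "b \<in> \<int>" using rational_algebraic_int_is_int zring_int b(1) by blast
    then obtain k where "b = of_int k" by (elim Ints_cases)
    then have "complex_of_int (int p * k) = of_int 1" using b(2) by simp
    then have "int p * k = 1" by (simp only: of_int_eq_iff)
    then have "int p dvd 1" by (metis dvd_triv_left)
    then show False using p by auto
  qed
  moreover have "of_nat p * x - of_nat p * y \<in> ?I0" if "x \<in> zring R" "y \<in> zring R" for x y
    using that by (intro image_eqI[where x = "x - y"]) (auto simp: algebra_simps intro: zring_intros)
  moreover have "b * (of_nat p * x) \<in> ?I0" if "x \<in> zring R" "b \<in> zring R" for x b
    using that by (intro image_eqI[where x = "b * x"]) (auto simp: algebra_simps intro: zring_intros)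
  moreover have "of_nat p \<in> ?I0" by (rule image_eqI[where x = 1]) (auto intro: zring_intros)
  ultimately have I0: "ideal ?I0"
    unfolding ideal_def using zring_of_nat by (auto intro: zring_mult)
  have "\<exists>M\<in>{I. ideal I}. \<forall>X\<in>{I. ideal I}. M \<subseteq> X \<longrightarrow> X = M"
  proof (rule subset_Zorn_nonempty)
    show "{I. ideal I} \<noteq> {}" using I0 by blast
    fix C assume C: "C \<noteq> {}" "subset.chain {I. ideal I} C"
    have CI: "ideal I" if "I \<in> C" for I using C(2) that by (auto simp: subset_chain_def)
    have two: "\<exists>I\<in>C. x \<in> I \<and> y \<in> I" if xy: "x \<in> \<Union>C" "y \<in> \<Union>C" for x y
    proof -
      obtain X Y where XY: "X \<in> C" "x \<in> X" "Y \<in> C" "y \<in> Y" using xy by blast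
      then have "X \<subseteq> Y \<or> Y \<subseteq> X" using C(2) by (simp add: subset_chain_def)
      then show ?thesis using XY by blast
    qed
    have "ideal (\<Union>C)"
      unfolding ideal_def
    proof (intro conjI ballI)
      show "\<Union>C \<subseteq> zring R" "1 \<notin> \<Union>C" using CI unfolding ideal_def by (blast, blast)
      show "of_nat p \<in> \<Union>C" using CI C(1) by (auto simp: ideal_def)
      show "x - y \<in> \<Union>C" if xy: "x \<in> \<Union>C" "y \<in> \<Union>C" for x y
      proof -
        obtain I where "I \<in> C" "x \<in> I" "y \<in> I" using two[OF xy] by blast
        then show ?thesis using CI[of I] by (auto simp: ideal_def)
      qed
      show "b * x \<in> \<Union>C" if x: "x \<in> \<Union>C" and b: "b \<in> zring R" for x b
      proof -
        obtain I where I: "I \<in> C" "x \<in> I" using x by blast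
        then have "b * x \<in> I" using CI[of I] b by (simp add: ideal_def)
        then show ?thesis using I by blast
      qed
    qed
    then show "\<Union>C \<in> {I. ideal I}" by simp
  qed
  then obtain M where M: "ideal M" "\<And>X. ideal X \<Longrightarrow> M \<subseteq> X \<Longrightarrow> X = M" by auto
  have M0: "0 \<in> M" using M(1) unfolding ideal_def by (metis diff_self)
  have Madd: "x + y \<in> M" if "x \<in> M" "y \<in> M" for x y
  proof -
    have "0 - y \<in> M" using M(1) M0 that unfolding ideal_def by blast
    then have "x - (0 - y) \<in> M" using M(1) that unfolding ideal_def by blast
    then show ?thesis by simp
  qed
  have "prime_over R p M"
  proof
    show "prime p" by fact
    show "M \<subseteq> zring R" "of_nat p \<in> M" "1 \<notin> M" using M(1) by (auto simp: ideal_def)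
    show "x - y \<in> M" if "x \<in> M" "y \<in> M" for x y using M(1) that by (auto simp: ideal_def)
    show "b * x \<in> M" if "x \<in> M" "b \<in> zring R" for x b using M(1) that by (auto simp: ideal_def)
    fix b assume b: "b \<in> zring R" "b \<notin> M"
    \<comment> \<open>\<open>X\<close> is the ideal generated by \<open>M\<close> and
      \<open>b\<close>; maximality forces it to contain 1, which is invertibility of
      \<open>b\<close> modulo \<open>M\<close>.\<close>
    define X where "X = {x + b * c |x c. x \<in> M \<and> c \<in> zring R}"
    have XI: "x + b * c \<in> X" if "x \<in> M" "c \<in> zring R" for x c using that by (auto simp: X_def)
    have MX: "M \<subseteq> X" using XI[OF _ zring_0] by auto
    have bX: "b \<in> X" using XI[OF M0 zring_1] by simp
    have "\<not> ideal X" using M(2)[of X] MX bX b by blast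
    moreover have "X \<subseteq> zring R" using M(1) b(1) by (auto simp: X_def ideal_def intro!: zring_add zring_mult)
    moreover have "of_nat p \<in> X" using M(1) MX by (auto simp: ideal_def)
    moreover have "x - y \<in> X" if xy: "x \<in> X" "y \<in> X" for x y
    proof -
      obtain m c m' c' where m: "x = m + b * c" "y = m' + b * c'" "m \<in> M" "m' \<in> M" "c \<in> zring R" "c' \<in> zring R"
        using xy unfolding X_def by blast
      have "x - y = (m - m') + b * (c - c')" using m by (simp add: algebra_simps)
      moreover have "m - m' \<in> M" using M(1) m by (auto simp: ideal_def)
      ultimately show ?thesis using XI zring_diff m by metis
    qed
    moreover have "a * x \<in> X" if xy: "x \<in> X" "a \<in> zring R" for x a
    proof -
      obtain m c where m: "x = m + b * c" "m \<in> M" "c \<in> zring R"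
        using xy unfolding X_def by blast
      have "a * x = a * m + b * (a * c)" using m by (simp add: algebra_simps)
      moreover have "a * m \<in> M" using M(1) m xy by (auto simp: ideal_def)
      ultimately show ?thesis using XI zring_mult m xy by metis
    qed
    ultimately have "1 \<in> X" unfolding ideal_def by blast
    then obtain m c where "1 = m + b * c" "m \<in> M" "c \<in> zring R" unfolding X_def by blast
    then show "\<exists>c\<in>zring R. 1 - b * c \<in> M" by (metis add_diff_cancel_right')
  qed
  then show ?thesis using that by blast
qed

section \<open>The decomposition group and valuations at \<open>M\<close>\<close>

context prime_over
begin

definition Dec :: "(complex \<Rightarrow> complex) set" where
  "Dec = {\<sigma> \<in> gal_Q. \<sigma> ` M = M}"

lemma Dec_gal: "\<sigma> \<in> Dec \<Longrightarrow> \<sigma> \<in> gal_Q"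
  by (simp add: Dec_def)

lemma Dec_id: "id \<in> Dec"
  by (simp add: Dec_def gal_id)

lemma Dec_comp: "\<sigma> \<in> Dec \<Longrightarrow> \<tau> \<in> Dec \<Longrightarrow> \<sigma> \<circ> \<tau> \<in> Dec"
  unfolding Dec_def using image_comp[of \<sigma> \<tau> M] gal_comp by simp

lemma Dec_M: "\<sigma> \<in> Dec \<Longrightarrow> x \<in> zring R \<Longrightarrow> \<sigma> x \<in> M \<longleftrightarrow> x \<in> M"
proof
  assume s: "\<sigma> \<in> Dec" and x: "x \<in> zring R"
  then show "\<sigma> x \<in> M" if "x \<in> M" using that by (auto simp: Dec_def)
  assume "\<sigma> x \<in> M"
  then have "\<sigma> x \<in> \<sigma> ` M" using s by (simp add: Dec_def)
  then obtain y where y: "y \<in> M" "\<sigma> x = \<sigma> y" by auto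
  then have "x = y" using gal_inj[OF Dec_gal[OF s]] x zring_qbar M_zring by blast
  then show "x \<in> M" using y by simp
qed

lemma Dec_agree:
  assumes "\<sigma> \<in> gal_Q" "\<tau> \<in> gal_Q" "\<And>r. r \<in> R \<Longrightarrow> \<sigma> r = \<tau> r"
  shows "\<sigma> \<in> Dec \<longleftrightarrow> \<tau> \<in> Dec"
proof -
  have "\<sigma> ` M = \<tau> ` M" using agree[OF assms] M_zring by (intro image_cong) auto
  then show ?thesis using assms by (simp add: Dec_def)
qed

text \<open>The first coefficient prime to \<open>p\<close> of an integral equation for an element of \<open>M\<close> yields a unit at \<open>M\<close>.\<close>

lemma M_power_p_aux:
  fixes g :: "int poly"
  assumes x: "x \<in> M"
  shows "x ^ k * poly (map_poly of_int g) x = of_nat p * c \<Longrightarrow> c \<in> zring R \<Longrightarrow> \<exists>i. \<not> int p dvd coeff g i \<Longrightarrow>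
    \<exists>a. \<exists>s\<in>zring R - M. \<exists>b\<in>zring R. x ^ a * s = of_nat p * b"
proof (induction g arbitrary: k c)
  case 0
  then show ?case by simp
next
  case (pCons \<alpha> g)
  have xz: "x \<in> zring R" using x M_zring by blast
  let ?g = "poly (map_poly of_int g) x"
  have eq: "x ^ k * (of_int \<alpha> + x * ?g) = of_nat p * c"
    using pCons.prems(1) by (simp add: of_int_hom.map_poly_pCons_hom)
  show ?case
  proof (cases "int p dvd \<alpha>")
    case True
    then obtain \<alpha>' where \<alpha>': "\<alpha> = int p * \<alpha>'" by auto
    have "x ^ Suc k * ?g = of_nat p * (c - x ^ k * of_int \<alpha>')"
      using eq unfolding \<alpha>' by (simp add: algebra_simps)
    moreover have "c - x ^ k * of_int \<alpha>' \<in> zring R" by (intro zring_intros pCons.prems xz)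
    moreover have "\<exists>i. \<not> int p dvd coeff g i"
    proof -
      obtain i where i: "\<not> int p dvd coeff (pCons \<alpha> g) i" using pCons.prems by blast
      then have "i \<noteq> 0" using True by (auto intro: ccontr)
      then show ?thesis using i by (cases i) auto
    qed
    ultimately show ?thesis using pCons.IH by blast
  next
    case False
    have sz: "of_int \<alpha> + x * ?g \<in> zring R" by (intro zring_intros xz)
    have "of_int \<alpha> + x * ?g \<notin> M"
    proof
      assume "of_int \<alpha> + x * ?g \<in> M"
      then have "of_int \<alpha> + x * ?g - x * ?g \<in> M" by (intro M_diff M_mult2 x zring_intros xz)
      then show False using False by (simp add: M_of_int)
    qed
    then show ?thesis using eq sz pCons.prems(2) by blast
  qed
qed

lemma M_power_p:
  assumes x: "x \<in> M"
  obtains a s b where "s \<in> zring R" "s \<notin> M" "b \<in> zring R" "x ^ a * s = of_nat p * b"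
proof -
  obtain f :: "int poly" where f: "poly (map_poly of_int f) x = 0" "lead_coeff f = 1"
    using zring_int[OF M_zring[OF x]] by (auto simp: algebraic_int_altdef_ipoly)
  have "\<not> int p dvd coeff f (degree f)" using f(2) prime_p by (simp add: not_prime_1 prime_nat_iff)
  then show ?thesis
    using M_power_p_aux[OF x, of 0 f 0] f(1) zring_0 that by auto
qed

text \<open>A power of \<open>p\<close> left over on one side would put the unit on the other side
  into \<open>M\<close>. Hence the valuation at \<open>M\<close> is well defined wherever it is
  expressed by such equations.\<close>

lemma p_power_unique:
  assumes "of_nat p ^ i * x = of_nat p ^ j * y" "x \<in> zring R" "y \<in> zring R" "x \<notin> M" "y \<notin> M"
  shows "i = j"
proof -
  have le: "j' \<le> i'" if "of_nat p ^ i' * x' = of_nat p ^ j' * y'" "x' \<notin> M" "y' \<in> zring R" for i' j' x' y'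
  proof (rule ccontr)
    assume "\<not> j' \<le> i'"
    then obtain k where "j' = i' + Suc k" using less_imp_Suc_add by force
    then have "of_nat p ^ i' * x' = of_nat p ^ i' * (of_nat p * (of_nat p ^ k * y'))"
      using that(1) by (simp add: power_add mult_ac)
    then have "x' = of_nat p * (of_nat p ^ k * y')" using prime_p by (simp add: prime_gt_0_nat)
    also have "\<dots> \<in> M" by (intro M_mult2 M_p zring_mult zring_power zring_of_nat that)
    finally show False using that by simp
  qed
  show ?thesis using le[OF assms(1,4,3)] le[OF assms(1)[symmetric] assms(5,2)] by simp
qed

text \<open>Otherwise the preimage of \<open>M\<close> under \<sigma> would lie in \<open>M\<close>;
  inverses modulo \<open>M\<close> then give the reverse inclusion, so \<sigma> would stabilise
  \<open>M\<close>.\<close>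

lemma unit_conj_in_M:
  assumes s: "\<sigma> \<in> gal_Q" "\<sigma> \<notin> Dec"
  shows "\<exists>t\<in>zring R. t \<notin> M \<and> \<sigma> t \<in> M"
proof (rule ccontr)
  assume "\<not> ?thesis"
  then have sub: "t \<in> M" if "t \<in> zring R" "\<sigma> t \<in> M" for t using that by blast
  obtain \<tau> where t: "\<tau> \<in> gal_Q" "\<And>x. x \<in> qbar \<Longrightarrow> \<tau> (\<sigma> x) = x" "\<And>x. x \<in> qbar \<Longrightarrow> \<sigma> (\<tau> x) = x"
    using gal_inv[OF s(1)] by blast
  have "\<sigma> x \<in> M" if x: "x \<in> M" for x
  proof (rule ccontr)
    assume "\<sigma> x \<notin> M"
    then obtain c where c: "c \<in> zring R" "1 - \<sigma> x * c \<in> M"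
      using M_max gal_zring[OF s(1) M_zring[OF x]] by blast
    have tc: "\<tau> c \<in> zring R" using gal_zring[OF t(1) c(1)] .
    have q: "x \<in> qbar" "\<tau> c \<in> qbar" "x * \<tau> c \<in> qbar"
      using zring_qbar M_zring[OF x] tc zring_mult by blast+
    have "\<sigma> (1 - x * \<tau> c) = 1 - \<sigma> x * c"
      using q t(3)[OF zring_qbar[OF c(1)]] by (simp add: gal_diff[OF s(1)] gal_mult[OF s(1)] gal_1[OF s(1)] qbar_ring)
    moreover have "1 - x * \<tau> c \<in> zring R" by (intro zring_intros tc M_zring[OF x])
    ultimately have "1 - x * \<tau> c \<in> M" using c(2) by (auto intro: sub[of "1 - x * \<tau> c"])
    then have "1 - x * \<tau> c + x * \<tau> c \<in> M" by (intro M_add M_mult2 x tc)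
    then show False using M_1 by simp
  qed
  moreover have "y \<in> \<sigma> ` M" if y: "y \<in> M" for y
  proof -
    have st: "\<sigma> (\<tau> y) = y" using t(3) y M_zring zring_qbar by blast
    then have "\<tau> y \<in> M" using sub[of "\<tau> y"] y gal_zring[OF t(1) M_zring[OF y]] by simp
    then show ?thesis using st by (metis imageI)
  qed
  ultimately have "\<sigma> ` M = M" by blast
  then show False using s by (simp add: Dec_def)
qed

text \<open>\<open>u\<close> multiplies one witness for each representative outside
  \<open>Dec\<close>: it is a unit at \<open>M\<close>, and each automorphism outside
  \<open>Dec\<close> sends it into \<open>M\<close>. The product of its \<open>Dec\<close>-orbit
  keeps both properties and is also fixed by \<open>Dec\<close>.\<close>

lemma decomposition_separator:
  obtains t where "t \<in> zring R" "t \<notin> M" "\<And>\<sigma>. \<sigma> \<in> Dec \<Longrightarrow> \<sigma> t = t" "\<And>\<sigma>. \<sigma> \<in> gal_Q \<Longrightarrow> \<sigma> \<notin> Dec \<Longrightarrow> \<sigma> t \<in> M"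
proof -
  obtain S where S: "finite S" "S \<subseteq> gal_Q" "\<And>\<sigma>. \<sigma> \<in> gal_Q \<Longrightarrow> \<exists>\<tau>\<in>S. \<forall>r\<in>R. \<sigma> r = \<tau> r"
    by (rule representatives, rule that, assumption+)
  have "\<forall>\<sigma>\<in>S - Dec. \<exists>t. t \<in> zring R \<and> t \<notin> M \<and> \<sigma> t \<in> M"
    using unit_conj_in_M S(2) by blast
  from bchoice[OF this] obtain g where g: "\<And>\<sigma>. \<sigma> \<in> S - Dec \<Longrightarrow> g \<sigma> \<in> zring R"
    "\<And>\<sigma>. \<sigma> \<in> S - Dec \<Longrightarrow> g \<sigma> \<notin> M" "\<And>\<sigma>. \<sigma> \<in> S - Dec \<Longrightarrow> \<sigma> (g \<sigma>) \<in> M" by blast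
  define u where "u = (\<Prod>\<sigma>\<in>S - Dec. g \<sigma>)"
  have fin: "finite (S - Dec)" using S by simp
  have uz: "u \<in> zring R" unfolding u_def using g by (intro zring_prod)
  have uM: "u \<notin> M" unfolding u_def using g by (subst M_prod[OF fin]) auto
  have u_conj: "\<sigma> u \<in> M" if s: "\<sigma> \<in> gal_Q" "\<sigma> \<notin> Dec" for \<sigma>
  proof -
    obtain \<tau> where \<tau>: "\<tau> \<in> S" "\<forall>r\<in>R. \<sigma> r = \<tau> r" using S(3) s by blast
    then have \<tau>g: "\<tau> \<in> gal_Q" using S by blast
    have "\<tau> \<notin> Dec" using Dec_agree[OF s(1) \<tau>g] \<tau>(2) s(2) by blast
    then have \<tau>D: "\<tau> \<in> S - Dec" using \<tau> by blast
    have "\<sigma> u = \<tau> u" using agree[OF s(1) \<tau>g _ uz] \<tau>(2) by blast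
    also have "\<dots> = (\<Prod>\<sigma>\<in>S - Dec. \<tau> (g \<sigma>))"
      unfolding u_def using g zring_qbar by (intro gal_prod[OF \<tau>g]) blast
    also have "\<dots> \<in> M" using g(1,3) \<tau>D gal_zring[OF \<tau>g] by (subst M_prod[OF fin]) auto
    finally show ?thesis .
  qed
  define Orb where "Orb = (\<lambda>\<sigma>. \<sigma> u) ` Dec"
  have "Orb \<subseteq> (\<lambda>\<tau>. \<tau> u) ` S"
  proof
    fix y assume "y \<in> Orb"
    then obtain \<sigma> where \<sigma>: "\<sigma> \<in> Dec" "y = \<sigma> u" by (auto simp: Orb_def)
    then obtain \<tau> where \<tau>: "\<tau> \<in> S" "\<forall>r\<in>R. \<sigma> r = \<tau> r" using S(3) Dec_gal by blast
    then have "\<sigma> u = \<tau> u" using agree[OF Dec_gal[OF \<sigma>(1)] _ _ uz] S(2) by blast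
    then show "y \<in> (\<lambda>\<tau>. \<tau> u) ` S" using \<sigma> \<tau> by blast
  qed
  then have finO: "finite Orb" using S(1) finite_surj by blast
  have Oz: "y \<in> zring R" if "y \<in> Orb" for y using that gal_zring[OF Dec_gal uz] by (auto simp: Orb_def)
  have OM: "y \<notin> M" if "y \<in> Orb" for y using that Dec_M uz uM by (auto simp: Orb_def)
  have uO: "u \<in> Orb" unfolding Orb_def using Dec_id by (intro image_eqI[where x = id]) auto
  show ?thesis
  proof (rule that[of "\<Prod>Orb"])
    show "\<Prod>Orb \<in> zring R" using Oz by (intro zring_prod)
    show "\<Prod>Orb \<notin> M" using M_prod[OF finO, of "\<lambda>x. x"] Oz OM by auto
  next
    fix \<sigma> assume s: "\<sigma> \<in> Dec"
    have "\<sigma> ` Orb \<subseteq> Orb"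
    proof
      fix y assume "y \<in> \<sigma> ` Orb"
      then obtain \<tau> where "\<tau> \<in> Dec" "y = (\<sigma> \<circ> \<tau>) u" by (auto simp: Orb_def)
      then show "y \<in> Orb" unfolding Orb_def using Dec_comp[OF s] by blast
    qed
    then show "\<sigma> (\<Prod>Orb) = \<Prod>Orb" using finO Oz zring_qbar by (intro gal_fixes_sum_prod[OF Dec_gal[OF s]]) auto
  next
    fix \<sigma> assume s: "\<sigma> \<in> gal_Q" "\<sigma> \<notin> Dec"
    have "\<sigma> (\<Prod>Orb) = (\<Prod>y\<in>Orb. \<sigma> y)"
      using Oz zring_qbar by (intro gal_prod[OF s(1)]) blast
    also have "\<dots> \<in> M"
      using uO u_conj[OF s] gal_zring[OF s(1) Oz] by (subst M_prod[OF finO]) auto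
    finally show "\<sigma> (\<Prod>Orb) \<in> M" .
  qed
qed

text \<open>The elements of valuation at least \<open>K\<close> at \<open>M\<close>.\<close>

definition divK :: "nat \<Rightarrow> complex \<Rightarrow> bool" where
  "divK K y \<longleftrightarrow> (\<exists>s\<in>zring R. \<exists>b\<in>zring R. s \<notin> M \<and> y * s = of_nat p ^ K * b)"

lemma divK_0: "divK K 0"
  unfolding divK_def by (intro bexI[of _ 1] bexI[of _ 0]) (auto intro: zring_intros simp: M_1)

lemma divK_add: "divK K x \<Longrightarrow> divK K y \<Longrightarrow> divK K (x + y)"
proof -
  assume "divK K x" "divK K y"
  then obtain s b s' b' where *: "s \<in> zring R" "b \<in> zring R" "s \<notin> M" "x * s = of_nat p ^ K * b"
    "s' \<in> zring R" "b' \<in> zring R" "s' \<notin> M" "y * s' = of_nat p ^ K * b'" unfolding divK_def by blast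
  have "(x + y) * (s * s') = x * s * s' + y * s' * s" by (simp add: algebra_simps)
  also have "\<dots> = of_nat p ^ K * (b * s' + b' * s)" unfolding * by (simp add: algebra_simps)
  finally have "(x + y) * (s * s') = of_nat p ^ K * (b * s' + b' * s)" .
  moreover have "s * s' \<notin> M" using * by (simp add: M_prime_iff)
  ultimately show ?thesis unfolding divK_def using * by (intro bexI[of _ "s * s'"] bexI[of _ "b * s' + b' * s"]) (auto intro: zring_intros)
qed

lemma divK_mult: "divK K x \<Longrightarrow> y \<in> zring R \<Longrightarrow> divK K (x * y)"
  unfolding divK_def by (metis mult.assoc mult.commute zring_mult)

lemma divK_sum: "(\<And>i. i \<in> A \<Longrightarrow> divK K (f i)) \<Longrightarrow> divK K (sum f A)"
  by (induction A rule: infinite_finite_induct) (auto intro: divK_0 divK_add)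

text \<open>The sum of the individual exponents bounds them all, and the factor \<open>K\<close>
  raises the divisibility from \<open>p\<close> to \<open>p ^ K\<close>.\<close>

lemma divK_uniform:
  assumes "finite X" "X \<subseteq> M"
  obtains N where "\<And>x. x \<in> X \<Longrightarrow> divK K (x ^ N)"
proof -
  have "\<forall>x\<in>X. \<exists>a. divK 1 (x ^ a)"
  proof
    fix x assume "x \<in> X"
    then have "x \<in> M" using assms by blast
    then obtain a s b where "s \<in> zring R" "s \<notin> M" "b \<in> zring R" "x ^ a * s = of_nat p * b"
      using M_power_p by blast
    then show "\<exists>a. divK 1 (x ^ a)" unfolding divK_def by auto
  qed
  then obtain f where f: "\<And>x. x \<in> X \<Longrightarrow> divK 1 (x ^ f x)" by metis
  show ?thesis
  proof (rule that[of "(\<Sum>x\<in>X. f x) * K"])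
    fix x assume x: "x \<in> X"
    then have xz: "x \<in> zring R" using assms M_zring by blast
    have le: "f x \<le> (\<Sum>x\<in>X. f x)" using member_le_sum[OF x, of f] assms by simp
    obtain s b where sb: "s \<in> zring R" "b \<in> zring R" "s \<notin> M" "x ^ f x * s = of_nat p * b"
      using f[OF x] unfolding divK_def by auto
    have "(x ^ f x) ^ K * s ^ K = of_nat p ^ K * b ^ K" using sb(4) by (metis power_mult_distrib)
    then have "divK K ((x ^ f x) ^ K)" unfolding divK_def using sb
      by (intro bexI[of _ "s ^ K"] bexI[of _ "b ^ K"]) (auto intro: zring_intros simp: M_power)
    then have "divK K ((x ^ f x) ^ K * (x ^ ((\<Sum>x\<in>X. f x) - f x)) ^ K)"
      by (rule divK_mult) (intro zring_intros xz)
    moreover have "(x ^ f x) ^ K * (x ^ ((\<Sum>x\<in>X. f x) - f x)) ^ K = x ^ ((\<Sum>x\<in>X. f x) * K)"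
      using le by (simp flip: power_mult_distrib power_add add: power_mult)
    ultimately show "divK K (x ^ ((\<Sum>x\<in>X. f x) * K))" by simp
  qed
qed

text \<open>
  The completion of the decomposition field at \<open>M\<close> is the field of \<open>p\<close>-adic numbers, so valuations of
  its elements are integers: up to elements of high valuation the orbit sum of \<open>t ^ N * P\<close>, an integer,
  is \<open>t ^ N * P\<close> itself.
\<close>

lemma decomposition_field_valuation:
  assumes P: "P \<in> zring R" "\<And>\<sigma>. \<sigma> \<in> Dec \<Longrightarrow> \<sigma> P = P"
    and Pm: "P ^ m * s' = of_nat p ^ e * t'" "s' \<in> zring R" "t' \<in> zring R" "s' \<notin> M" "t' \<notin> M" "m > 0"
  obtains j s t where "s \<in> zring R" "t \<in> zring R" "s \<notin> M" "t \<notin> M" "P * s = of_nat p ^ j * t"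
proof -
  obtain S where S: "finite S" "S \<subseteq> gal_Q" "\<And>\<sigma>. \<sigma> \<in> gal_Q \<Longrightarrow> \<exists>\<tau>\<in>S. \<forall>r\<in>R. \<sigma> r = \<tau> r"
    by (rule representatives, rule that, assumption+)
  have finorb: "finite ((\<lambda>\<sigma>. \<sigma> x) ` A)" if x: "x \<in> zring R" and A: "A \<subseteq> gal_Q" for x A
  proof -
    have "(\<lambda>\<sigma>. \<sigma> x) ` A \<subseteq> (\<lambda>\<sigma>. \<sigma> x) ` S"
    proof
      fix y assume "y \<in> (\<lambda>\<sigma>. \<sigma> x) ` A"
      then obtain \<sigma> where \<sigma>: "\<sigma> \<in> gal_Q" "y = \<sigma> x" using A by blast
      then obtain \<tau> where \<tau>: "\<tau> \<in> S" "\<forall>r\<in>R. \<sigma> r = \<tau> r" using S(3) by blast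
      then have "\<sigma> x = \<tau> x" using agree[OF \<sigma>(1) _ _ x] S(2) by blast
      then show "y \<in> (\<lambda>\<sigma>. \<sigma> x) ` S" using \<sigma> \<tau> by blast
    qed
    then show ?thesis using S(1) finite_surj by blast
  qed
  obtain t where t: "t \<in> zring R" "t \<notin> M" "\<And>\<sigma>. \<sigma> \<in> Dec \<Longrightarrow> \<sigma> t = t"
    "\<And>\<sigma>. \<sigma> \<in> gal_Q \<Longrightarrow> \<sigma> \<notin> Dec \<Longrightarrow> \<sigma> t \<in> M" using decomposition_separator by blast
  \<comment> \<open>The valuation of \<open>P\<close> is e / m, hence at most \<open>e\<close>;
    precision \<open>K = Suc e\<close> is enough to see it.\<close>
  define K where "K = Suc e"
  have "finite ((\<lambda>\<sigma>. \<sigma> t) ` (gal_Q - Dec))" "(\<lambda>\<sigma>. \<sigma> t) ` (gal_Q - Dec) \<subseteq> M"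
    using finorb t by auto
  then obtain N where N: "\<And>x. x \<in> (\<lambda>\<sigma>. \<sigma> t) ` (gal_Q - Dec) \<Longrightarrow> divK K (x ^ N)" using divK_uniform by blast
  define z where "z = t ^ N * P"
  have zz: "z \<in> zring R" unfolding z_def by (intro zring_intros t P)
  have tq: "t ^ N \<in> qbar" "t \<in> qbar" "P \<in> qbar" using zring_qbar t P zring_power by blast+
  have z_conj: "\<sigma> z = (\<sigma> t) ^ N * \<sigma> P" if "\<sigma> \<in> gal_Q" for \<sigma>
    unfolding z_def using gal_mult[OF that tq(1,3)] gal_power[OF that tq(2)] by simp
  \<comment> \<open>Distinct conjugates are summed: \<open>Dec\<close> fixes \<open>z\<close>, so
    \<open>z\<close> occurs once, and every other conjugate comes from outside \<open>Dec\<close>,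
    where the factor \<open>t ^ N\<close> has become divisible by \<open>p ^ K\<close> up to units
    at \<open>M\<close>.\<close>
  define Z where "Z = (\<lambda>\<sigma>. \<sigma> z) ` gal_Q"
  have finZ: "finite Z" unfolding Z_def by (rule finorb[OF zz]) simp
  have Zz: "y \<in> zring R" if "y \<in> Z" for y using that gal_zring[OF _ zz] by (auto simp: Z_def)
  have zZ: "z \<in> Z" unfolding Z_def using gal_id by (intro image_eqI[where x = id]) auto
  have fixed: "\<rho> (\<Sum>Z) = \<Sum>Z" if r: "\<rho> \<in> gal_Q" for \<rho>
  proof -
    have "\<rho> ` Z \<subseteq> Z"
    proof
      fix y assume "y \<in> \<rho> ` Z"
      then obtain \<tau> where "\<tau> \<in> gal_Q" "y = (\<rho> \<circ> \<tau>) z" by (auto simp: Z_def)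
      then show "y \<in> Z" unfolding Z_def using gal_comp[OF r] by blast
    qed
    then show ?thesis using finZ Zz zring_qbar by (intro gal_fixes_sum_prod[OF r]) auto
  qed
  have "algebraic_int (\<Sum>Z)" using Zz by (intro zring_int zring_sum)
  then obtain T where T: "\<Sum>Z = of_int T" using fixed_int fixed by blast
  have "divK K (\<Sum>(Z - {z}))"
  proof (rule divK_sum)
    fix y assume y: "y \<in> Z - {z}"
    then obtain \<sigma> where \<sigma>: "\<sigma> \<in> gal_Q" "y = \<sigma> z" by (auto simp: Z_def)
    have "\<sigma> z = z" if "\<sigma> \<in> Dec" using z_conj[OF \<sigma>(1)] t(3)[OF that] P(2)[OF that] by (simp add: z_def)
    then have "\<sigma> \<notin> Dec" using y \<sigma> by blast
    then have "divK K ((\<sigma> t) ^ N)" using N \<sigma> by blast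
    then show "divK K y" using \<sigma> z_conj[OF \<sigma>(1)] divK_mult gal_zring[OF \<sigma>(1) P(1)] by simp
  qed
  then obtain s b where sb: "s \<in> zring R" "b \<in> zring R" "s \<notin> M" "\<Sum>(Z - {z}) * s = of_nat p ^ K * b"
    unfolding divK_def by blast
  have "\<Sum>Z = z + \<Sum>(Z - {z})" using sum.remove[OF finZ zZ, of "\<lambda>x. x"] by simp
  then have zs: "z * s = of_int T * s - of_nat p ^ K * b" using sb(4) T by (simp add: algebra_simps)
  have not_divK: "\<not> divK K z"
  proof
    assume "divK K z"
    then obtain u c where uc: "u \<in> zring R" "c \<in> zring R" "u \<notin> M" "z * u = of_nat p ^ K * c" unfolding divK_def by blast
    have "of_nat p ^ e * (t ^ (N * m) * u ^ m * t') = (t ^ N) ^ m * u ^ m * (of_nat p ^ e * t')"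
      by (simp add: power_mult mult_ac)
    also have "\<dots> = (t ^ N) ^ m * u ^ m * (P ^ m * s')" unfolding Pm(1) ..
    also have "\<dots> = (z * u) ^ m * s'" by (simp add: z_def power_mult_distrib mult_ac)
    also have "\<dots> = of_nat p ^ (K * m) * (c ^ m * s')" unfolding uc(4) by (simp add: power_mult_distrib power_mult mult_ac)
    also have "\<dots> = of_nat p ^ e * (of_nat p * (of_nat p ^ (K * m - K) * (c ^ m * s')))"
    proof -
      have "K \<le> K * m" using Pm(6) by simp
      then have "K * m = K + (K * m - K)" by simp
      then have "K * m = e + Suc (K * m - K)" unfolding K_def by linarith
      then have "(of_nat p :: complex) ^ (K * m) = of_nat p ^ e * (of_nat p * of_nat p ^ (K * m - K))"
        by (metis power_Suc power_add)
      then show ?thesis by (simp add: mult_ac)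
    qed
    finally have "t ^ (N * m) * u ^ m * t' = of_nat p * (of_nat p ^ (K * m - K) * (c ^ m * s'))"
      using prime_p by (simp add: prime_gt_0_nat)
    also have "\<dots> \<in> M" by (intro M_mult2 M_p zring_mult zring_power zring_of_nat uc Pm)
    finally show False using t uc Pm by (simp add: M_prime_iff M_power zring_intros)
  qed
  have T0: "T \<noteq> 0"
  proof
    assume "T = 0"
    then have "z * s = of_nat p ^ K * (- b)" using zs by simp
    then show False using not_divK sb zring_uminus unfolding divK_def by blast
  qed
  \<comment> \<open>\<open>T\<close> and \<open>z\<close> agree up to valuation \<open>K\<close>,
    and \<open>z\<close> has valuation below \<open>K\<close>; so \<open>z\<close> has the integral
    valuation \<open>j\<close> of \<open>T\<close>.\<close>
  define j where "j = multiplicity (int p) T"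
  obtain T' where T': "T = int p ^ j * T'" "\<not> int p dvd T'"
    using multiplicity_decompose'[of T "int p"] T0 prime_p unfolding j_def
    by (metis not_prime_unit prime_nat_int_transfer)
  have "j < K"
  proof (rule ccontr)
    assume "\<not> j < K"
    then have "(of_nat p :: complex) ^ j = of_nat p ^ K * of_nat p ^ (j - K)" by (simp flip: power_add)
    then have "z * s = of_nat p ^ K * (of_nat p ^ (j - K) * of_int T' * s - b)"
      using zs unfolding T' by (simp add: algebra_simps)
    moreover have "of_nat p ^ (j - K) * of_int T' * s - b \<in> zring R" 
      by (intro zring_diff zring_mult zring_power zring_of_nat zring_of_int sb)
    ultimately show False using not_divK sb unfolding divK_def by blast
  qed
  then obtain k where k: "K = j + Suc k" using less_imp_Suc_add by force
  let ?w = "of_int T' * s - of_nat p * (of_nat p ^ k * b)"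
  have wz: "?w \<in> zring R" by (intro zring_diff zring_mult zring_power zring_of_nat zring_of_int sb)
  have "?w \<notin> M"
  proof
    assume "?w \<in> M"
    then have "?w + of_nat p * (of_nat p ^ k * b) \<in> M"
      by (intro M_add M_mult2 M_p zring_mult zring_power zring_of_nat sb)
    then have "of_int T' * s \<in> M" by simp
    then show False using sb T'(2) by (simp add: M_prime_iff zring_of_int M_of_int)
  qed
  moreover have "P * (t ^ N * s) = of_nat p ^ j * ?w"
    using zs unfolding T' k z_def by (simp add: algebra_simps power_add)
  moreover have "t ^ N * s \<in> zring R" "t ^ N * s \<notin> M"
    using t sb by (auto simp: M_prime_iff M_power zring_intros)
  ultimately show ?thesis using that wz by blast
qed

end

section \<open>The roots of the iterates\<close>

lemma poly_iter: "poly (map_poly of_int (iter f n)) (x :: complex) = (poly (map_poly of_int f) ^^ n) x"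
  by (induction n) (simp_all add: iter_def of_int_hom.map_poly_pcompose poly_pcompose of_int_hom.map_poly_pCons_hom)

lemma iter_0: "iter f 0 = [:0, 1:]"
  by (simp add: iter_def)

lemma iter_Suc: "iter f (Suc n) = pcompose f (iter f n)"
  by (simp add: iter_def)

lemma pderiv_iter: "pderiv (iter f n) = (\<Prod>i<n. pcompose (pderiv f) (iter f i))"
  by (induction n) (simp_all add: iter_0 iter_Suc pderiv_pcompose mult.commute pderiv_pCons)

text \<open>\<delta> is the Vandermonde product, a square root of the discriminant up to the sign
  \<open>e\<close> produced by ordering the pairs.\<close>

lemma prod_differences_square:
  assumes "finite R"
  shows "\<exists>\<delta>\<in>zring R. \<exists>e\<in>{1, -1}. \<delta>\<^sup>2 = e * (\<Prod>r\<in>R. \<Prod>s\<in>R - {r}. r - s)"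
  using assms
proof (induction R rule: finite_induct)
  case empty
  show ?case by (rule bexI[of _ 1]) (auto intro: zring_intros)
next
  case (insert x R)
  then obtain \<delta> e where d: "\<delta> \<in> zring R" "e \<in> {1, -1}" "\<delta>\<^sup>2 = e * (\<Prod>r\<in>R. \<Prod>s\<in>R - {r}. r - s)" by blast
  let ?\<delta> = "\<delta> * (\<Prod>s\<in>R. x - s)"
  have "\<delta> \<in> zring (insert x R)" using d(1) by induction (auto intro: zring_intros)
  then have z: "?\<delta> \<in> zring (insert x R)"
    by (auto intro!: zring_mult zring_prod zring_diff intro: zring_base)
  have "(\<Prod>r\<in>insert x R. \<Prod>s\<in>insert x R - {r}. r - s) = (\<Prod>s\<in>R. x - s) * (\<Prod>r\<in>R. \<Prod>s\<in>insert x R - {r}. r - s)"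
    using insert by (simp add: insert_Diff_if)
  also have "(\<Prod>r\<in>R. \<Prod>s\<in>insert x R - {r}. r - s) = (\<Prod>r\<in>R. (- 1) * (x - r) * (\<Prod>s\<in>R - {r}. r - s))"
  proof (rule prod.cong)
    fix r assume "r \<in> R"
    then have "insert x R - {r} = insert x (R - {r})" "x \<notin> R - {r}" using insert by auto
    then show "(\<Prod>s\<in>insert x R - {r}. r - s) = (- 1) * (x - r) * (\<Prod>s\<in>R - {r}. r - s)"
      using insert by simp
  qed simp
  also have "\<dots> = (- 1) ^ card R * (\<Prod>s\<in>R. x - s) * (\<Prod>r\<in>R. \<Prod>s\<in>R - {r}. r - s)"
    by (simp only: prod.distrib prod_constant)
  finally have *: "(\<Prod>r\<in>insert x R. \<Prod>s\<in>insert x R - {r}. r - s)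
    = (- 1) ^ card R * (\<Prod>s\<in>R. x - s)\<^sup>2 * (\<Prod>r\<in>R. \<Prod>s\<in>R - {r}. r - s)"
    by (simp add: power2_eq_square mult_ac)
  have "?\<delta>\<^sup>2 = (e * (- 1) ^ card R) * (\<Prod>r\<in>insert x R. \<Prod>s\<in>insert x R - {r}. r - s)"
    unfolding * by (simp add: power_mult_distrib d(3) mult_ac flip: power_add)
  moreover have "e * (- 1) ^ card R \<in> {1, -1}" using d(2) by (cases "even (card R)") auto
  ultimately show ?case using z by blast
qed

lemma rat_of_int_poly: "map_poly of_rat (map_poly of_int p :: rat poly) = (map_poly of_int p :: complex poly)"
  by (subst map_poly_map_poly) (auto simp: o_def)

lemma degree_phi_aux:
  assumes "d \<ge> 3"
  shows "degree (phi d c) = d" "lead_coeff (phi d c) = 1"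
proof -
  have c: "coeff (phi d c) i = (if i = d then 1 else if i = d - 1 then - (c * int d) else if i = 0 then c * (int d - 1) else 0)" for i
    using assms by (auto simp: phi_def coeff_pCons split: nat.split)
  show 1: "degree (phi d c) = d"
  proof (rule antisym)
    show "degree (phi d c) \<le> d" using assms by (intro degree_le) (auto simp: c)
    show "d \<le> degree (phi d c)" by (intro le_degree) (simp add: c)
  qed
  show "lead_coeff (phi d c) = 1" unfolding 1 by (simp add: c)
qed

lemma degree_iter:
  assumes "degree f > 0" "lead_coeff f = (1 :: int)"
  shows "degree (iter f n) = degree f ^ n \<and> lead_coeff (iter f n) = 1"
proof (induction n)
  case (Suc n)
  then have "degree (iter f n) > 0" using assms by simp
  then have "lead_coeff (pcompose f (iter f n)) = 1" using Suc assms by (subst lead_coeff_comp) auto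
  then show ?case using Suc by (simp add: iter_Suc degree_pcompose)
qed (simp add: iter_0)

lemma poly_linear_factor:
  "poly (map_poly of_int ([:- k, 1:] * p)) (x :: complex) = (x - of_int k) * poly (map_poly of_int p) x"
proof -
  have "poly (map_poly of_int [:- k, 1:]) x = x - of_int k"
    by (simp add: of_int_hom.map_poly_pCons_hom)
  then show ?thesis unfolding of_int_poly_hom.hom_mult poly_mult by simp
qed

locale arboreal =
  fixes d :: nat and c :: int
  assumes d3: "d \<ge> 3" and cB: "c \<in> B_set d"
begin

abbreviation "f \<equiv> phi d c"

definition ph :: "complex \<Rightarrow> complex" where
  "ph x = poly (map_poly of_int f) x"

definition R :: "nat \<Rightarrow> complex set" where
  "R n = {x. (ph ^^ n) x = 0}"

definition a :: "nat \<Rightarrow> int" where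
  "a n = poly (iter f n) 0"

lemma c_pos: "c > 0" and coprime_c: "coprime c (int d - 1)"
  using cB by (auto simp: B_set_def)

lemma irred: "n \<ge> 1 \<Longrightarrow> irreducible (map_poly of_int (iter f n) :: rat poly)"
  using cB by (auto simp: B_set_def)

lemma ph_iter: "poly (map_poly of_int (iter f n)) x = (ph ^^ n) x"
proof -
  have "ph = poly (map_poly of_int f)" by (simp add: ph_def fun_eq_iff)
  then show ?thesis by (simp add: poly_iter)
qed

lemma ph_eq: "ph x = x ^ d - of_int c * of_nat d * x ^ (d - 1) + of_int c * (of_nat d - 1)"
  by (simp add: ph_def phi_def of_int_poly_hom.hom_minus of_int_poly_hom.hom_add poly_monom
      of_int_hom.map_poly_pCons_hom)

lemma ph_eq': "ph x = x ^ (d - 1) * (x - of_int c * of_nat d) + of_int c * (of_nat d - 1)"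
proof -
  have "x ^ d = x ^ (d - 1) * x" using d3 by (metis Suc_diff_1 gr0I not_numeral_le_zero power_Suc2)
  then show ?thesis by (simp add: ph_eq algebra_simps)
qed

lemma R_0: "R 0 = {0}"
  by (auto simp: R_def)

lemma R_Suc: "x \<in> R (Suc n) \<longleftrightarrow> ph x \<in> R n"
  by (simp add: R_def funpow_swap1)

lemma R_root: "x \<in> R n \<longleftrightarrow> poly (map_poly of_int (iter f n)) x = 0"
  by (simp add: R_def ph_iter)

lemma degree_f: "degree f = d" "lead_coeff f = 1"
  using degree_phi_aux d3 by auto

lemma degree_iter_f: "degree (iter f n) = d ^ n" "lead_coeff (iter f n) = 1"
  using degree_iter[of f n] degree_f d3 by auto

lemma iter_nz: "iter f n \<noteq> 0"
  using degree_iter_f(2)[of n] by auto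

lemma a_eq: "of_int (a n) = (ph ^^ n) 0"
proof -
  have "complex_of_int (poly (iter f n) 0) = poly (map_poly of_int (iter f n)) (of_int 0)"
    by (rule of_int_hom.poly_map_poly[symmetric])
  also have "\<dots> = (ph ^^ n) (of_int 0)" by (rule ph_iter)
  finally show ?thesis by (simp add: a_def)
qed

lemma a_0: "a 0 = 0"
  by (simp add: a_def iter_0)

lemma a_Suc: "a (Suc n) = a n ^ (d - 1) * (a n - c * int d) + c * (int d - 1)"
proof -
  have "complex_of_int (a (Suc n)) = of_int (a n ^ (d - 1) * (a n - c * int d) + c * (int d - 1))"
    by (simp add: a_eq ph_eq')
  then show ?thesis by (simp only: of_int_eq_iff)
qed

lemma a_1: "a 1 = c * (int d - 1)"
  using a_Suc[of 0] d3 by (simp add: a_0)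

text \<open>Over Q an irreducible polynomial cannot divide its nonzero derivative, which has smaller
  degree; so the two have no common root.\<close>

lemma R_simple: "x \<in> R n \<Longrightarrow> poly (pderiv (map_poly of_int (iter f n))) x \<noteq> 0"
proof
  assume x: "x \<in> R n" and 0: "poly (pderiv (map_poly of_int (iter f n))) x = 0"
  show False
  proof (cases "n = 0")
    case True
    then show False using 0 by (simp add: iter_0 of_int_hom.map_poly_pCons_hom pderiv_pCons)
  next
    case False
    let ?P = "map_poly of_int (iter f n) :: rat poly"
    have "poly (map_poly of_rat ?P) x = 0" using x by (simp add: rat_of_int_poly R_root)
    moreover have "poly (map_poly of_rat (pderiv ?P)) x = 0" using 0 by (simp add: rat_of_int_poly of_rat_hom.map_poly_pderiv)
    ultimately have "?P dvd pderiv ?P" using False by (intro rat_poly_dvd_of_common_root[OF irred]) simp_all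
    moreover have deg: "degree ?P = d ^ n" by (simp add: degree_iter_f)
    moreover have "pderiv ?P \<noteq> 0" using deg d3 by (auto simp: pderiv_eq_0_iff)
    ultimately have "degree ?P \<le> degree (pderiv ?P)" using dvd_imp_degree_le by blast
    moreover have "d ^ n > 0" using d3 by simp
    ultimately show False using deg degree_pderiv[of ?P] by linarith
  qed
qed

lemma rsqf: "rsquarefree (map_poly of_int (iter f n) :: complex poly)"
  using R_simple by (auto simp: rsquarefree_roots R_root)

lemma F_prod: "(map_poly of_int (iter f n) :: complex poly) = (\<Prod>r\<in>R n. [:- r, 1:])"
proof -
  have "R n = {z. poly (map_poly of_int (iter f n)) z = 0}" by (auto simp: R_root)
  moreover have "lead_coeff (map_poly of_int (iter f n) :: complex poly) = 1" using degree_iter_f by simp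
  ultimately show ?thesis using complex_poly_decompose_rsquarefree[OF rsqf[of n]] by simp
qed

lemma F_prod_val: "(ph ^^ n) x = (\<Prod>r\<in>R n. x - r)"
proof -
  have "(ph ^^ n) x = poly (\<Prod>r\<in>R n. [:- r, 1:]) x" unfolding F_prod[symmetric] ph_iter ..
  then show ?thesis by (simp add: poly_prod)
qed

lemma finite_R: "finite (R n)"
proof -
  have "finite {x. poly (map_poly of_int (iter f n)) x = (0 :: complex)}" using iter_nz by (intro poly_roots_finite) simp
  then show ?thesis by (simp add: R_root[abs_def, symmetric])
qed

lemma card_R: "card (R n) = d ^ n"
proof -
  have "d ^ n = degree (map_poly of_int (iter f n) :: complex poly)" by (simp add: degree_iter_f)
  also have "\<dots> = (\<Sum>r\<in>R n. degree [:- r, 1:])" unfolding F_prod by (rule degree_prod_eq_sum_degree) auto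
  finally show ?thesis by simp
qed

lemma gal_R: "\<sigma> \<in> gal_Q \<Longrightarrow> x \<in> R n \<Longrightarrow> \<sigma> x \<in> R n"
proof -
  assume s: "\<sigma> \<in> gal_Q" and x: "x \<in> R n"
  then have q: "x \<in> qbar" using ipoly_root_qbar[of "iter f n" x] iter_nz by (auto simp: R_root)
  show ?thesis using gal_ipoly[OF s q, of "iter f n"] x gal_0[OF s] by (simp add: R_root)
qed

lemma gal_bij_R: "\<sigma> \<in> gal_Q \<Longrightarrow> bij_betw \<sigma> (R n) (R n)"
  using gal_R ipoly_root_qbar[OF iter_nz] by (intro gal_permutes finite_R) (auto simp: R_root)

lemma R_alg_int: "x \<in> R n \<Longrightarrow> algebraic_int x"
  using degree_iter_f by (auto simp: algebraic_int_altdef_ipoly R_root)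

sublocale gs: galois_stable "R n" for n
  by unfold_locales (auto intro: finite_R R_alg_int gal_R)

lemma R_qbar: "x \<in> R n \<Longrightarrow> x \<in> qbar"
  using R_alg_int by (auto simp: qbar_def)

lemma ph_qbar: "x \<in> qbar \<Longrightarrow> ph x \<in> qbar"
  by (auto simp: ph_def poly_altdef intro!: qbar_sum qbar_ring qbar_power)

lemma gal_ph: "\<sigma> \<in> gal_Q \<Longrightarrow> x \<in> qbar \<Longrightarrow> \<sigma> (ph x) = ph (\<sigma> x)"
  by (simp add: ph_def gal_ipoly)

lemma gal_transitive_R:
  assumes "x \<in> R n" "y \<in> R n"
  obtains \<sigma> where "\<sigma> \<in> gal_Q" "\<sigma> x = y"
proof (cases "n = 0")
  case True
  then show ?thesis using assms that[OF gal_id] by (simp add: R_0)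
next
  case False
  then have "irreducible (map_poly of_int (iter f n) :: rat poly)" using irred by simp
  then show ?thesis
    using gal_transitive[of "map_poly of_int (iter f n)" x y] assms R_qbar[OF assms(1)] that
    by (auto simp: rat_of_int_poly R_root)
qed

lemma pderiv_f: "pderiv f = [:- a 1, 1:] * monom (int d) (d - 2)"
proof -
  define e where "e = d - 2"
  have e: "d = Suc (Suc e)" "d - 1 = Suc e" using d3 by (simp_all add: e_def)
  have "[:- a 1, 1:] * monom (int d) e = monom (int d) (Suc e) - smult (a 1) (monom (int d) e)"
    by (simp add: monom_Suc)
  also have "\<dots> = pderiv f"
    unfolding a_1 phi_def e(2) pderiv_add pderiv_diff pderiv_monom
    by (simp add: pderiv_pCons smult_monom e(1) algebra_simps)
  finally show ?thesis by (simp add: e_def)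
qed

lemma poly_pderiv_f: "poly (map_poly of_int (pderiv f)) (x :: complex) = of_nat d * x ^ (d - 2) * (x - of_int (a 1))"
  unfolding pderiv_f poly_linear_factor by (simp add: poly_monom)

text \<open>The cofactor of \<open>x - a 1\<close> in the derivative of the \<open>n\<close>-th
  iterate. For a prime satisfying \<open>good_prime\<close> it is a unit at every root, which leaves
  \<open>x - a 1\<close> as the only cause of coinciding roots.\<close>

definition H :: "nat \<Rightarrow> int poly" where
  "H n = monom (int d) (d - 2) * (\<Prod>i\<in>{1..<n}. pcompose (pderiv f) (iter f i))"

lemma pderiv_F: "n \<ge> 1 \<Longrightarrow> pderiv (iter f n) = [:- a 1, 1:] * H n"
proof -
  assume n: "n \<ge> 1"
  have "{..<n} = insert 0 {1..<n}" using n by auto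
  then have "pderiv (iter f n) = pcompose (pderiv f) (iter f 0) * (\<Prod>i\<in>{1..<n}. pcompose (pderiv f) (iter f i))"
    by (simp add: pderiv_iter)
  also have "pcompose (pderiv f) (iter f 0) = pderiv f" unfolding iter_0 by (rule pcompose_idR)
  finally show ?thesis unfolding pderiv_f H_def by (simp only: mult.assoc)
qed

lemma H_val: "poly (map_poly of_int (H n)) x = of_nat d * x ^ (d - 2) *
    (\<Prod>i\<in>{1..<n}. of_nat d * ((ph ^^ i) x) ^ (d - 2) * ((ph ^^ i) x - of_int (a 1)))"
  by (simp add: H_def of_int_poly_hom.hom_mult of_int_poly_hom.hom_prod poly_monom poly_prod
      of_int_hom.map_poly_pcompose poly_pcompose ph_iter poly_pderiv_f)

lemma F'_val: "n \<ge> 1 \<Longrightarrow> poly (pderiv (map_poly of_int (iter f n))) (x :: complex) = (x - of_int (a 1)) * poly (map_poly of_int (H n)) x"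
  unfolding of_int_hom.map_poly_pderiv[symmetric] by (simp only: pderiv_F poly_linear_factor)

lemma F'_root: "r \<in> R n \<Longrightarrow> poly (pderiv (map_poly of_int (iter f n))) r = (\<Prod>s\<in>R n - {r}. r - s)"
proof -
  assume r: "r \<in> R n"
  have "(\<Prod>r\<in>R n. [:- r, 1:]) = [:- r, 1:] * (\<Prod>r\<in>R n - {r}. [:- r, 1:])"
    by (rule prod.remove[OF finite_R r])
  then have "poly (pderiv (map_poly of_int (iter f n))) r = poly (\<Prod>r\<in>R n - {r}. [:- r, 1:]) r"
    unfolding F_prod by (simp add: pderiv_mult pderiv_pCons del: mult_pCons_left)
  then show ?thesis by (simp add: poly_prod)
qed

end

section \<open>Transpositions from primitive prime divisors\<close>

context arboreal
begin

definition fib :: "complex \<Rightarrow> complex set" where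
  "fib \<beta> = {x. ph x = \<beta>}"

lemma fib_poly: "fib \<beta> = {x. poly (map_poly of_int f - [:\<beta>:]) x = 0}"
  by (simp add: fib_def ph_def)

lemma fib_poly_nz: "map_poly of_int f - [:\<beta> :: complex:] \<noteq> 0" and
  degree_fib_poly: "degree (map_poly of_int f - [:\<beta> :: complex:]) = d"
proof -
  have "degree (map_poly of_int f :: complex poly) = d" using degree_f by simp
  then show *: "degree (map_poly of_int f - [:\<beta> :: complex:]) = d"
    unfolding diff_conv_add_uminus using d3 by (subst degree_add_eq_left) auto
  show "map_poly of_int f - [:\<beta> :: complex:] \<noteq> 0"
  proof
    assume "map_poly of_int f - [:\<beta> :: complex:] = 0"
    then show False using * d3 by (metis degree_0 not_numeral_le_zero)
  qed
qed

lemma finite_fib: "finite (fib \<beta>)"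
  unfolding fib_poly by (rule poly_roots_finite[OF fib_poly_nz])

lemma card_fib_le: "card (fib \<beta>) \<le> d"
  unfolding fib_poly using card_poly_roots_bound[OF fib_poly_nz] degree_fib_poly by metis

lemma R_Suc_fib: "R (Suc n) = (\<Union>\<beta>\<in>R n. fib \<beta>)"
  by (auto simp: R_Suc fib_def)

text \<open>Each of the d^n fibres has at most \<open>d\<close> elements and their union has
  d^(n+1), so none can be smaller.\<close>

lemma card_fib: "\<beta> \<in> R n \<Longrightarrow> card (fib \<beta>) = d"
proof (rule ccontr)
  assume b: "\<beta> \<in> R n" and "card (fib \<beta>) \<noteq> d"
  then have lt: "card (fib \<beta>) < d" using card_fib_le[of \<beta>] by simp
  have "card (R (Suc n)) = (\<Sum>\<beta>\<in>R n. card (fib \<beta>))"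
    unfolding R_Suc_fib by (rule card_UN_disjoint) (simp add: finite_R, simp add: finite_fib, auto simp: fib_def)
  also have "\<dots> < (\<Sum>\<beta>\<in>R n. d)"
    using b lt card_fib_le finite_R by (intro sum_strict_mono_ex1) auto
  finally show False by (simp add: card_R)
qed

lemma fib_R: "\<beta> \<in> R n \<Longrightarrow> fib \<beta> \<subseteq> R (Suc n)"
  by (auto simp: R_Suc fib_def)

lemma fib_poly_prod: assumes "\<beta> \<in> R n" shows "map_poly of_int f - [:\<beta>:] = (\<Prod>y\<in>fib \<beta>. [:- y, 1:])"
proof -
  let ?p = "map_poly of_int f - [:\<beta>:]"
  have "poly (pderiv ?p) y \<noteq> 0" if y: "poly ?p y = 0" for y
  proof
    assume "poly (pderiv ?p) y = 0"
    then have 0: "poly (pderiv (map_poly of_int f)) y = 0" by (simp add: pderiv_diff pderiv_pCons)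
    have "y \<in> R (Suc n)" using y assms by (simp add: R_Suc ph_def)
    \<comment> \<open>\<open>iter_Suc\<close> has \<open>f\<close> outermost; here the chain rule is
      applied with \<open>f\<close> innermost, so that a critical point of \<open>f\<close> becomes
      a critical point of the iterate.\<close>
    moreover have "iter f (Suc n) = pcompose (iter f n) f"
    proof (induction n)
      case 0
      show ?case unfolding iter_Suc iter_0 pcompose_idR by (simp add: pcompose_pCons)
    next
      case (Suc n)
      then show ?case by (metis iter_Suc pcompose_assoc)
    qed
    then have "poly (pderiv (map_poly of_int (iter f (Suc n)))) y = 0"
      using 0 by (simp add: of_int_hom.map_poly_pcompose pderiv_pcompose poly_pcompose)
    ultimately show False using R_simple by blast
  qed
  then have "rsquarefree ?p" by (auto simp: rsquarefree_roots)
  then have e: "smult (lead_coeff ?p) (\<Prod>z\<in>fib \<beta>. [:-z, 1:]) = ?p"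
    unfolding fib_poly by (rule complex_poly_decompose_rsquarefree)
  have "coeff (map_poly of_int f - [:\<beta>:]) d = (1 :: complex)"
    using degree_f d3 by (cases d) simp_all
  then have "lead_coeff ?p = 1" by (simp only: degree_fib_poly)
  then show ?thesis using e by simp
qed

lemma fib_prod: assumes "\<beta> \<in> R n" shows "ph x - \<beta> = (\<Prod>y\<in>fib \<beta>. x - y)"
proof -
  have "poly (map_poly of_int f - [:\<beta>:]) x = (\<Prod>y\<in>fib \<beta>. x - y)"
    unfolding fib_poly_prod[OF assms] by (simp add: poly_prod)
  then show ?thesis by (simp add: ph_def)
qed

lemma fib_deriv: 
  assumes "\<beta> \<in> R n" "y \<in> fib \<beta>"
  shows "of_nat d * y ^ (d - 2) * (y - of_int (a 1)) = (\<Prod>z\<in>fib \<beta> - {y}. y - z)"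
proof -
  have "(\<Prod>y\<in>fib \<beta>. [:- y, 1:]) = [:- y, 1:] * (\<Prod>y\<in>fib \<beta> - {y}. [:- y, 1:])"
    by (rule prod.remove[OF finite_fib assms(2)])
  then have "pderiv (map_poly of_int f - [:\<beta>:]) = pderiv ([:- y, 1:] * (\<Prod>y\<in>fib \<beta> - {y}. [:- y, 1:]))"
    unfolding fib_poly_prod[OF assms(1)] by simp
  then have "poly (pderiv (map_poly of_int f - [:\<beta>:])) y = (\<Prod>z\<in>fib \<beta> - {y}. y - z)"
    by (simp add: pderiv_mult pderiv_pCons poly_prod del: mult_pCons_left)
  moreover have "pderiv (map_poly of_int f - [:\<beta>:]) = map_poly of_int (pderiv f)"
    by (simp add: pderiv_diff pderiv_pCons of_int_hom.map_poly_pderiv)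
  ultimately show ?thesis by (simp only: poly_pderiv_f)
qed

text \<open>The index \<open>Suc n\<close> appears because the critical point \<open>a 1\<close> has
  \<open>n\<close>-th image \<open>a (Suc n)\<close>. Primes dividing \<open>d\<close> or an earlier
  \<open>a i\<close> are excluded so that \<open>H n\<close> is a unit at the roots.\<close>

definition good_prime :: "nat \<Rightarrow> nat \<Rightarrow> bool" where
  "good_prime n p \<longleftrightarrow> prime p \<and> \<not> p dvd d \<and> odd (multiplicity (int p) (a (Suc n))) \<and> (\<forall>i\<in>{1..n}. \<not> int p dvd a i)"

definition swaps :: "nat \<Rightarrow> complex \<Rightarrow> complex \<Rightarrow> bool" where
  "swaps n r s \<longleftrightarrow> (\<exists>\<sigma>\<in>gal_Q. \<sigma> r = s \<and> \<sigma> s = r \<and> (\<forall>t\<in>R n - {r, s}. \<sigma> t = t))"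

lemma ph_zring: "x \<in> zring A \<Longrightarrow> ph x \<in> zring A"
  unfolding ph_def by (rule zring_ipoly)

lemma funpow_ph_zring: "x \<in> zring A \<Longrightarrow> (ph ^^ n) x \<in> zring A"
  by (induction n) (auto intro: ph_zring)

lemma funpow_ph_M_iff:
  assumes "prime_over (R n) p M" "x \<in> zring (R n)" "x - of_int y \<in> M"
  shows "(ph ^^ k) x \<in> M \<longleftrightarrow> (ph ^^ k) (of_int y) \<in> M"
proof -
  interpret prime_over "R n" p M by fact
  show ?thesis unfolding ph_iter[symmetric] by (rule M_ipoly_iff[OF assms(2) zring_of_int assms(3)])
qed

text \<open>If the factor of index \<open>i\<close> lay in \<open>M\<close>, then the
  \<open>i\<close>-th image of \<open>x\<close> would be congruent to 0 or to \<open>a 1\<close>, or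
  \<open>d\<close> would be in \<open>M\<close>. Applying the remaining n - i steps would put
  \<open>a (n - i)\<close> or \<open>a (Suc (n - i))\<close> in \<open>M\<close>. Both indices lie
  between 1 and n, because \<open>H n\<close> omits the factor \<open>x - a 1\<close> at i =
  0.\<close>

lemma H_unit:
  assumes "prime_over (R n) p M" "n \<ge> 1" "good_prime n p" "x \<in> zring (R n)" "(ph ^^ n) x \<in> M"
  shows "poly (map_poly of_int (H n)) x \<notin> M"
proof -
  interpret prime_over "R n" p M by fact
  have gp: "\<not> int p dvd a i" if "1 \<le> i" "i \<le> n" for i using assms(3) that by (simp add: good_prime_def)
  have aM: "(ph ^^ i) 0 \<notin> M" if "1 \<le> i" "i \<le> n" for i using gp[OF that] by (simp add: a_eq[symmetric] M_of_int)
  have dM: "of_nat d \<notin> M" using assms(3) M_of_int[of "int d"] by (simp add: good_prime_def)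
  have yz: "(ph ^^ i) x \<in> zring (R n)" for i by (rule funpow_ph_zring[OF assms(4)])
  have split: "(ph ^^ (n - i)) ((ph ^^ i) x) = (ph ^^ n) x" if "i \<le> n" for i
    using that by (simp flip: funpow_add[THEN fun_cong, unfolded o_apply])
  have 1: "(ph ^^ i) x \<notin> M" if "i < n" for i
  proof
    assume "(ph ^^ i) x \<in> M"
    then have "(ph ^^ (n - i)) ((ph ^^ i) x) \<in> M \<longleftrightarrow> (ph ^^ (n - i)) 0 \<in> M"
      using funpow_ph_M_iff[OF assms(1) yz, of i 0 "n - i"] by simp
    then show False using split[of i] assms(5) aM[of "n - i"] that by simp
  qed
  have 2: "(ph ^^ i) x - of_int (a 1) \<notin> M" if "1 \<le> i" "i < n" for i
  proof
    assume "(ph ^^ i) x - of_int (a 1) \<in> M"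
    then have "(ph ^^ (n - i)) ((ph ^^ i) x) \<in> M \<longleftrightarrow> (ph ^^ (n - i)) (of_int (a 1)) \<in> M"
      by (rule funpow_ph_M_iff[OF assms(1) yz])
    moreover have "(ph ^^ (n - i)) (of_int (a 1)) = (ph ^^ Suc (n - i)) 0"
      by (simp add: a_eq funpow_swap1)
    ultimately show False using split[of i] assms(5) aM[of "Suc (n - i)"] that by simp
  qed
  have z: "of_nat d * ((ph ^^ i) x) ^ (d - 2) * ((ph ^^ i) x - of_int (a 1)) \<in> zring (R n)" for i
    by (intro zring_mult zring_power zring_diff zring_of_nat zring_of_int yz)
  have u1: "of_nat d * x ^ (d - 2) \<notin> M"
    using 1[of 0] dM assms(2,4) by (simp add: M_prime_iff M_power zring_of_nat zring_power)
  have "of_nat d * ((ph ^^ i) x) ^ (d - 2) * ((ph ^^ i) x - of_int (a 1)) \<notin> M" if "i \<in> {1..<n}" for i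
  proof -
    have z': "(ph ^^ i) x - of_int (a 1) \<in> zring (R n)" "of_nat d * ((ph ^^ i) x) ^ (d - 2) \<in> zring (R n)"
      by (intro zring_mult zring_power zring_diff zring_of_nat zring_of_int yz)+
    have "of_nat d * ((ph ^^ i) x) ^ (d - 2) \<notin> M"
      using 1[of i] dM that yz by (simp add: M_prime_iff M_power zring_of_nat zring_power)
    then show ?thesis using 2[of i] that M_prime_iff[OF z'(2,1)] by simp
  qed
  then have u2: "(\<Prod>i\<in>{1..<n}. of_nat d * ((ph ^^ i) x) ^ (d - 2) * ((ph ^^ i) x - of_int (a 1))) \<notin> M"
    using z by (subst M_prod) auto
  show ?thesis unfolding H_val
  proof (subst M_prime_iff)
    show "of_nat d * x ^ (d - 2) \<in> zring (R n)" by (intro zring_mult zring_power zring_of_nat assms(4))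
    show "(\<Prod>i\<in>{1..<n}. of_nat d * ((ph ^^ i) x) ^ (d - 2) * ((ph ^^ i) x - of_int (a 1))) \<in> zring (R n)"
      using z by (intro zring_prod)
  qed (use u1 u2 in blast)
qed

text \<open>A second root congruent to \<open>r\<close> puts the derivative at \<open>r\<close>, a
  product of differences of roots, into \<open>M\<close>, while its cofactor \<open>H n\<close> is a
  unit.\<close>

lemma double_root_mod:
  assumes "prime_over (R n) p M" "n \<ge> 1" "good_prime n p" "r \<in> R n" "s \<in> R n" "r \<noteq> s" "r - s \<in> M"
  shows "r - of_int (a 1) \<in> M"
proof -
  interpret prime_over "R n" p M by fact
  have rz: "r \<in> zring (R n)" using assms(4) by (rule zring_base)
  have "(ph ^^ n) r = 0" using assms(4) by (simp add: R_def)
  then have H: "poly (map_poly of_int (H n)) r \<notin> M" using H_unit[OF assms(1-3) rz] M_0 by simp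
  have "(\<Prod>s\<in>R n - {r}. r - s) \<in> M"
    using assms(4-7) finite_R by (subst M_prod) (auto intro: zring_diff zring_base)
  then have "(r - of_int (a 1)) * poly (map_poly of_int (H n)) r \<in> M"
    using F'_val[OF assms(2), of r] F'_root[OF assms(4)] by simp
  then show ?thesis using H rz by (subst (asm) M_prime_iff) (auto intro: zring_diff zring_of_int zring_ipoly)
qed

lemma zring_poly_prod: "A \<subseteq> zring B \<Longrightarrow> x \<in> zring B \<Longrightarrow>
    poly (\<Prod>r\<in>A. [:- r, 1:]) x \<in> zring B \<and> poly (pderiv (\<Prod>r\<in>A. [:- r, 1:])) x \<in> zring B
   \<and> poly (pderiv (pderiv (\<Prod>r\<in>A. [:- r, 1:]))) x \<in> zring B"
proof (induction A rule: infinite_finite_induct)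
  case (insert r A)
  then show ?case
    using zring_of_int[of 2 B]
    by (simp add: pderiv_mult pderiv_add pderiv_pCons del: mult_pCons_left)
       (auto intro!: zring_add zring_mult zring_diff)
qed (auto intro: zring_0 zring_1)

text \<open>Three roots congruent to \<open>a 1\<close> put the second derivative at
  \<open>a 1\<close> into \<open>M\<close>. But there it equals the value of \<open>H n\<close>,
  because the first derivative is \<open>x - a 1\<close> times \<open>H n\<close>.\<close>

lemma no_triple_root_mod:
  assumes "prime_over (R n) p M" "n \<ge> 1" "good_prime n p" "r \<in> R n" "s \<in> R n" "t \<in> R n" "r \<noteq> s" "s \<noteq> t" "r \<noteq> t"
  and "r - of_int (a 1) \<in> M" "s - of_int (a 1) \<in> M" "t - of_int (a 1) \<in> M"
  shows False
proof -
  interpret prime_over "R n" p M by fact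
  let ?a = "of_int (a 1) :: complex"
  define W where "W = (\<Prod>r\<in>R n - {r, s, t}. [:- r, 1:])"
  let ?F = "map_poly of_int (iter f n) :: complex poly"
  have "R n = insert r (insert s (insert t (R n - {r, s, t})))" using assms by blast
  then have "(\<Prod>r\<in>R n. [:- r, 1:]) = (\<Prod>r\<in>insert r (insert s (insert t (R n - {r, s, t}))). [:- r, 1:])"
    by simp
  then have FW: "?F = [:- r, 1:] * ([:- s, 1:] * ([:- t, 1:] * W))"
    unfolding F_prod W_def using assms(7-9) finite_R by (simp del: mult_pCons_left)
  have az: "?a \<in> zring (R n)" by (rule zring_of_int)
  have Wz: "poly W ?a \<in> zring (R n)" "poly (pderiv W) ?a \<in> zring (R n)" "poly (pderiv (pderiv W)) ?a \<in> zring (R n)"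
    unfolding W_def using zring_poly_prod[of "R n - {r, s, t}" "R n" ?a] az by (auto intro: zring_base)
  have aM: "?a - r \<in> M" "?a - s \<in> M" "?a - t \<in> M"
    using M_uminus[OF assms(10)] M_uminus[OF assms(11)] M_uminus[OF assms(12)] by auto
  have "poly (pderiv (pderiv ?F)) ?a \<in> M"
  proof -
    have "poly (pderiv (pderiv ?F)) ?a =
       (?a - r) * ((?a - s) * ((?a - t) * poly (pderiv (pderiv W)) ?a) 
          + 2 * ((?a - s) * poly (pderiv W) ?a) + 2 * ((?a - t) * poly (pderiv W) ?a) + 2 * poly W ?a)
      + (?a - s) * (2 * ((?a - t) * poly (pderiv W) ?a) + 2 * poly W ?a) + (?a - t) * (2 * poly W ?a)"
      unfolding FW by (simp add: pderiv_mult pderiv_add pderiv_pCons del: mult_pCons_left) (simp add: algebra_simps)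
    moreover have 2: "(2 :: complex) \<in> zring (R n)" using zring_of_int[of 2 "R n"] by simp
    moreover have "?a - r \<in> zring (R n)" "?a - s \<in> zring (R n)" "?a - t \<in> zring (R n)"
      using aM M_zring by auto
    ultimately show ?thesis
      using aM Wz by (simp only:) (intro M_add M_mult2 zring_add zring_mult; assumption)
  qed
  moreover have "poly (pderiv (pderiv ?F)) ?a = poly (map_poly of_int (H n)) ?a"
  proof -
    have "pderiv ?F = map_poly of_int ([:- a 1, 1:] * H n)"
      by (simp only: of_int_hom.map_poly_pderiv[symmetric] pderiv_F[OF assms(2)])
    also have "\<dots> = [:- ?a, 1:] * map_poly of_int (H n)"
      unfolding of_int_poly_hom.hom_mult by (simp add: of_int_hom.map_poly_pCons_hom)
    finally show ?thesis by (simp add: pderiv_mult pderiv_pCons del: mult_pCons_left)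
  qed
  moreover have "poly (map_poly of_int (H n)) ?a \<notin> M"
  proof (rule H_unit[OF assms(1-3) az])
    have "(ph ^^ n) ?a = of_int (a (Suc n))" by (simp add: a_eq funpow_swap1)
    moreover have "int p dvd a (Suc n)" using assms(3) unfolding good_prime_def
      by (metis even_zero not_dvd_imp_multiplicity_0)
    ultimately show "(ph ^^ n) ?a \<in> M" by (simp add: M_of_int)
  qed
  ultimately show False by simp
qed

text \<open>Up to sign the discriminant is \<open>a (Suc n)\<close> times an integer
  \<open>u\<close> prime to \<open>p\<close>, so inertia acts nontrivially. It moves only roots
  congruent to \<open>a 1\<close>, and there are at most two of those.\<close>

lemma transposition_exists:
  assumes "n \<ge> 1" "good_prime n p"
  shows "\<exists>r\<in>R n. \<exists>s\<in>R n. r \<noteq> s \<and> swaps n r s"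
proof -
  have p: "prime p" using assms by (simp add: good_prime_def)
  obtain M where M: "prime_over (R n) p M" using gs.prime_over_exists[OF p] by blast
  interpret prime_over "R n" p M by fact
  obtain \<delta> e where \<delta>: "\<delta> \<in> zring (R n)" "e \<in> {1, -1}" "\<delta>\<^sup>2 = e * (\<Prod>r\<in>R n. \<Prod>s\<in>R n - {r}. r - s)"
    using prod_differences_square[OF finite_R] by blast
  define U where "U = (\<Prod>r\<in>R n. poly (map_poly of_int (H n)) r)"
  have Hz: "poly (map_poly of_int (H n)) r \<in> zring (R n)" if "r \<in> R n" for r
    using that by (intro zring_ipoly zring_base)
  have Uz: "U \<in> zring (R n)" unfolding U_def using Hz by (rule zring_prod)
  have UM: "U \<notin> M" unfolding U_def using Hz H_unit[OF M assms zring_base] M_0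
    by (subst M_prod[OF finite_R]) (auto simp: R_def)
  have U_fixed: "\<sigma> U = U" if s: "\<sigma> \<in> gal_Q" for \<sigma>
  proof -
    have bij: "bij_betw \<sigma> (R n) (R n)" by (rule gal_bij_R[OF s])
    have "\<sigma> U = (\<Prod>r\<in>R n. \<sigma> (poly (map_poly of_int (H n)) r))"
      unfolding U_def using Hz gs.zring_qbar by (intro gal_prod[OF s]) blast
    also have "\<dots> = (\<Prod>r\<in>R n. poly (map_poly of_int (H n)) (\<sigma> r))"
      using gal_ipoly[OF s R_qbar] by (intro prod.cong) auto
    also have "\<dots> = U" unfolding U_def by (rule prod.reindex_bij_betw[OF bij])
    finally show ?thesis .
  qed
  obtain u where u: "U = of_int u" using gs.fixed_int[OF gs.zring_int[OF Uz]] U_fixed by blast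
  have pu: "\<not> int p dvd u" using UM by (simp add: u M_of_int)
  \<comment> \<open>At \<open>a 1\<close> the iterate takes the value \<open>a (Suc n)\<close>; this
    is where the odd multiplicity enters the discriminant.\<close>
  have "(\<Prod>r\<in>R n. r - of_int (a 1)) = (- 1) ^ card (R n) * (\<Prod>r\<in>R n. of_int (a 1) - r)"
    by (simp flip: prod_constant prod.distrib)
  also have "(\<Prod>r\<in>R n. of_int (a 1) - r) = of_int (a (Suc n))"
    by (simp add: F_prod_val[symmetric] a_eq funpow_swap1)
  finally have P: "(\<Prod>r\<in>R n. r - of_int (a 1)) = (- 1) ^ card (R n) * of_int (a (Suc n))" .
  have "(\<Prod>r\<in>R n. \<Prod>s\<in>R n - {r}. r - s) = (\<Prod>r\<in>R n. (r - of_int (a 1)) * poly (map_poly of_int (H n)) r)"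
    by (intro prod.cong refl) (simp only: F'_root[symmetric] F'_val[OF assms(1)])
  also have "\<dots> = (- 1) ^ card (R n) * of_int (a (Suc n)) * of_int u"
    by (simp only: prod.distrib P U_def[symmetric] u)
  finally have \<delta>2: "\<delta>\<^sup>2 = (e * (- 1) ^ card (R n)) * of_int (a (Suc n) * u)" using \<delta>(3) by simp
  define \<epsilon> :: int where "\<epsilon> = (if e * (- 1) ^ card (R n) = 1 then 1 else - 1)"
  have "e * (- 1) ^ card (R n) = 1 \<or> e * (- 1) ^ card (R n) = - 1" using \<delta>(2) by (cases "even (card (R n))") auto
  then have \<epsilon>: "\<epsilon> \<in> {1, - 1}" "e * (- 1) ^ card (R n) = of_int \<epsilon>" by (auto simp: \<epsilon>_def)
  define D where "D = \<epsilon> * (a (Suc n) * u)"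
  have D2: "\<delta>\<^sup>2 = of_int D" unfolding \<delta>2 \<epsilon>(2) D_def by simp
  have odd: "odd (multiplicity (int p) (a (Suc n)))" using assms by (simp add: good_prime_def)
  have an0: "a (Suc n) \<noteq> 0" using odd by (metis even_zero multiplicity_zero)
  have u0: "u \<noteq> 0" using pu by auto
  have p\<epsilon>: "\<not> int p dvd \<epsilon>" "\<epsilon> \<noteq> 0" using \<epsilon>(1) p by (auto simp: prime_nat_iff)
  have "multiplicity (int p) D = multiplicity (int p) \<epsilon> + (multiplicity (int p) (a (Suc n)) + multiplicity (int p) u)"
    unfolding D_def using an0 u0 p\<epsilon> p by (simp add: prime_elem_multiplicity_mult_distrib)
  also have "\<dots> = multiplicity (int p) (a (Suc n))"
    using pu p\<epsilon> by (simp add: not_dvd_imp_multiplicity_0)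
  finally have Dm: "odd (multiplicity (int p) D)" using odd by simp
  have "D \<noteq> 0" using an0 u0 \<epsilon>(1) by (auto simp: D_def)
  then obtain \<sigma> where \<sigma>: "\<sigma> \<in> gal_Q" "\<And>r. r \<in> R n \<Longrightarrow> \<sigma> r - r \<in> M" and ex: "\<exists>r\<in>R n. \<sigma> r \<noteq> r"
    using inertia_nontrivial[OF \<delta>(1) D2 _ Dm] by blast
  then obtain r where r: "r \<in> R n" "\<sigma> r \<noteq> r" by blast
  have moved: "t - of_int (a 1) \<in> M" if "t \<in> R n" "\<sigma> t \<noteq> t" for t
  proof -
    have "t - \<sigma> t \<in> M" using M_uminus[OF \<sigma>(2)[OF that(1)]] by simp
    then show ?thesis using double_root_mod[OF M assms that(1) gal_R[OF \<sigma>(1) that(1)]] that by auto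
  qed
  define s where "s = \<sigma> r"
  have s: "s \<in> R n" "s \<noteq> r" using r gal_R[OF \<sigma>(1)] by (auto simp: s_def)
  have inj: "\<sigma> x = \<sigma> y \<longleftrightarrow> x = y" if "x \<in> R n" "y \<in> R n" for x y
    using gal_inj[OF \<sigma>(1)] R_qbar that by blast
  have ss: "\<sigma> s \<noteq> s" using inj[OF s(1) r(1)] s by (simp add: s_def)
  have ra: "r - of_int (a 1) \<in> M" and sa: "s - of_int (a 1) \<in> M" using moved r s ss by auto
  have no3: "t = r \<or> t = s" if "t \<in> R n" "t - of_int (a 1) \<in> M" for t
    using no_triple_root_mod[OF M assms r(1) s(1) that(1)] s(2) ra sa that(2) by auto
  have "\<sigma> s = r"
  proof -
    have "(\<sigma> s - s) + (s - of_int (a 1)) \<in> M" using \<sigma>(2)[OF s(1)] sa by (rule M_add)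
    then show ?thesis using no3[OF gal_R[OF \<sigma>(1) s(1)]] ss by simp
  qed
  moreover have "\<sigma> t = t" if "t \<in> R n - {r, s}" for t using that moved no3 by blast
  ultimately have "swaps n r s" unfolding swaps_def using s_def by (intro bexI[OF _ \<sigma>(1)]) simp
  then show ?thesis using r(1) s by (intro bexI[of _ r] bexI[of _ s]) auto
qed

end

section \<open>Primitivity on the fibres\<close>

context arboreal
begin

text \<open>For n > 0 this says that the kernel of restriction from level \<open>n\<close> to level
  \<open>n - 1\<close> is the full product of the symmetric groups of the fibres.\<close>

definition full :: "nat \<Rightarrow> bool" where
  "full n \<longleftrightarrow> (\<forall>g. bij_betw g (R n) (R n) \<longrightarrow> (\<forall>r\<in>R n. ph (g r) = ph r) \<longrightarrow> (\<exists>\<sigma>\<in>gal_Q. \<forall>r\<in>R n. \<sigma> r = g r))"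

text \<open>Primitivity is phrased by Galois-invariant equivalence relations inside the fibre
  relation, on all fibres at once; it then applies directly to \<open>swaps n\<close>, without
  passing to the stabiliser of a vertex.\<close>

definition fibre_primitive :: "nat \<Rightarrow> bool" where
  "fibre_primitive n \<longleftrightarrow> (\<forall>E. (\<forall>r\<in>R n. E r r) \<longrightarrow> (\<forall>r\<in>R n. \<forall>s\<in>R n. E r s \<longrightarrow> E s r)
     \<longrightarrow> (\<forall>r\<in>R n. \<forall>s\<in>R n. \<forall>t\<in>R n. E r s \<longrightarrow> E s t \<longrightarrow> E r t)
     \<longrightarrow> (\<forall>\<rho>\<in>gal_Q. \<forall>r\<in>R n. \<forall>s\<in>R n. E r s \<longrightarrow> E (\<rho> r) (\<rho> s))
     \<longrightarrow> (\<forall>r\<in>R n. \<forall>s\<in>R n. E r s \<longrightarrow> ph r = ph s)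
     \<longrightarrow> (\<exists>r\<in>R n. \<exists>s\<in>R n. r \<noteq> s \<and> E r s)
     \<longrightarrow> (\<forall>r\<in>R n. \<forall>s\<in>R n. ph r = ph s \<longrightarrow> E r s))"

lemma swaps_refl: "swaps n r r"
  unfolding swaps_def by (rule bexI[OF _ gal_id]) simp

lemma swaps_sym: "swaps n r s \<Longrightarrow> swaps n s r"
  unfolding swaps_def by (metis insert_commute)

lemma swaps_conj:
  assumes \<rho>: "\<rho> \<in> gal_Q" and rs: "r \<in> R n" "s \<in> R n" "swaps n r s"
  shows "swaps n (\<rho> r) (\<rho> s)"
proof -
  obtain \<sigma> where \<sigma>: "\<sigma> \<in> gal_Q" "\<sigma> r = s" "\<sigma> s = r" "\<And>t. t \<in> R n - {r, s} \<Longrightarrow> \<sigma> t = t"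
    using rs(3) unfolding swaps_def by blast
  obtain \<tau> where \<tau>: "\<tau> \<in> gal_Q" "\<And>x. x \<in> qbar \<Longrightarrow> \<tau> (\<rho> x) = x" "\<And>x. x \<in> qbar \<Longrightarrow> \<rho> (\<tau> x) = x"
    using gal_inv[OF \<rho>] by blast
  have g: "\<rho> \<circ> (\<sigma> \<circ> \<tau>) \<in> gal_Q" by (intro gal_comp \<rho> \<sigma> \<tau>)
  have q: "r \<in> qbar" "s \<in> qbar" using rs R_qbar by auto
  have "\<rho> (\<sigma> (\<tau> t)) = t" if t: "t \<in> R n - {\<rho> r, \<rho> s}" for t
  proof -
    have tq: "t \<in> qbar" using t R_qbar by blast
    have "\<tau> t \<in> R n" using gal_R[OF \<tau>(1)] t by blast
    moreover have "\<tau> t \<noteq> r" "\<tau> t \<noteq> s" using \<tau>(3)[OF tq] t by auto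
    ultimately have "\<sigma> (\<tau> t) = \<tau> t" using \<sigma>(4) by blast
    then show ?thesis using \<tau>(3)[OF tq] by simp
  qed
  then show ?thesis unfolding swaps_def using \<sigma> \<tau>(2)[OF q(1)] \<tau>(2)[OF q(2)]
    by (intro bexI[OF _ g]) simp
qed

text \<open>Conjugating the second transposition by the first: (r s)(s t)(r s) = (r t).\<close>

lemma swaps_trans:
  assumes R: "r \<in> R n" "s \<in> R n" "t \<in> R n" and sw: "swaps n r s" "swaps n s t"
  shows "swaps n r t"
proof (cases "r = s \<or> s = t \<or> r = t")
  case True
  then show ?thesis using sw swaps_refl by metis
next
  case False
  obtain \<sigma> where \<sigma>: "\<sigma> \<in> gal_Q" "\<sigma> r = s" "\<sigma> s = r" "\<And>x. x \<in> R n - {r, s} \<Longrightarrow> \<sigma> x = x"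
    using sw(1) unfolding swaps_def by blast
  obtain \<tau> where \<tau>: "\<tau> \<in> gal_Q" "\<tau> s = t" "\<tau> t = s" "\<And>x. x \<in> R n - {s, t} \<Longrightarrow> \<tau> x = x"
    using sw(2) unfolding swaps_def by blast
  have g: "\<sigma> \<circ> (\<tau> \<circ> \<sigma>) \<in> gal_Q" by (intro gal_comp \<sigma> \<tau>)
  have st: "\<sigma> t = t" using \<sigma>(4)[of t] R False by auto
  have tr: "\<tau> r = r" using \<tau>(4)[of r] R False by auto
  have "\<sigma> (\<tau> (\<sigma> x)) = x" if x: "x \<in> R n - {r, t}" for x
  proof (cases "x = s")
    case False
    then have "\<sigma> x = x" "\<tau> x = x" using \<sigma>(4)[of x] \<tau>(4)[of x] x by auto
    then show ?thesis by simp
  qed (use \<sigma> tr in simp)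
  then show ?thesis unfolding swaps_def using \<sigma> \<tau> st by (intro bexI[OF _ g]) simp
qed

text \<open>As d \<ge> 3, the fibre of \<open>r\<close> contains a third root, which is fixed; so
  the automorphism fixes the parent of \<open>r\<close>.\<close>

lemma swaps_fibre:
  assumes "r \<in> R (Suc m)" "s \<in> R (Suc m)" "swaps (Suc m) r s"
  shows "ph r = ph s"
proof -
  obtain \<sigma> where \<sigma>: "\<sigma> \<in> gal_Q" "\<sigma> r = s" "\<And>x. x \<in> R (Suc m) - {r, s} \<Longrightarrow> \<sigma> x = x"
    using assms(3) unfolding swaps_def by blast
  have b: "ph r \<in> R m" using assms(1) by (simp add: R_Suc)
  have "card {r, s} < card (fib (ph r))" using card_fib[OF b] d3 by (cases "r = s") auto
  then have "\<not> fib (ph r) \<subseteq> {r, s}" by (meson card_mono finite.emptyI finite.insertI not_le)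
  then obtain t where t: "t \<in> fib (ph r)" "t \<notin> {r, s}" by blast
  then have tR: "t \<in> R (Suc m)" using fib_R[OF b] by blast
  have "ph s = ph (\<sigma> r)" by (simp add: \<sigma>)
  also have "\<dots> = \<sigma> (ph r)" using gal_ph[OF \<sigma>(1)] R_qbar assms(1) by metis
  also have "ph r = ph t" using t by (simp add: fib_def)
  also have "\<sigma> (ph t) = ph (\<sigma> t)" using gal_ph[OF \<sigma>(1)] R_qbar tR by metis
  also have "\<sigma> t = t" using \<sigma>(3)[of t] t tR by blast
  finally show ?thesis using t by (simp add: fib_def)
qed

text \<open>Fibre-preserving permutations are products of transpositions of siblings; composing with
  one of these reduces the number of moved points.\<close>

lemma full_if_all_swaps:
  assumes sw: "\<And>r s. r \<in> R n \<Longrightarrow> s \<in> R n \<Longrightarrow> ph r = ph s \<Longrightarrow> swaps n r s"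
  shows "full n"
proof -
  have "\<exists>\<sigma>\<in>gal_Q. \<forall>r\<in>R n. \<sigma> r = g r" if "bij_betw g (R n) (R n)" "\<forall>r\<in>R n. ph (g r) = ph r" for g
    using that
  proof (induction "card {r \<in> R n. g r \<noteq> r}" arbitrary: g rule: less_induct)
    case less
    show ?case
    proof (cases "\<forall>r\<in>R n. g r = r")
      case True
      then show ?thesis by (intro bexI[OF _ gal_id]) simp
    next
      case False
      then obtain r where r: "r \<in> R n" "g r \<noteq> r" by blast
      define s where "s = g r"
      have sR: "s \<in> R n" using less.prems(1) r by (auto simp: s_def bij_betw_def)
      have phs: "ph s = ph r" using less.prems(2) r by (simp add: s_def)
      obtain \<sigma> where \<sigma>: "\<sigma> \<in> gal_Q" "\<sigma> r = s" "\<sigma> s = r" "\<And>x. x \<in> R n - {r, s} \<Longrightarrow> \<sigma> x = x"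
        using sw[OF r(1) sR phs[symmetric]] unfolding swaps_def by blast
      have gR: "g x \<in> R n" if "x \<in> R n" for x using less.prems(1) that by (auto simp: bij_betw_def)
      have \<sigma>inv: "\<sigma> (\<sigma> x) = x" if "x \<in> R n" for x using \<sigma>(2-4) that by (cases "x \<in> {r, s}") auto
      have \<sigma>ph: "ph (\<sigma> x) = ph x" if "x \<in> R n" for x using \<sigma>(2-4) that phs by (cases "x \<in> {r, s}") auto
      have "bij_betw \<sigma> (R n) (R n)"
        using \<sigma>inv gal_R[OF \<sigma>(1)] by (intro bij_betwI[where g = \<sigma>]) auto
      then have bij: "bij_betw (\<sigma> \<circ> g) (R n) (R n)" using less.prems(1) bij_betw_trans by blast
      have ph': "\<forall>x\<in>R n. ph ((\<sigma> \<circ> g) x) = ph x" using \<sigma>ph gR less.prems(2) by simp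
      have "{x \<in> R n. (\<sigma> \<circ> g) x \<noteq> x} \<subseteq> {x \<in> R n. g x \<noteq> x} - {r}"
      proof
        fix x assume "x \<in> {x \<in> R n. (\<sigma> \<circ> g) x \<noteq> x}"
        then have x: "x \<in> R n" "\<sigma> (g x) \<noteq> x" by auto
        have "x \<noteq> r" using x \<sigma>(3) by (auto simp: s_def)
        moreover have "g x \<noteq> x"
        proof
          assume gx: "g x = x"
          then have "x \<noteq> s" using less.prems(1) r x \<open>x \<noteq> r\<close>
            by (metis bij_betw_inv_into_left s_def)
          then have "\<sigma> x = x" using \<sigma>(4)[of x] x \<open>x \<noteq> r\<close> by blast
          then show False using x gx by simp
        qed
        ultimately show "x \<in> {x \<in> R n. g x \<noteq> x} - {r}" using x by simp
      qed
      also have "\<dots> \<subset> {x \<in> R n. g x \<noteq> x}" using r by blast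
      finally have "card {x \<in> R n. (\<sigma> \<circ> g) x \<noteq> x} < card {x \<in> R n. g x \<noteq> x}"
        using finite_R by (intro psubset_card_mono) auto
      then obtain \<tau> where \<tau>: "\<tau> \<in> gal_Q" "\<forall>x\<in>R n. \<tau> x = (\<sigma> \<circ> g) x" using less.hyps bij ph' by blast
      have "\<forall>x\<in>R n. (\<sigma> \<circ> \<tau>) x = g x" using \<tau>(2) \<sigma>inv gR by simp
      then show ?thesis using gal_comp[OF \<sigma>(1) \<tau>(1)] by blast
    qed
  qed
  then show ?thesis unfolding full_def by blast
qed

lemma full_if_transposition:
  assumes "fibre_primitive (Suc m)" "r \<in> R (Suc m)" "s \<in> R (Suc m)" "r \<noteq> s" "swaps (Suc m) r s"
  shows "full (Suc m)"
proof (rule full_if_all_swaps)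
  fix x y assume "x \<in> R (Suc m)" "y \<in> R (Suc m)" "ph x = ph y"
  then show "swaps (Suc m) x y"
  proof (rule assms(1)[unfolded fibre_primitive_def, rule_format, of "swaps (Suc m)", rotated -3])
    show "\<exists>r\<in>R (Suc m). \<exists>s\<in>R (Suc m). r \<noteq> s \<and> swaps (Suc m) r s" using assms by blast
  qed (rule swaps_refl, erule swaps_sym, erule (4) swaps_trans, erule (3) swaps_conj, erule (2) swaps_fibre)
qed

text \<open>Galois transitivity gives all classes the same size \<open>k\<close>. They partition a
  fibre of \<open>d\<close> elements, so \<open>k\<close> divides the prime \<open>d\<close> and is
  not 1.\<close>

lemma fibre_primitive_prime:
  assumes "prime d"
  shows "fibre_primitive (Suc m)"
  unfolding fibre_primitive_def
proof (intro allI impI ballI)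
  let ?R = "R (Suc m)"
  fix E r s
  assume refl: "\<forall>r\<in>?R. E r r" and sym: "\<forall>r\<in>?R. \<forall>s\<in>?R. E r s \<longrightarrow> E s r"
    and trans: "\<forall>r\<in>?R. \<forall>s\<in>?R. \<forall>t\<in>?R. E r s \<longrightarrow> E s t \<longrightarrow> E r t"
    and inv: "\<forall>\<rho>\<in>gal_Q. \<forall>r\<in>?R. \<forall>s\<in>?R. E r s \<longrightarrow> E (\<rho> r) (\<rho> s)"
    and fibre: "\<forall>r\<in>?R. \<forall>s\<in>?R. E r s \<longrightarrow> ph r = ph s"
    and nontriv: "\<exists>r\<in>?R. \<exists>s\<in>?R. r \<noteq> s \<and> E r s"
    and rs: "r \<in> ?R" "s \<in> ?R" "ph r = ph s"
  define C where "C = (\<lambda>x. {y \<in> ?R. E x y})"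
  have finC: "finite (C x)" for x using finite_R by (simp add: C_def)
  have le: "card (C x) \<le> card (C y)" if xy: "x \<in> ?R" "y \<in> ?R" for x y
  proof -
    obtain \<rho> where \<rho>: "\<rho> \<in> gal_Q" "\<rho> x = y" using gal_transitive_R[OF xy] by blast
    have "\<rho> ` C x \<subseteq> C y" using inv \<rho> xy gal_R[OF \<rho>(1)] by (auto simp: C_def)
    moreover have "inj_on \<rho> (C x)" using gal_inj[OF \<rho>(1)] R_qbar by (auto simp: C_def inj_on_def)
    ultimately show ?thesis using card_inj_on_le finC by blast
  qed
  define k where "k = card (C r)"
  have ck: "card (C x) = k" if "x \<in> ?R" for x using le[OF that rs(1)] le[OF rs(1) that] by (simp add: k_def)
  have b: "ph r \<in> R m" using rs(1) by (simp add: R_Suc)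
  have sub: "fib (ph r) \<subseteq> ?R" by (rule fib_R[OF b])
  have Csub: "C x \<subseteq> fib (ph r)" if "x \<in> fib (ph r)" for x
    using fibre that sub by (auto simp: C_def fib_def)
  have "x \<in> C x" if "x \<in> fib (ph r)" for x
    using refl subsetD[OF sub that] by (simp add: C_def)
  then have U: "\<Union> (C ` fib (ph r)) = fib (ph r)" using Csub by blast
  have disj: "c \<inter> c' = {}" if cc: "c \<in> C ` fib (ph r)" "c' \<in> C ` fib (ph r)" "c \<noteq> c'" for c c'
  proof (rule ccontr)
    assume "c \<inter> c' \<noteq> {}"
    then obtain x y z where z: "x \<in> ?R" "y \<in> ?R" "c = C x" "c' = C y" "z \<in> ?R" "E x z" "E y z"
      using cc sub by (auto simp: C_def)
    have Exy: "E x y" using trans[rule_format, OF z(1,5,2,6)] sym[rule_format, OF z(2,5,7)] by blast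
    have Eyx: "E y x" by (rule sym[rule_format, OF z(1,2) Exy])
    have "C x = C y"
      using trans[rule_format, OF z(2,1) _ Eyx] trans[rule_format, OF z(1,2) _ Exy] by (auto simp: C_def)
    then show False using cc z by simp
  qed
  have "k * card (C ` fib (ph r)) = card (\<Union> (C ` fib (ph r)))"
    using finite_fib ck sub disj U by (intro card_partition) auto
  then have "k dvd d" using U card_fib[OF b] by (metis dvd_triv_left)
  moreover have "k \<noteq> 1"
  proof -
    obtain x y where xy: "x \<in> ?R" "y \<in> ?R" "x \<noteq> y" "E x y" using nontriv by blast
    then have "{x, y} \<subseteq> C x" using refl by (auto simp: C_def)
    then have "2 \<le> card (C x)" using card_mono[OF finC, of "{x, y}" x] xy(3) by simp
    then show ?thesis using ck xy by simp
  qed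
  ultimately have "k = d" using assms unfolding prime_nat_iff by blast
  moreover have "r \<in> fib (ph r)" by (simp add: fib_def)
  ultimately have "C r = fib (ph r)"
    using card_subset_eq[OF finite_fib Csub] card_fib[OF b] by (simp add: k_def)
  moreover have "s \<in> fib (ph r)" using rs by (simp add: fib_def)
  ultimately show "E r s" by (auto simp: C_def)
qed

end

section \<open>Total ramification above a prime divisor of d - 1\<close>

context arboreal
begin

text \<open>The other root of \<phi>(x) = \<phi>(0). Modulo a prime above \<open>q\<close> the
  polynomial becomes x^(d-1) (x - cd), with cd a unit.\<close>

definition cd :: int where "cd = c * int d"

lemma ph_critical: "ph x - of_int (a 1) = x ^ (d - 1) * (x - of_int cd)"
  unfolding a_1 ph_eq' cd_def using d3 by (simp add: of_nat_diff)

context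
  fixes q n :: nat and M :: "complex set"
  assumes q_dvd: "q dvd d - 1" and cop: "coprime (d - 1) (multiplicity q (d - 1))"
    and PM: "prime_over (R n) q M"
begin

interpretation prime_over "R n" q M by (rule PM)

lemma q_prime: "prime q"
  by (rule prime_p)

lemma q_c: "\<not> int q dvd c" and q_d: "\<not> int q dvd int d"
proof -
  have q1: "int q dvd int d - 1" using q_dvd d3 by (metis int_dvd_int_iff int_ops(2) of_nat_diff le_trans one_le_numeral)
  show "\<not> int q dvd c" using coprime_c q1 q_prime
    by (metis coprime_common_divisor not_prime_unit prime_nat_int_transfer)
  show "\<not> int q dvd int d"
  proof
    assume "int q dvd int d"
    then have "int q dvd int d - (int d - 1)" using q1 by (rule dvd_diff)
    then show False using q_prime by auto
  qed
qed

lemma a1_M: "of_int (a 1) \<in> M"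
  unfolding M_of_int a_1 using q_dvd d3
  by (metis dvd_mult int_dvd_int_iff int_ops(2) of_nat_diff le_trans one_le_numeral)

lemma cd_M: "of_int cd \<notin> M"
  unfolding M_of_int cd_def using q_c q_d q_prime by (simp add: prime_dvd_mult_iff)

lemma ph_M: "x \<in> M \<Longrightarrow> ph x \<in> M"
proof -
  assume x: "x \<in> M"
  have "ph x = x ^ (d - 1) * (x - of_int cd) + of_int (a 1)"
    using ph_critical[of x] by (simp add: algebra_simps)
  moreover have "x ^ (d - 1) \<in> M" using x d3 M_zring by (simp add: M_power)
  ultimately show ?thesis using a1_M M_zring[OF x] by (auto intro!: M_add M_mult2 zring_diff zring_of_int)
qed

text \<open>Modulo \<open>M\<close> the equation ph x = 0 has only the roots 0 and
  \<open>cd\<close>, which are distinct there.\<close>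

lemma notM_iff: "x \<in> zring (R n) \<Longrightarrow> ph x \<in> M \<Longrightarrow> x \<notin> M \<longleftrightarrow> x - of_int cd \<in> M"
proof -
  assume x: "x \<in> zring (R n)" "ph x \<in> M"
  have "x ^ (d - 1) * (x - of_int cd) \<in> M"
    unfolding ph_critical[symmetric] using x a1_M by (intro M_diff)
  then have "x \<in> M \<or> x - of_int cd \<in> M"
    using x by (subst (asm) M_prime_iff) (auto simp: M_power intro: zring_power zring_diff zring_of_int)
  moreover have False if "x \<in> M" "x - of_int cd \<in> M"
    using M_diff[OF that] cd_M by simp
  ultimately show ?thesis by blast
qed

lemma fib_not_subset_M:
  assumes "\<beta> \<in> R i" "\<beta> \<in> M" "fib \<beta> \<subseteq> zring (R n)"
  shows "\<exists>y\<in>fib \<beta>. y \<notin> M"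
proof -
  let ?x = "of_int cd :: complex"
  have "ph ?x - \<beta> = of_int (a 1) - \<beta>" using ph_critical[of ?x] by simp
  also have "\<dots> \<in> M" using a1_M assms by (intro M_diff)
  finally have "(\<Prod>y\<in>fib \<beta>. ?x - y) \<in> M" using fib_prod[OF assms(1)] by simp
  then obtain y where y: "y \<in> fib \<beta>" "?x - y \<in> M"
    using assms(3) by (subst (asm) M_prod[OF finite_fib]) (auto intro: zring_diff zring_of_int)
  have "y \<notin> M"
  proof
    assume "y \<in> M"
    then have "?x - y + y \<in> M" using y by (intro M_add)
    then show False using cd_M by simp
  qed
  then show ?thesis using y by blast
qed

lemma card_fib_M:
  assumes "\<beta> \<in> R i" "\<beta> \<in> M"
  shows "card (fib \<beta> \<inter> M) \<le> d - 1"
proof -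
  have "fib \<beta> \<inter> M \<noteq> fib \<beta>"
  proof
    assume "fib \<beta> \<inter> M = fib \<beta>"
    then have "fib \<beta> \<subseteq> M" by blast
    then show False using fib_not_subset_M[OF assms] M_sub by blast
  qed
  then have "fib \<beta> \<inter> M \<subset> fib \<beta>" by blast
  then have "card (fib \<beta> \<inter> M) < card (fib \<beta>)" using finite_fib psubset_card_mono by blast
  then show ?thesis using card_fib[OF assms(1)] by simp
qed

text \<open>This upper bound meets the lower bound for the size of an orbit in
  \<open>Dec_transitive\<close>.\<close>

lemma card_R_M: "card (R i \<inter> M) \<le> (d - 1) ^ i"
proof (induction i)
  case 0
  have "card (R 0 \<inter> M) \<le> card {0 :: complex}" unfolding R_0 by (intro card_mono) auto
  then show ?case by simp
next
  case (Suc i)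
  have "R (Suc i) \<inter> M \<subseteq> (\<Union>\<beta>\<in>R i \<inter> M. fib \<beta> \<inter> M)"
    using ph_M by (auto simp: R_Suc fib_def)
  then have "card (R (Suc i) \<inter> M) \<le> card (\<Union>\<beta>\<in>R i \<inter> M. fib \<beta> \<inter> M)"
    using finite_R finite_fib by (intro card_mono) auto
  also have "\<dots> \<le> (\<Sum>\<beta>\<in>R i \<inter> M. card (fib \<beta> \<inter> M))" using finite_R by (intro card_UN_le) auto
  also have "\<dots> \<le> (\<Sum>\<beta>\<in>R i \<inter> M. d - 1)" using card_fib_M by (intro sum_mono) auto
  also have "\<dots> \<le> (d - 1) ^ Suc i" using Suc by simp
  finally show ?case .
qed

definition qv :: nat where "qv = multiplicity q (d - 1)"

lemma c_dm1:
  obtains u where "a 1 = c * (int q ^ qv * u)" "\<not> int q dvd u"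
proof -
  have 1: "d - 1 \<noteq> 0" and 2: "\<not> q dvd 1" using d3 q_prime by (auto simp: prime_nat_iff)
  obtain w where w: "d - 1 = q ^ qv * w" "\<not> q dvd w"
    unfolding qv_def by (rule multiplicity_decompose'[OF 1 2])
  have "int d - 1 = int (d - 1)" using d3 by simp
  then have "a 1 = c * (int q ^ qv * int w)" unfolding a_1 by (simp only: w(1) of_nat_mult of_nat_power)
  then show ?thesis using that[of "int w"] w(2) by simp
qed

text \<open>The roots of level \<open>i\<close> in \<open>M\<close> have valuation \<open>qv / (d - 1) ^ i\<close>: there is total ramification.\<close>

lemma R_M_valuation:
  "x \<in> R (Suc i) \<Longrightarrow> x \<in> M \<Longrightarrow>
   \<exists>s\<in>zring (R n). \<exists>t\<in>zring (R n). s \<notin> M \<and> t \<notin> M \<and> x ^ ((d - 1) ^ Suc i) * s = of_nat q ^ qv * t"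
proof (induction i arbitrary: x)
  case 0
  obtain u where u: "a 1 = c * (int q ^ qv * u)" "\<not> int q dvd u" by (rule c_dm1)
  have xz: "x \<in> zring (R n)" using 0 M_zring by blast
  have "ph x = 0" using 0(1) by (simp add: R_Suc R_0)
  then have eq: "x ^ (d - 1) ^ Suc 0 * (x - of_int cd) = of_nat q ^ qv * of_int (- c * u)"
    using ph_critical[of x] u(1) by (simp add: mult_ac)
  have s: "x - of_int cd \<notin> M" using notM_iff[OF xz] 0 \<open>ph x = 0\<close> M_0 by simp
  have t: "complex_of_int (- c * u) \<notin> M" unfolding M_of_int using q_c u(2) q_prime by (simp add: prime_dvd_mult_iff)
  have "x - of_int cd \<in> zring (R n)" using xz by (intro zring_diff zring_of_int)
  then show ?case using s t eq zring_of_int[of "- c * u" "R n"] by blast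
next
  case (Suc i)
  obtain u where u: "a 1 = c * (int q ^ qv * u)" "\<not> int q dvd u" by (rule c_dm1)
  have xz: "x \<in> zring (R n)" using Suc.prems M_zring by blast
  define \<beta> where "\<beta> = ph x"
  have \<beta>: "\<beta> \<in> R (Suc i)" "\<beta> \<in> M" using Suc.prems ph_M R_Suc by (auto simp: \<beta>_def)
  define m where "m = (d - 1) ^ Suc i"
  have m2: "m \<ge> 2"
  proof -
    have "(d - 1) ^ 1 \<le> (d - 1) ^ Suc i" using d3 by (intro power_increasing) auto
    moreover have "(d - 1) ^ 1 \<ge> 2" using d3 by simp
    ultimately show ?thesis unfolding m_def by linarith
  qed
  obtain s t where st: "s \<in> zring (R n)" "t \<in> zring (R n)" "s \<notin> M" "t \<notin> M" "\<beta> ^ m * s = of_nat q ^ qv * t"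
    using Suc.IH[OF \<beta>] unfolding m_def by blast
  \<comment> \<open>\<open>a 1\<close> has valuation \<open>qv\<close>, which is \<open>m\<close>
    times that of \<beta>, and m \<ge> 2; so \<beta> - a 1 is \<beta> times a unit at
    \<open>M\<close>. The element \<open>w\<close> of \<open>M\<close> measures the difference:
    \<open>t * of_int (a 1) = \<beta> * w\<close>.\<close>
  define w where "w = of_int (c * u) * s * \<beta> ^ (m - 1)"
  have w: "w \<in> M" unfolding w_def using st \<beta> m2 M_zring[OF \<beta>(2)]
    by (intro M_mult zring_mult zring_of_int) (auto simp: M_power)
  have t': "t - w \<in> zring (R n)" "t - w \<notin> M"
    using st w M_add[of "t - w" w] M_zring by (auto intro: zring_diff)
  have \<beta>m: "\<beta> ^ m = \<beta> * \<beta> ^ (m - 1)" using m2 by (cases m) auto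
  have "t * of_int (a 1) = of_int (c * u) * (of_nat q ^ qv * t)" unfolding u(1) by simp
  also have "\<dots> = of_int (c * u) * (\<beta> ^ m * s)" unfolding st(5) ..
  also have "\<dots> = \<beta> * w" unfolding \<beta>m w_def by (simp add: mult_ac)
  finally have ta: "t * (\<beta> - of_int (a 1)) = \<beta> * (t - w)" by (simp add: algebra_simps)
  have "x ^ (d - 1) * ((x - of_int cd) * t) = t * (\<beta> - of_int (a 1))"
    unfolding \<beta>_def ph_critical by (simp add: mult_ac)
  then have "x ^ (d - 1) * ((x - of_int cd) * t) = \<beta> * (t - w)" unfolding ta .
  then have "(x ^ (d - 1) * ((x - of_int cd) * t)) ^ m * s = (\<beta> ^ m * s) * (t - w) ^ m"
    by (simp add: power_mult_distrib mult_ac)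
  then have "(x ^ (d - 1)) ^ m * (((x - of_int cd) * t) ^ m * s) = of_nat q ^ qv * (t * (t - w) ^ m)"
    unfolding st(5) by (simp add: power_mult_distrib mult_ac)
  moreover have "(x ^ (d - 1)) ^ m = x ^ ((d - 1) ^ Suc (Suc i))" by (simp add: m_def power_mult)
  moreover have xz': "x - of_int cd \<in> zring (R n)" using xz by (intro zring_diff zring_of_int)
  have "x - of_int cd \<notin> M" using notM_iff[OF xz] Suc.prems \<beta>(2) by (simp add: \<beta>_def)
  then have "((x - of_int cd) * t) ^ m * s \<notin> M" "((x - of_int cd) * t) ^ m * s \<in> zring (R n)"
    using st xz' by (auto simp: M_prime_iff M_power zring_mult zring_power)
  moreover have "t * (t - w) ^ m \<notin> M" "t * (t - w) ^ m \<in> zring (R n)"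
    using st t' by (auto simp: M_prime_iff M_power zring_mult zring_power)
  ultimately show ?case
    by (intro bexI[of _ "((x - of_int cd) * t) ^ m * s"] bexI[of _ "t * (t - w) ^ m"]) simp_all
qed

text \<open>The product of the \<open>Dec\<close>-orbit of \<open>r\<close> has valuation
  \<open>qv * card S / N\<close>, which is an integer because the product is fixed by
  \<open>Dec\<close>. As \<open>N\<close> is prime to \<open>qv\<close>, it divides
  \<open>card S\<close>, while at most \<open>N\<close> roots lie in \<open>M\<close>.\<close>

lemma Dec_transitive:
  assumes n: "n = Suc m" and r: "r \<in> R n \<inter> M" and r': "r' \<in> R n \<inter> M"
  shows "\<exists>\<sigma>\<in>Dec. \<sigma> r = r'"
proof -
  define N where "N = (d - 1) ^ n"
  have N0: "N > 0" using d3 by (simp add: N_def)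
  define S where "S = (\<lambda>\<sigma>. \<sigma> r) ` Dec"
  have SR: "S \<subseteq> R n \<inter> M"
    using r gal_R[OF Dec_gal] Dec_M M_zring by (auto simp: S_def)
  then have finS: "finite S" using finite_R finite_subset by blast
  have rS: "r \<in> S" unfolding S_def using Dec_id by (intro image_eqI[where x = id]) auto
  have Sz: "y \<in> zring (R n)" if "y \<in> S" for y using that SR M_zring by blast
  define P where "P = \<Prod>S"
  have Pz: "P \<in> zring (R n)" unfolding P_def using Sz by (rule zring_prod)
  have Pfix: "\<sigma> P = P" if s: "\<sigma> \<in> Dec" for \<sigma>
  proof -
    have "\<sigma> ` S \<subseteq> S"
    proof
      fix y assume "y \<in> \<sigma> ` S"
      then obtain \<tau> where "\<tau> \<in> Dec" "y = (\<sigma> \<circ> \<tau>) r" by (auto simp: S_def)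
      then show "y \<in> S" unfolding S_def using Dec_comp[OF s] by blast
    qed
    then show ?thesis unfolding P_def using finS Sz gs.zring_qbar by (intro gal_fixes_sum_prod[OF Dec_gal[OF s]]) auto
  qed
  have "\<forall>y\<in>S. \<exists>st. fst st \<in> zring (R n) \<and> snd st \<in> zring (R n) \<and> fst st \<notin> M \<and> snd st \<notin> M \<and> y ^ N * fst st = of_nat q ^ qv * snd st"
    using R_M_valuation[of _ m] SR unfolding N_def n by fastforce
  then obtain st where st: "\<And>y. y \<in> S \<Longrightarrow> fst (st y) \<in> zring (R n)" "\<And>y. y \<in> S \<Longrightarrow> snd (st y) \<in> zring (R n)"
    "\<And>y. y \<in> S \<Longrightarrow> fst (st y) \<notin> M" "\<And>y. y \<in> S \<Longrightarrow> snd (st y) \<notin> M"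
    "\<And>y. y \<in> S \<Longrightarrow> y ^ N * fst (st y) = of_nat q ^ qv * snd (st y)" by metis
  define s t where "s = (\<Prod>y\<in>S. fst (st y))" "t = (\<Prod>y\<in>S. snd (st y))"
  have sz: "s \<in> zring (R n)" "t \<in> zring (R n)" unfolding s_t_def using st by (auto intro!: zring_prod)
  have sM: "s \<notin> M" "t \<notin> M" unfolding s_t_def using st by (auto simp: M_prod[OF finS])
  have "P ^ N * s = (\<Prod>y\<in>S. y ^ N * fst (st y))"
    unfolding P_def s_t_def by (simp add: prod_power_distrib prod.distrib)
  also have "\<dots> = (\<Prod>y\<in>S. of_nat q ^ qv * snd (st y))" using st by (intro prod.cong) auto
  also have "\<dots> = of_nat q ^ (qv * card S) * t" unfolding s_t_def by (simp add: prod.distrib power_mult)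
  finally have PN: "P ^ N * s = of_nat q ^ (qv * card S) * t" .
  obtain j s' t' where j: "s' \<in> zring (R n)" "t' \<in> zring (R n)" "s' \<notin> M" "t' \<notin> M" "P * s' = of_nat q ^ j * t'"
    
    by (rule decomposition_field_valuation[where P = P and s' = s and t' = t and m = N and e = "qv * card S",
      OF Pz _ PN sz sM N0]) (erule Pfix, rule that, assumption+)
  have "of_nat q ^ (qv * card S) * (t * s' ^ N) = P ^ N * s * s' ^ N" unfolding PN by (simp add: mult_ac)
  also have "\<dots> = (P * s') ^ N * s" by (simp add: power_mult_distrib mult_ac)
  also have "\<dots> = of_nat q ^ (j * N) * (t' ^ N * s)" unfolding j(5) power_mult_distrib by (simp add: mult_ac flip: power_mult)
  finally have "of_nat q ^ (qv * card S) * (t * s' ^ N) = of_nat q ^ (j * N) * (t' ^ N * s)" .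
  moreover have "t * s' ^ N \<in> zring (R n)" "t' ^ N * s \<in> zring (R n)" using sz j by (simp_all add: zring_mult zring_power)
  moreover have "t * s' ^ N \<notin> M" "t' ^ N * s \<notin> M"
    using sz sM j by (simp_all add: M_prime_iff M_power zring_power)
  ultimately have "qv * card S = j * N" by (rule p_power_unique)
  then have "N dvd qv * card S" by simp
  moreover have "coprime N qv" using cop by (simp add: N_def qv_def)
  ultimately have "N dvd card S" by (simp add: coprime_dvd_mult_right_iff)
  moreover have "card S > 0" using rS finS card_gt_0_iff by blast
  ultimately have "N \<le> card S" by (rule dvd_imp_le)
  then have "card (R n \<inter> M) \<le> card S" using card_R_M[of n] by (simp add: N_def)
  then have "S = R n \<inter> M" using SR finite_R by (intro card_seteq) auto
  then have "r' \<in> (\<lambda>\<sigma>. \<sigma> r) ` Dec" using r' unfolding S_def by blast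
  then show ?thesis by blast
qed

text \<open>Two such roots would both be congruent to \<open>cd\<close>, putting the derivative of
  \<open>f\<close> at \<open>y\<close> into \<open>M\<close>; but its factors \<open>d\<close>,
  \<open>y\<close> and \<open>y - a 1\<close> are units there.\<close>

lemma fib_one_unit:
  assumes "\<beta> \<in> R i" "\<beta> \<in> M" "fib \<beta> \<subseteq> zring (R n)" "y \<in> fib \<beta>" "z \<in> fib \<beta>" "y \<notin> M" "z \<notin> M"
  shows "y = z"
proof (rule ccontr)
  assume "y \<noteq> z"
  have yz: "y \<in> zring (R n)" "z \<in> zring (R n)" using assms by auto
  have ph: "ph y \<in> M" "ph z \<in> M" using assms by (auto simp: fib_def)
  have "y - of_int cd \<in> M" "z - of_int cd \<in> M"
    using notM_iff[OF yz(1) ph(1)] notM_iff[OF yz(2) ph(2)] assms by auto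
  then have "(y - of_int cd) - (z - of_int cd) \<in> M" by (rule M_diff)
  then have "y - z \<in> M" by simp
  then have "(\<Prod>z\<in>fib \<beta> - {y}. y - z) \<in> M"
    using assms \<open>y \<noteq> z\<close> finite_fib by (subst M_prod) (auto intro: zring_diff)
  then have "of_nat d * y ^ (d - 2) * (y - of_int (a 1)) \<in> M" using fib_deriv[OF assms(1,4)] by simp
  moreover have "of_nat d \<notin> M" using q_d M_of_int[of "int d"] by simp
  moreover have "y - of_int (a 1) \<notin> M"
  proof
    assume "y - of_int (a 1) \<in> M"
    then have "y - of_int (a 1) + of_int (a 1) \<in> M" using a1_M by (rule M_add)
    then show False using assms by simp
  qed
  ultimately show False using assms yz
    by (simp add: M_prime_iff M_power zring_mult zring_power zring_of_nat zring_diff zring_of_int)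
qed

text \<open>In a fibre over an element of \<open>M\<close> there is one root \<epsilon> outside
  \<open>M\<close>, and \<open>Dec\<close> carries any root in \<open>M\<close> of this fibre to any
  other while fixing \<epsilon>. A related pair can be moved so that it starts at \<epsilon>; then
  \<epsilon> is related to its whole fibre, and Galois transitivity transports this to every
  root.\<close>

lemma fibre_primitive_q:
  assumes n: "n = Suc m"
  shows "fibre_primitive n"
  unfolding fibre_primitive_def
proof (intro allI impI ballI)
  let ?R = "R n"
  fix E r s
  assume refl: "\<forall>r\<in>?R. E r r" and sym: "\<forall>r\<in>?R. \<forall>s\<in>?R. E r s \<longrightarrow> E s r"
    and trans: "\<forall>r\<in>?R. \<forall>s\<in>?R. \<forall>t\<in>?R. E r s \<longrightarrow> E s t \<longrightarrow> E r t"
    and inv: "\<forall>\<rho>\<in>gal_Q. \<forall>r\<in>?R. \<forall>s\<in>?R. E r s \<longrightarrow> E (\<rho> r) (\<rho> s)"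
    and fibre: "\<forall>r\<in>?R. \<forall>s\<in>?R. E r s \<longrightarrow> ph r = ph s"
    and nontriv: "\<exists>r\<in>?R. \<exists>s\<in>?R. r \<noteq> s \<and> E r s"
    and rs: "r \<in> ?R" "s \<in> ?R" "ph r = ph s"
  \<comment> \<open>The critical orbit lies in \<open>M\<close>, and its \<open>n\<close>-th term is
    up to sign the product of the roots of level \<open>n\<close>; so some root of that level lies
    in \<open>M\<close>.\<close>
  have "(ph ^^ n) 0 \<in> M"
  proof -
    have "(ph ^^ Suc i) 0 \<in> M" for i
      by (induction i) (simp_all add: ph_M M_0)
    then show ?thesis using n by blast
  qed
  then have "(\<Prod>r\<in>?R. 0 - r) \<in> M" by (simp only: F_prod_val)
  then obtain r0 where r0: "r0 \<in> ?R" "- r0 \<in> M"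
    by (subst (asm) M_prod[OF finite_R]) (auto intro: zring_uminus zring_base)
  then have r0M: "r0 \<in> M" using M_uminus_iff by blast
  define \<beta> where "\<beta> = ph r0"
  have \<beta>: "\<beta> \<in> R m" "\<beta> \<in> M" using r0 r0M ph_M n by (auto simp: \<beta>_def R_Suc)
  have fibR: "fib \<beta> \<subseteq> ?R" using fib_R[OF \<beta>(1)] n by simp
  then have fibz: "fib \<beta> \<subseteq> zring ?R" using zring_base by blast
  obtain \<epsilon> where \<epsilon>: "\<epsilon> \<in> fib \<beta>" "\<epsilon> \<notin> M" using fib_not_subset_M[OF \<beta> fibz] by blast
  have \<epsilon>R: "\<epsilon> \<in> ?R" using \<epsilon> fibR by blast
  obtain x y where xy: "x \<in> ?R" "y \<in> ?R" "x \<noteq> y" "E x y" using nontriv by blast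
  obtain \<rho> where \<rho>: "\<rho> \<in> gal_Q" "\<rho> x = \<epsilon>" using gal_transitive_R[OF xy(1) \<epsilon>R] by blast
  define z where "z = \<rho> y"
  have zR: "z \<in> ?R" using gal_R[OF \<rho>(1) xy(2)] by (simp add: z_def)
  have Ez: "E \<epsilon> z" using inv \<rho> xy by (auto simp: z_def)
  have z\<epsilon>: "z \<noteq> \<epsilon>" using gal_inj[OF \<rho>(1), of x y] R_qbar xy \<rho>(2) by (auto simp: z_def)
  have zfib: "z \<in> fib \<beta>" using fibre Ez \<epsilon>R zR \<epsilon>(1) by (auto simp: fib_def)
  have zM: "z \<in> M" using fib_one_unit[OF \<beta> fibz zfib \<epsilon>(1) _ \<epsilon>(2)] z\<epsilon> by blast
  have all: "E \<epsilon> w" if w: "w \<in> fib \<beta>" for w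
  proof (cases "w \<in> M")
    case True
    have wR: "w \<in> ?R" using w fibR by blast
    obtain \<sigma> where \<sigma>: "\<sigma> \<in> Dec" "\<sigma> z = w" using Dec_transitive[OF n] zR zM wR True by blast
    have g: "\<sigma> \<in> gal_Q" using Dec_gal \<sigma> by blast
    have "ph (\<sigma> \<epsilon>) = \<sigma> (ph \<epsilon>)" using gal_ph[OF g] R_qbar \<epsilon>R by metis
    also have "\<dots> = \<sigma> (ph z)" using \<epsilon>(1) zfib by (simp add: fib_def)
    also have "\<dots> = ph w" using gal_ph[OF g] R_qbar zR \<sigma>(2) by metis
    finally have "\<sigma> \<epsilon> \<in> fib \<beta>" using w by (simp add: fib_def)
    moreover have "\<sigma> \<epsilon> \<notin> M" using Dec_M[OF \<sigma>(1)] \<epsilon> fibz by blast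
    ultimately have "\<sigma> \<epsilon> = \<epsilon>" using fib_one_unit[OF \<beta> fibz _ \<epsilon>(1) _ \<epsilon>(2)] by blast
    then show ?thesis using inv g \<epsilon>R zR Ez \<sigma>(2) by metis
  next
    case False
    then have "w = \<epsilon>" using fib_one_unit[OF \<beta> fibz w \<epsilon>(1) _ \<epsilon>(2)] by blast
    then show ?thesis using refl \<epsilon>R by simp
  qed
  obtain \<tau> where \<tau>: "\<tau> \<in> gal_Q" "\<tau> \<epsilon> = r" using gal_transitive_R[OF \<epsilon>R rs(1)] by blast
  obtain \<tau>' where \<tau>': "\<tau>' \<in> gal_Q" "\<And>x. x \<in> qbar \<Longrightarrow> \<tau>' (\<tau> x) = x" "\<And>x. x \<in> qbar \<Longrightarrow> \<tau> (\<tau>' x) = x"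
    using gal_inv[OF \<tau>(1)] by blast
  have "ph (\<tau>' s) = \<tau>' (ph s)" using gal_ph[OF \<tau>'(1)] R_qbar rs(2) by metis
  also have "\<dots> = \<tau>' (ph (\<tau> \<epsilon>))" using rs \<tau> by simp
  also have "\<dots> = \<tau>' (\<tau> (ph \<epsilon>))" using gal_ph[OF \<tau>(1)] R_qbar \<epsilon>R by metis
  also have "\<dots> = ph \<epsilon>" using \<tau>'(2) ph_qbar R_qbar \<epsilon>R by blast
  finally have "\<tau>' s \<in> fib \<beta>" using \<epsilon>(1) by (simp add: fib_def)
  then have "E (\<tau> \<epsilon>) (\<tau> (\<tau>' s))" using inv \<tau>(1) all \<epsilon>R fibR by blast
  then show "E r s" using \<tau> \<tau>'(3) R_qbar rs(2) by metis
qed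

end

lemma fibre_primitive_case2:
  assumes "prime q" "q dvd d - 1" "coprime (d - 1) (multiplicity q (d - 1))"
  shows "fibre_primitive (Suc m)"
proof -
  obtain M where "prime_over (R (Suc m)) q M" using gs.prime_over_exists[OF assms(1)] by blast
  then show ?thesis using fibre_primitive_q[OF assms(2,3)] by blast
qed

end

section \<open>Automorphisms of the pre-image tree\<close>

lemma finite_image_factor:
  assumes "finite (k ` A)" "\<And>x y. x \<in> A \<Longrightarrow> y \<in> A \<Longrightarrow> k x = k y \<Longrightarrow> F x = F y"
  shows "finite (F ` A)"
proof -
  have "F ` A \<subseteq> (\<lambda>z. F (SOME x. x \<in> A \<and> k x = z)) ` (k ` A)"
  proof
    fix y assume "y \<in> F ` A"
    then obtain x where x: "x \<in> A" "y = F x" by blast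
    have "(SOME x'. x' \<in> A \<and> k x' = k x) \<in> A \<and> k (SOME x'. x' \<in> A \<and> k x' = k x) = k x"
      by (rule someI[of "\<lambda>x'. x' \<in> A \<and> k x' = k x" x]) (use x in simp)
    then have "y = F (SOME x'. x' \<in> A \<and> k x' = k x)" using assms(2) x by metis
    then show "y \<in> (\<lambda>z. F (SOME x. x \<in> A \<and> k x = z)) ` (k ` A)" using x by blast
  qed
  then show ?thesis using assms(1) finite_surj by blast
qed

context arboreal
begin

lemma V_iff: "(n, b) \<in> tree_V f \<longleftrightarrow> b \<in> R n"
  by (simp add: tree_V_def R_root)

lemma V_E: "v \<in> tree_V f \<Longrightarrow> snd v \<in> R (fst v)"
  using V_iff by (metis prod.collapse)

lemma edge_iff: "tree_edge f (n, b) (m, b') \<longleftrightarrow> b \<in> R n \<and> b' \<in> R m \<and> (n = Suc m \<and> b' = ph b \<or> m = Suc n \<and> b = ph b')"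
  by (auto simp: tree_edge_def V_iff ph_def)

definition nbrs :: "nat \<times> complex \<Rightarrow> (nat \<times> complex) set" where
  "nbrs v = {u. tree_edge f u v}"

lemma nbrs_root: "card (nbrs (0, 0)) = d"
proof -
  have "nbrs (0, 0) = Pair 1 ` fib 0"
  proof (rule Set.set_eqI)
    fix u :: "nat \<times> complex" show "u \<in> nbrs (0, 0) \<longleftrightarrow> u \<in> Pair 1 ` fib 0"
      by (cases u) (auto simp: nbrs_def edge_iff R_0 fib_def R_Suc)
  qed
  moreover have "card (Pair (1::nat) ` fib 0) = card (fib 0)" by (intro card_image inj_onI) auto
  ultimately show ?thesis using card_fib[of 0 0] by (simp add: R_0)
qed

lemma nbrs_Suc: "b \<in> R (Suc n) \<Longrightarrow> card (nbrs (Suc n, b)) = Suc d"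
proof -
  assume b: "b \<in> R (Suc n)"
  have "nbrs (Suc n, b) = insert (n, ph b) (Pair (Suc (Suc n)) ` fib b)"
  proof (rule Set.set_eqI)
    fix u :: "nat \<times> complex" show "u \<in> nbrs (Suc n, b) \<longleftrightarrow> u \<in> insert (n, ph b) (Pair (Suc (Suc n)) ` fib b)"
      using b by (cases u) (auto simp: nbrs_def edge_iff fib_def R_Suc)
  qed
  moreover have "card (Pair (Suc (Suc n)) ` fib b) = card (fib b)" by (intro card_image inj_onI) auto
  moreover have "(n, ph b) \<notin> Pair (Suc (Suc n)) ` fib b" by auto
  ultimately show ?thesis using card_fib[OF b] finite_fib by simp
qed

lemma aut_outside: "g \<in> tree_Aut f \<Longrightarrow> v \<notin> tree_V f \<Longrightarrow> g v = v"
  unfolding tree_Aut_def by blast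

text \<open>The root has \<open>d\<close> neighbours, every other vertex
  \<open>d + 1\<close>.\<close>

lemma aut_root:
  assumes g: "g \<in> tree_Aut f"
  shows "g (0, 0) = (0, 0)"
proof -
  have bij: "bij_betw g (tree_V f) (tree_V f)"
    and edge: "\<And>u v. u \<in> tree_V f \<Longrightarrow> v \<in> tree_V f \<Longrightarrow> tree_edge f (g u) (g v) \<longleftrightarrow> tree_edge f u v"
    using g by (auto simp: tree_Aut_def)
  have V0: "(0, 0) \<in> tree_V f" by (simp add: V_iff R_0)
  have nV: "nbrs v \<subseteq> tree_V f" for v by (auto simp: nbrs_def tree_edge_def)
  have "g ` nbrs (0, 0) = nbrs (g (0, 0))"
  proof (intro equalityI subsetI)
    fix x assume "x \<in> g ` nbrs (0, 0)"
    then obtain u where u: "u \<in> nbrs (0, 0)" "x = g u" by blast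
    then have "u \<in> tree_V f" using nV by blast
    then show "x \<in> nbrs (g (0, 0))" using edge[of u "(0, 0)"] V0 u by (simp add: nbrs_def)
  next
    fix x assume x: "x \<in> nbrs (g (0, 0))"
    then obtain u where u: "u \<in> tree_V f" "x = g u" using nV bij by (metis bij_betw_imp_surj_on imageE subsetD)
    then show "x \<in> g ` nbrs (0, 0)" using x edge[OF u(1) V0] by (auto simp: nbrs_def)
  qed
  moreover have "inj_on g (nbrs (0, 0))" using bij nV by (meson bij_betw_imp_inj_on inj_on_subset)
  ultimately have c: "card (nbrs (g (0, 0))) = d" using card_image nbrs_root by metis
  obtain n b where nb: "g (0, 0) = (n, b)" by fastforce
  have "(n, b) \<in> tree_V f" using bij V0 nb by (metis bij_betwE)
  then have "b \<in> R n" by (simp add: V_iff)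
  then show ?thesis using c nb nbrs_Suc by (cases n) (auto simp: R_0)
qed

lemma aut_step:
  assumes g: "g \<in> tree_Aut f"
  shows "b \<in> R n \<Longrightarrow> fst (g (n, b)) = n \<and> (\<forall>m. n = Suc m \<longrightarrow> g (m, ph b) = (m, ph (snd (g (n, b)))))"
proof (induction n arbitrary: b)
  case 0
  then show ?case using aut_root[OF g] by (simp add: R_0)
next
  case (Suc n)
  have bij: "bij_betw g (tree_V f) (tree_V f)"
    and edge: "\<And>u v. u \<in> tree_V f \<Longrightarrow> v \<in> tree_V f \<Longrightarrow> tree_edge f (g u) (g v) \<longleftrightarrow> tree_edge f u v"
    using g by (auto simp: tree_Aut_def)
  have pb: "ph b \<in> R n" using Suc.prems by (simp add: R_Suc)
  obtain b' where b': "g (n, ph b) = (n, b')" using Suc.IH[OF pb] by (metis prod.collapse)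
  obtain k x where kx: "g (Suc n, b) = (k, x)" by fastforce
  have "tree_edge f (Suc n, b) (n, ph b)" using Suc.prems pb by (simp add: edge_iff)
  then have e: "tree_edge f (k, x) (n, b')"
    using edge[of "(Suc n, b)" "(n, ph b)"] Suc.prems pb by (simp add: V_iff kx b')
  \<comment> \<open>The image of the edge could only be folded back towards the root; but the image
    of the grandparent already occupies that place, contradicting injectivity.\<close>
  have "\<not> (n = Suc k \<and> x = ph b')"
  proof
    assume n: "n = Suc k \<and> x = ph b'"
    then have "g (k, ph (ph b)) = (k, x)" using Suc.IH[OF pb] b' by simp
    then have "g (k, ph (ph b)) = g (Suc n, b)" using kx by simp
    moreover have "(k, ph (ph b)) \<in> tree_V f" "(Suc n, b) \<in> tree_V f"
      using pb n Suc.prems by (auto simp: V_iff R_Suc)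
    ultimately have "(k, ph (ph b)) = (Suc n, b)" using bij by (metis bij_betw_inv_into_left)
    then show False using n by simp
  qed
  then have "k = Suc n" "b' = ph x" using e by (auto simp: edge_iff)
  then show ?case using kx b' by simp
qed

lemma aut_level:
  assumes "g \<in> tree_Aut f" "b \<in> R n"
  shows "g (n, b) = (n, snd (g (n, b)))" "snd (g (n, b)) \<in> R n"
proof -
  show 1: "g (n, b) = (n, snd (g (n, b)))" using aut_step[OF assms] by (metis prod.collapse)
  have "g (n, b) \<in> tree_V f" using assms by (auto simp: tree_Aut_def V_iff intro: bij_betw_apply)
  then show "snd (g (n, b)) \<in> R n" using 1 V_iff by metis
qed

lemma aut_bij:
  assumes g: "g \<in> tree_Aut f"
  shows "bij_betw (\<lambda>b. snd (g (n, b))) (R n) (R n)"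
proof -
  have inj: "inj_on (\<lambda>b. snd (g (n, b))) (R n)"
  proof (rule inj_onI)
    fix x y assume xy: "x \<in> R n" "y \<in> R n" "snd (g (n, x)) = snd (g (n, y))"
    then have "g (n, x) = g (n, y)" using aut_level(1)[OF g] by metis
    moreover have "inj_on g (tree_V f)" using g by (auto simp: tree_Aut_def bij_betw_def)
    ultimately show "x = y" using xy by (metis V_iff inj_onD prod.inject)
  qed
  moreover have "(\<lambda>b. snd (g (n, b))) ` R n \<subseteq> R n" using aut_level(2)[OF g] by blast
  ultimately show ?thesis using endo_inj_surj[OF finite_R] by (simp add: bij_betw_def)
qed

lemma fib_nonempty: "\<beta> \<in> R n \<Longrightarrow> \<exists>x\<in>R (Suc n). ph x = \<beta>"
proof -
  assume b: "\<beta> \<in> R n"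
  have "fib \<beta> \<noteq> {}" using card_fib[OF b] d3 by auto
  then show ?thesis using b by (auto simp: fib_def R_Suc)
qed

text \<open>If \<sigma> realises \<open>g\<close> on one level, then the inverse of \<sigma>
  composed with \<open>g\<close> preserves the fibres on the next level and is realised there by
  \<open>full\<close>; composing with \<sigma> gives \<open>g\<close>.\<close>

lemma aut_realize:
  assumes g: "g \<in> tree_Aut f" and full: "\<And>n. n > N \<Longrightarrow> full n" and triv: "\<And>b. b \<in> R N \<Longrightarrow> g (N, b) = (N, b)"
  shows "\<exists>\<sigma>\<in>gal_Q. \<forall>b\<in>R (N + k). \<sigma> b = snd (g (N + k, b))"
proof (induction k)
  case 0
  show ?case by (rule bexI[OF _ gal_id]) (simp add: triv)
next
  case (Suc k)
  let ?n = "N + k"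
  let ?G = "\<lambda>n b. snd (g (n, b))"
  obtain \<sigma> where \<sigma>: "\<sigma> \<in> gal_Q" "\<And>b. b \<in> R ?n \<Longrightarrow> \<sigma> b = ?G ?n b" using Suc by blast
  obtain \<tau> where \<tau>: "\<tau> \<in> gal_Q" "\<And>x. x \<in> qbar \<Longrightarrow> \<tau> (\<sigma> x) = x" "\<And>x. x \<in> qbar \<Longrightarrow> \<sigma> (\<tau> x) = x"
    using gal_inv[OF \<sigma>(1)] by blast
  let ?h = "\<lambda>r. \<tau> (?G (Suc ?n) r)"
  have "bij_betw \<tau> (R (Suc ?n)) (R (Suc ?n))" by (rule gal_bij_R[OF \<tau>(1)])
  then have bij: "bij_betw ?h (R (Suc ?n)) (R (Suc ?n))"
    using bij_betw_trans[OF aut_bij[OF g]] by (simp add: o_def)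
  have ph: "ph (?h r) = ph r" if r: "r \<in> R (Suc ?n)" for r
  proof -
    have Gr: "?G (Suc ?n) r \<in> R (Suc ?n)" using aut_level(2)[OF g r] .
    have pr: "ph r \<in> R ?n" using r by (simp add: R_Suc)
    have "g (?n, ph r) = (?n, ph (?G (Suc ?n) r))" using aut_step[OF g r] by blast
    then have "ph (?G (Suc ?n) r) = \<sigma> (ph r)" using \<sigma>(2)[OF pr] by simp
    then have "\<tau> (ph (?G (Suc ?n) r)) = ph r" using \<tau>(2) R_qbar[OF pr] by simp
    then show ?thesis using gal_ph[OF \<tau>(1) R_qbar[OF Gr]] by simp
  qed
  have fl: "full (Suc ?n)" using full by simp
  obtain \<rho> where \<rho>: "\<rho> \<in> gal_Q" "\<And>r. r \<in> R (Suc ?n) \<Longrightarrow> \<rho> r = ?h r"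
    using fl[unfolded full_def, rule_format, OF bij ph] by blast
  have "(\<sigma> \<circ> \<rho>) r = ?G (Suc ?n) r" if r: "r \<in> R (Suc ?n)" for r
    using \<rho>(2)[OF r] \<tau>(3)[OF R_qbar[OF aut_level(2)[OF g r]]] by simp
  then show ?case using gal_comp[OF \<sigma>(1) \<rho>(1)] by (intro bexI[of _ "\<sigma> \<circ> \<rho>"]) auto
qed

lemma aut_realize_down:
  assumes g: "g \<in> tree_Aut f" and \<sigma>: "\<sigma> \<in> gal_Q" "\<And>b. b \<in> R (m + k) \<Longrightarrow> \<sigma> b = snd (g (m + k, b))"
    and b: "b \<in> R m"
  shows "\<sigma> b = snd (g (m, b))"
  using \<sigma>(2) b
proof (induction k arbitrary: m b)
  case (Suc k)
  obtain x where x: "x \<in> R (Suc m)" "ph x = b" using fib_nonempty[OF Suc.prems(2)] by blast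
  have "\<sigma> x = snd (g (Suc m, x))" using Suc.IH[of "Suc m" x] Suc.prems(1) x by simp
  moreover have "\<sigma> b = ph (\<sigma> x)" using gal_ph[OF \<sigma>(1) R_qbar[OF x(1)]] x by simp
  moreover have "g (m, b) = (m, ph (snd (g (Suc m, x))))" using aut_step[OF g x(1)] x(2) by blast
  ultimately show ?case by simp
qed simp

lemma zring_R_mono: "x \<in> zring (R m) \<Longrightarrow> x \<in> zring (R (m + k))"
proof (induction k arbitrary: m)
  case (Suc k)
  have "r \<in> zring (R (Suc m))" if r: "r \<in> R m" for r
  proof -
    obtain x where "x \<in> R (Suc m)" "ph x = r" using fib_nonempty[OF r] by blast
    then show ?thesis using ph_zring[of x "R (Suc m)"] by (auto intro: zring_base)
  qed
  then have "x \<in> zring (R (Suc m))" using Suc.prems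
  proof -
    assume *: "\<And>r. r \<in> R m \<Longrightarrow> r \<in> zring (R (Suc m))"
    from Suc.prems show ?thesis by induction (auto intro: * zring_1 zring_diff zring_mult)
  qed
  then show ?case using Suc.IH[of "Suc m"] by simp
qed simp

text \<open>A compactness argument: automorphisms realising \<open>g\<close> up to level
  \<open>n\<close> or further agree on \<open>zring (R n)\<close>, so their restrictions glue to a
  partial homomorphism, whose extension to \<open>qbar\<close> realises \<open>g\<close> on all
  levels.\<close>

lemma aut_in_gal_tree:
  assumes g: "g \<in> tree_Aut f" and full: "\<And>n. n > N \<Longrightarrow> full n" and triv: "\<And>b. b \<in> R N \<Longrightarrow> g (N, b) = (N, b)"
  shows "g \<in> gal_tree f"
proof -
  have "\<exists>\<sigma>\<in>gal_Q. \<forall>m\<le>n. \<forall>b\<in>R m. \<sigma> b = snd (g (m, b))" for n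
  proof -
    obtain \<sigma> where \<sigma>: "\<sigma> \<in> gal_Q" "\<And>b. b \<in> R (N + n) \<Longrightarrow> \<sigma> b = snd (g (N + n, b))"
      using aut_realize[OF g full triv, of n] by blast
    have "\<sigma> b = snd (g (m, b))" if m: "m \<le> n" "b \<in> R m" for m b
    proof -
      have e: "m + (N + n - m) = N + n" using m by simp
      show ?thesis
        by (rule aut_realize_down[OF g \<sigma>(1) _ m(2), where k = "N + n - m"]) (simp add: e \<sigma>(2))
    qed
    then show ?thesis using \<sigma>(1) by blast
  qed
  then obtain s where s: "\<And>n. s n \<in> gal_Q" "\<And>n m b. m \<le> n \<Longrightarrow> b \<in> R m \<Longrightarrow> s n b = snd (g (m, b))" by metis
  have agree: "s n x = s (n + k) x" if "x \<in> zring (R n)" for n k x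
  proof (rule gs.agree[OF s(1) s(1) _ that])
    fix r assume r: "r \<in> R n"
    show "s n r = s (n + k) r" using s(2)[of n n r] s(2)[of n "n + k" r] r by simp
  qed
  define \<Gamma> where "\<Gamma> = {(x, y). \<exists>n. x \<in> zring (R n) \<and> y = s n x}"
  have common: "\<exists>n. x \<in> zring (R n) \<and> x' \<in> zring (R n) \<and> y = s n x \<and> y' = s n x'"
    if xy: "(x, y) \<in> \<Gamma>" "(x', y') \<in> \<Gamma>" for x y x' y'
  proof -
    obtain n m where nm: "x \<in> zring (R n)" "y = s n x" "x' \<in> zring (R m)" "y' = s m x'"
      using xy by (auto simp: \<Gamma>_def)
    have "x \<in> zring (R (n + m))" "x' \<in> zring (R (n + m))"
      using zring_R_mono[OF nm(1), of m] zring_R_mono[OF nm(3), of n] by (simp_all add: add.commute)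
    moreover have "y = s (n + m) x" "y' = s (n + m) x'"
      using agree[OF nm(1), of m] agree[OF nm(3), of n] nm by (simp_all add: add.commute)
    ultimately show ?thesis by blast
  qed
  interpret partial_hom \<Gamma>
  proof
    show "(1, 1) \<in> \<Gamma>" using gal_1[OF s(1)[of 0]] by (auto simp: \<Gamma>_def intro!: exI[of _ 0] zring_1)
    show "algebraic x" if "(x, y) \<in> \<Gamma>" for x y
      using that gs.zring_qbar by (auto simp: \<Gamma>_def qbar_def)
    show "y = 0" if "(0, y) \<in> \<Gamma>" for y
      using that gal_0[OF s(1)] by (auto simp: \<Gamma>_def)
    fix x y x' y' assume "(x, y) \<in> \<Gamma>" "(x', y') \<in> \<Gamma>"
    then obtain n where n: "x \<in> zring (R n)" "x' \<in> zring (R n)" "y = s n x" "y' = s n x'" using common by blast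
    then have q: "x \<in> qbar" "x' \<in> qbar" using gs.zring_qbar by blast+
    show "(x - x', y - y') \<in> \<Gamma>"
      using n gal_diff[OF s(1) q] by (auto simp: \<Gamma>_def intro!: exI[of _ n] zring_diff)
    show "(x * x', y * y') \<in> \<Gamma>"
      using n gal_mult[OF s(1) q] by (auto simp: \<Gamma>_def intro!: exI[of _ n] zring_mult)
  qed
  obtain \<sigma> where \<sigma>: "\<sigma> \<in> gal_Q" "\<And>x y. (x, y) \<in> \<Gamma> \<Longrightarrow> \<sigma> x = y" using extend_to_gal_Q by blast
  have \<sigma>G: "\<sigma> b = snd (g (n, b))" if b: "b \<in> R n" for n b
  proof -
    have "(b, s n b) \<in> \<Gamma>" using b by (auto simp: \<Gamma>_def intro!: exI[of _ n] zring_base)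
    then show ?thesis using \<sigma>(2) s(2)[of n n b] b by simp
  qed
  have "g = (\<lambda>v. if v \<in> tree_V f then (fst v, \<sigma> (snd v)) else v)"
  proof
    fix v show "g v = (if v \<in> tree_V f then (fst v, \<sigma> (snd v)) else v)"
    proof (cases "v \<in> tree_V f")
      case True
      then have b: "snd v \<in> R (fst v)" by (rule V_E)
      then show ?thesis using aut_level(1)[OF g b] \<sigma>G[OF b] True by simp
    next
      case False
      then show ?thesis using aut_outside[OF g] by simp
    qed
  qed
  then show ?thesis using \<sigma>(1) by (auto simp: gal_tree_def)
qed

lemma gal_tree_subset: "gal_tree f \<subseteq> tree_Aut f"
proof
  fix g assume "g \<in> gal_tree f"
  then obtain \<sigma> where \<sigma>: "\<sigma> \<in> gal_Q" "g = (\<lambda>v. if v \<in> tree_V f then (fst v, \<sigma> (snd v)) else v)"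
    by (auto simp: gal_tree_def)
  obtain \<tau> where \<tau>: "\<tau> \<in> gal_Q" "\<And>x. x \<in> qbar \<Longrightarrow> \<tau> (\<sigma> x) = x" "\<And>x. x \<in> qbar \<Longrightarrow> \<sigma> (\<tau> x) = x"
    using gal_inv[OF \<sigma>(1)] by blast
  have gV: "g (n, b) = (n, \<sigma> b)" if "b \<in> R n" for n b using that by (simp add: \<sigma>(2) V_iff)
  have bij: "bij_betw g (tree_V f) (tree_V f)"
  proof (rule bij_betw_byWitness[where f' = "\<lambda>v. (fst v, \<tau> (snd v))"])
    show "\<forall>a\<in>tree_V f. (fst (g a), \<tau> (snd (g a))) = a"
      using gV \<tau>(2) R_qbar V_E by (metis fst_conv prod.collapse snd_conv)
    show "\<forall>a'\<in>tree_V f. g (fst a', \<tau> (snd a')) = a'"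
      using gV gal_R[OF \<tau>(1)] \<tau>(3) R_qbar V_E by (metis prod.collapse)
    show "g ` tree_V f \<subseteq> tree_V f"
      using gV gal_R[OF \<sigma>(1)] by (auto simp: V_iff)
    show "(\<lambda>v. (fst v, \<tau> (snd v))) ` tree_V f \<subseteq> tree_V f"
      using gal_R[OF \<tau>(1)] by (auto simp: V_iff)
  qed
  have edge: "tree_edge f (g u) (g v) \<longleftrightarrow> tree_edge f u v" if uv: "u \<in> tree_V f" "v \<in> tree_V f" for u v
  proof -
    obtain n b m b' where e: "u = (n, b)" "v = (m, b')" by fastforce
    have b: "b \<in> R n" "b' \<in> R m" using uv by (auto simp: e V_iff)
    have q: "b \<in> qbar" "b' \<in> qbar" "ph b \<in> qbar" "ph b' \<in> qbar" using b R_qbar ph_qbar by blast+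
    have "b' = ph b \<longleftrightarrow> \<sigma> b' = ph (\<sigma> b)" "b = ph b' \<longleftrightarrow> \<sigma> b = ph (\<sigma> b')"
      using gal_inj[OF \<sigma>(1)] q gal_ph[OF \<sigma>(1)] by metis+
    then show ?thesis using b gV gal_R[OF \<sigma>(1)] by (simp add: e edge_iff)
  qed
  have "g v = v" if "v \<notin> tree_V f" for v using that \<sigma>(2) by simp
  then show "g \<in> tree_Aut f" unfolding tree_Aut_def using bij edge by blast
qed

lemma gal_tree_eq:
  assumes "\<And>n. n > 0 \<Longrightarrow> full n"
  shows "gal_tree f = tree_Aut f"
proof (rule antisym[OF gal_tree_subset], rule subsetI)
  fix g assume g: "g \<in> tree_Aut f"
  show "g \<in> gal_tree f"
    by (rule aut_in_gal_tree[OF g, of 0]) (use assms aut_root[OF g] in \<open>auto simp: R_0\<close>)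
qed

lemma gal_tree_comp:
  assumes "g \<in> gal_tree f" "h \<in> gal_tree f"
  shows "g \<circ> h \<in> gal_tree f"
proof -
  obtain \<sigma> \<tau> where *: "\<sigma> \<in> gal_Q" "g = (\<lambda>v. if v \<in> tree_V f then (fst v, \<sigma> (snd v)) else v)"
    "\<tau> \<in> gal_Q" "h = (\<lambda>v. if v \<in> tree_V f then (fst v, \<tau> (snd v)) else v)"
    using assms by (auto simp: gal_tree_def)
  have "g \<circ> h = (\<lambda>v. if v \<in> tree_V f then (fst v, (\<sigma> \<circ> \<tau>) (snd v)) else v)"
    using gal_R[OF *(3)] by (auto simp: *(2,4) V_iff fun_eq_iff)
  then show ?thesis using gal_comp[OF *(1,3)] by (auto simp: gal_tree_def)
qed

lemma tree_Aut_quotient: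
  assumes g: "g \<in> tree_Aut f" and g': "g' \<in> tree_Aut f"
  obtains k where "k \<in> tree_Aut f" "g' = g \<circ> k"
proof -
  let ?V = "tree_V f"
  have bij: "bij_betw g ?V ?V" "bij_betw g' ?V ?V" using g g' by (auto simp: tree_Aut_def)
  define k where "k = (\<lambda>v. if v \<in> ?V then inv_into ?V g (g' v) else v)"
  have gk: "g (k v) = g' v" if "v \<in> ?V" for v
    using that bij by (metis bij_betw_apply bij_betw_inv_into_right k_def)
  have kV: "k v \<in> ?V" if "v \<in> ?V" for v
    using that bij by (metis bij_betw_apply bij_betw_inv_into k_def)
  have "bij_betw (inv_into ?V g \<circ> g') ?V ?V"
    using bij_betw_trans[OF bij(2) bij_betw_inv_into[OF bij(1)]] .
  then have "bij_betw k ?V ?V" by (rule bij_betw_cong[THEN iffD1, rotated]) (simp add: k_def)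
  moreover have "tree_edge f (k u) (k v) \<longleftrightarrow> tree_edge f u v" if uv: "u \<in> ?V" "v \<in> ?V" for u v
  proof -
    have "tree_edge f (k u) (k v) \<longleftrightarrow> tree_edge f (g (k u)) (g (k v))"
      using g kV[OF uv(1)] kV[OF uv(2)] by (simp add: tree_Aut_def)
    also have "\<dots> \<longleftrightarrow> tree_edge f u v" using g' uv gk by (simp add: tree_Aut_def)
    finally show ?thesis .
  qed
  ultimately have "k \<in> tree_Aut f" by (auto simp: tree_Aut_def k_def)
  moreover have "g' = g \<circ> k"
  proof
    fix v show "g' v = (g \<circ> k) v"
    proof (cases "v \<in> ?V")
      case False
      then show ?thesis using aut_outside[OF g False] aut_outside[OF g' False] by (simp add: k_def)
    qed (simp add: gk)
  qed
  ultimately show ?thesis using that by blast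
qed

text \<open>A coset depends only on the action on the finite level \<open>N\<close>: automorphisms
  agreeing there differ by one that is trivial on level \<open>N\<close>, and such a one comes from
  Galois.\<close>

lemma finite_index_if_eventually_full:
  assumes full: "\<And>n. n > N \<Longrightarrow> full n"
  shows "finite_index (gal_tree f) (tree_Aut f)"
proof -
  let ?H = "gal_tree f" and ?A = "tree_Aut f"
  define F where "F = (\<lambda>g :: nat \<times> complex \<Rightarrow> nat \<times> complex. (\<lambda>h. g \<circ> h) ` ?H)"
  define k where "k = (\<lambda>g :: nat \<times> complex \<Rightarrow> nat \<times> complex. restrict (\<lambda>b. snd (g (N, b))) (R N))"
  have "k ` ?A \<subseteq> R N \<rightarrow>\<^sub>E R N" using aut_level(2) by (auto simp: k_def)
  then have fin: "finite (k ` ?A)" using finite_R by (metis finite_PiE finite_subset)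
  have sub: "F g' \<subseteq> F g" if gg: "g \<in> ?A" "g' \<in> ?A" "k g = k g'" for g g'
  proof
    fix x assume "x \<in> F g'"
    then obtain h where h: "h \<in> ?H" "x = g' \<circ> h" by (auto simp: F_def)
    obtain q where q: "q \<in> ?A" "g' = g \<circ> q" using tree_Aut_quotient[OF gg(1,2)] by blast
    have "q (N, b) = (N, b)" if b: "b \<in> R N" for b
    proof -
      have "snd (g (N, b)) = snd (g' (N, b))" using gg(3) b unfolding k_def by (metis restrict_apply')
      then have "g (N, b) = g' (N, b)" using aut_level(1)[OF gg(1) b] aut_level(1)[OF gg(2) b] by metis
      then have "g (q (N, b)) = g (N, b)" using q(2) by simp
      moreover have "q (N, b) \<in> tree_V f" "(N, b) \<in> tree_V f"
        using aut_level[OF q(1) b] b V_iff by metis+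
      moreover have "inj_on g (tree_V f)" using gg(1) by (auto simp: tree_Aut_def bij_betw_def)
      ultimately show ?thesis by (meson inj_onD)
    qed
    then have "q \<in> ?H" using aut_in_gal_tree[OF q(1) full] by blast
    then have "q \<circ> h \<in> ?H" using gal_tree_comp h by blast
    moreover have "x = g \<circ> (q \<circ> h)" using h q by (simp add: o_assoc)
    ultimately show "x \<in> F g" by (auto simp: F_def)
  qed
  have "finite (F ` ?A)"
  proof (rule finite_image_factor[OF fin])
    fix x y assume "x \<in> ?A" "y \<in> ?A" "k x = k y"
    then show "F x = F y" using sub[of x y] sub[of y x] by simp
  qed
  moreover have "{(\<lambda>h. g \<circ> h) ` ?H | g. g \<in> ?A} = F ` ?A" by (auto simp: F_def)
  ultimately show ?thesis by (simp add: finite_index_def)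
qed

end

section \<open>Discriminants and the cubic case\<close>

text \<open>The nonzero entries in the first column of the Sylvester matrix are
  \<open>lead_coeff f\<close> and its multiple by the degree. Divisibility matters because
  \<open>disc\<close> uses integer division, which could otherwise truncate to 0.\<close>

lemma lead_coeff_dvd_resultant:
  assumes "degree f > 0" "degree (pderiv f) = degree f - 1"
  shows "lead_coeff f dvd resultant f (pderiv (f :: int poly))"
proof -
  let ?m = "degree f" and ?n = "degree (pderiv f)"
  let ?S = "sylvester_mat f (pderiv f)"
  have S: "?S \<in> carrier_mat (?m + ?n) (?m + ?n)" by (rule sylvester_carrier_mat)
  have 0: "0 < ?m + ?n" using assms by simp
  have "lead_coeff f dvd ?S $$ (i, 0) * cofactor ?S i 0" if i: "i < ?m + ?n" for i
  proof -
    have "?S $$ (i, 0) = (if i < ?n then if i \<le> 0 \<and> 0 - i \<le> ?m then coeff f (?m + i - 0) else 0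
      else if i - ?n \<le> 0 \<and> 0 \<le> i then coeff (pderiv f) (i - 0) else 0)"
      by (rule sylvester_index_mat[OF i 0])
    then have "?S $$ (i, 0) = 0 \<or> ?S $$ (i, 0) = lead_coeff f \<or> ?S $$ (i, 0) = coeff (pderiv f) ?n"
      by (auto split: if_splits)
    moreover have "coeff (pderiv f) ?n = int ?m * lead_coeff f" using assms by (simp add: coeff_pderiv)
    ultimately show ?thesis by auto
  qed
  then have "lead_coeff f dvd (\<Sum>i<?m + ?n. ?S $$ (i, 0) * cofactor ?S i 0)"
    by (intro dvd_sum) auto
  then show ?thesis unfolding resultant_def laplace_expansion_column[OF S 0] .
qed

lemma disc_nonzero:
  fixes f :: "int poly"
  assumes deg: "degree f > 0"
    and simple: "\<And>x :: complex. poly (map_poly of_int f) x = 0 \<Longrightarrow> poly (map_poly of_int (pderiv f)) x \<noteq> 0"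
  shows "disc f \<noteq> 0"
proof -
  have "resultant f (pderiv f) \<noteq> 0"
  proof
    assume "resultant f (pderiv f) = 0"
    then have "degree (gcd f (pderiv f)) \<noteq> 0" by (simp add: resultant_0_gcd)
    then have "\<not> constant (poly (map_poly of_int (gcd f (pderiv f)) :: complex poly))"
      by (simp add: constant_degree)
    then obtain x :: complex where x: "poly (map_poly of_int (gcd f (pderiv f))) x = 0"
      using fundamental_theorem_of_algebra by blast
    have "poly (map_poly of_int g) x = 0" if dvd: "gcd f (pderiv f) dvd g" for g
    proof -
      obtain k where "g = gcd f (pderiv f) * k" using dvd by blast
      then show ?thesis using x by (simp only: of_int_poly_hom.hom_mult poly_mult mult_zero_left)
    qed
    then show False using simple[of x] by simp
  qed
  moreover have "degree (pderiv f) = degree f - 1" by (rule degree_pderiv)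
  ultimately have "resultant f (pderiv f) div lead_coeff f \<noteq> 0"
    using lead_coeff_dvd_resultant[OF deg] by (simp add: dvd_div_eq_0_iff)
  then show ?thesis by (simp add: disc_def)
qed

text \<open>Squares are 0 or 1 modulo 3. Hence the explicit factor 3 of the cubic discriminant keeps
  its odd multiplicity.\<close>

lemma three_not_square_part: "\<not> 3 dvd 2 * c\<^sup>2 - (1 :: int)"
proof -
  have "c mod 3 = 0 \<or> c mod 3 = 1 \<or> c mod 3 = 2" by presburger
  moreover have "c\<^sup>2 mod 3 = (c mod 3)\<^sup>2 mod 3" by (simp add: power_mod)
  ultimately have s: "c\<^sup>2 mod 3 = 0 \<or> c\<^sup>2 mod 3 = 1" by auto
  have *: "s mod 3 = 0 \<or> s mod 3 = 1 \<Longrightarrow> \<not> 3 dvd 2 * s - 1" for s :: int by presburger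
  show ?thesis by (rule *[OF s])
qed

context arboreal
begin

text \<open>
  The discriminant of the cubic is \<open>3 (6c)\<^sup>2 (2c\<^sup>2 - 1)\<close>. It may have no primitive prime divisor of odd
  multiplicity (as \<open>2c\<^sup>2 - 1\<close> may be a square), but it is never a square.
\<close>

lemma full_cubic:
  assumes d: "d = 3"
  shows "full 1"
proof -
  have "card (R 1) = 3" using card_R[of 1] d by simp
  then obtain x y z where xyz: "R 1 = {x, y, z}" "x \<noteq> y" "y \<noteq> z" "x \<noteq> z"
    by (auto simp: card_3_iff)
  define \<delta> where "\<delta> = (x - y) * (y - z) * (x - z)"
  have z: "x \<in> zring (R 1)" "y \<in> zring (R 1)" "z \<in> zring (R 1)" using xyz zring_base by auto
  have \<delta>z: "\<delta> \<in> zring (R 1)" unfolding \<delta>_def by (intro zring_mult zring_diff z)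
  have q: "x \<in> qbar" "y \<in> qbar" "z \<in> qbar" using R_qbar xyz by auto
  have ph3: "ph w = (w - x) * (w - y) * (w - z)" for w
    using F_prod_val[of 1 w] xyz by (simp add: mult.assoc)
  have "H 1 = monom 3 1" unfolding H_def by (simp add: d)
  then have F': "(\<Prod>s\<in>R 1 - {r}. r - s) = (r - of_int (a 1)) * (3 * r)" if "r \<in> R 1" for r
    using F'_root[OF that] F'_val[of 1 r] by (simp add: poly_monom)
  have "R 1 - {x} = {y, z}" "R 1 - {y} = {x, z}" "R 1 - {z} = {x, y}" using xyz by auto
  then have F'3: "(x - y) * (x - z) = (x - of_int (a 1)) * (3 * x)" "(y - x) * (y - z) = (y - of_int (a 1)) * (3 * y)"
    "(z - x) * (z - y) = (z - of_int (a 1)) * (3 * z)"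
    using F'[of x] F'[of y] F'[of z] xyz by simp_all
  have "\<delta>\<^sup>2 = - (((x - y) * (x - z)) * ((y - x) * (y - z)) * ((z - x) * (z - y)))"
    unfolding \<delta>_def by (simp add: power2_eq_square algebra_simps)
  also have "\<dots> = - (27 * (x * y * z) * ((x - of_int (a 1)) * (y - of_int (a 1)) * (z - of_int (a 1))))"
    unfolding F'3 by (simp add: algebra_simps)
  also have "x * y * z = - ph 0" unfolding ph3 by simp
  also have "(x - of_int (a 1)) * (y - of_int (a 1)) * (z - of_int (a 1)) = - ph (of_int (a 1))" unfolding ph3 by (simp add: algebra_simps)
  also have "ph 0 = of_int (a 1)" using a_eq[of 1] by simp
  also have "ph (of_int (a 1)) = of_int (a (Suc 1))" using a_eq[of "Suc 1"] a_eq[of 1] by simp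
  finally have \<delta>2: "\<delta>\<^sup>2 = of_int (- (27 * a 1 * a (Suc 1)))" by simp
  have a1: "a 1 = 2 * c" unfolding a_1 by (simp add: d)
  have a2: "a (Suc 1) = (2 * c)\<^sup>2 * (2 * c - c * 3) + 2 * c" unfolding a_Suc a1 by (simp add: d)
  have "- (27 * a 1 * a (Suc 1)) = 3 * (6 * c)\<^sup>2 * (2 * c\<^sup>2 - 1)"
    unfolding a1 a2 by (simp add: power2_eq_square algebra_simps)
  then have \<delta>2: "\<delta>\<^sup>2 = of_int (3 * (6 * c)\<^sup>2 * (2 * c\<^sup>2 - 1))" using \<delta>2 by (simp only:)
  \<comment> \<open>If fixed by Galois, \<delta> would be an integer \<open>k\<close> whose square
    contains 3 to an odd power.\<close>
  have "\<exists>\<sigma>\<in>gal_Q. \<sigma> \<delta> \<noteq> \<delta>"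
  proof (rule ccontr)
    assume "\<not> ?thesis"
    then obtain k where "\<delta> = of_int k" using gs.fixed_int[OF gs.zring_int[OF \<delta>z]] by blast
    then have "complex_of_int (k\<^sup>2) = of_int (3 * (6 * c)\<^sup>2 * (2 * c\<^sup>2 - 1))" using \<delta>2 by simp
    then have k: "k\<^sup>2 = 3 * (6 * c)\<^sup>2 * (2 * c\<^sup>2 - 1)" by (simp only: of_int_eq_iff)
    have n0: "2 * c\<^sup>2 - 1 \<noteq> 0" "k \<noteq> 0"
      using three_not_square_part[of c] k c_pos by auto
    have p3: "prime_elem (3 :: int)" by simp
    have "multiplicity 3 (k\<^sup>2) = 2 * multiplicity 3 k"
      using n0 by (intro prime_elem_multiplicity_power_distrib p3)
    moreover have "multiplicity 3 (3 * (6 * c)\<^sup>2 * (2 * c\<^sup>2 - 1)) = 1 + 2 * multiplicity 3 (6 * c) + 0"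
    proof -
      have "multiplicity 3 (3 * (6 * c)\<^sup>2 * (2 * c\<^sup>2 - 1)) = multiplicity 3 (3::int) + multiplicity 3 ((6 * c)\<^sup>2) + multiplicity 3 (2 * c\<^sup>2 - 1)"
        using n0 c_pos by (subst prime_elem_multiplicity_mult_distrib[OF p3], simp, simp,
          subst prime_elem_multiplicity_mult_distrib[OF p3], simp, simp, simp)
      also have "multiplicity 3 ((6 * c)\<^sup>2) = 2 * multiplicity 3 (6 * c)"
        using c_pos by (intro prime_elem_multiplicity_power_distrib p3) simp
      also have "multiplicity 3 (2 * c\<^sup>2 - 1) = 0" by (rule not_dvd_imp_multiplicity_0[OF three_not_square_part])
      finally show ?thesis by simp
    qed
    ultimately have "2 * multiplicity 3 k = 1 + 2 * multiplicity 3 (6 * c)" unfolding k by linarith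
    then have "odd (2 * multiplicity 3 k)" by simp
    then show False by simp
  qed
  then obtain \<sigma> where \<sigma>: "\<sigma> \<in> gal_Q" "\<sigma> \<delta> \<noteq> \<delta>" by blast
  have \<sigma>\<delta>: "\<sigma> \<delta> = (\<sigma> x - \<sigma> y) * (\<sigma> y - \<sigma> z) * (\<sigma> x - \<sigma> z)"
    unfolding \<delta>_def using q by (simp add: gal_mult[OF \<sigma>(1)] gal_diff[OF \<sigma>(1)] qbar_ring)
  have mem: "\<sigma> x \<in> {x, y, z}" "\<sigma> y \<in> {x, y, z}" "\<sigma> z \<in> {x, y, z}" using gal_R[OF \<sigma>(1), of _ 1] xyz by auto
  have ne: "\<sigma> x \<noteq> \<sigma> y" "\<sigma> y \<noteq> \<sigma> z" "\<sigma> x \<noteq> \<sigma> z" using gal_inj[OF \<sigma>(1)] q xyz by auto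
  \<comment> \<open>The identity and the two three-cycles preserve \<delta>, so one of the three
    transpositions remains.\<close>
  have "(\<sigma> x = x \<and> \<sigma> y = y \<and> \<sigma> z = z) \<or> (\<sigma> x = y \<and> \<sigma> y = z \<and> \<sigma> z = x) \<or> (\<sigma> x = z \<and> \<sigma> y = x \<and> \<sigma> z = y)
    \<or> (\<sigma> x = y \<and> \<sigma> y = x \<and> \<sigma> z = z) \<or> (\<sigma> x = z \<and> \<sigma> z = x \<and> \<sigma> y = y) \<or> (\<sigma> y = z \<and> \<sigma> z = y \<and> \<sigma> x = x)"
    using mem ne by auto
  moreover have "\<not> (\<sigma> x = x \<and> \<sigma> y = y \<and> \<sigma> z = z)" using \<sigma>(2) unfolding \<sigma>\<delta> by (auto simp: \<delta>_def)
  moreover have "\<not> (\<sigma> x = y \<and> \<sigma> y = z \<and> \<sigma> z = x)"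
  proof
    assume "\<sigma> x = y \<and> \<sigma> y = z \<and> \<sigma> z = x"
    then have "\<sigma> \<delta> = \<delta>" unfolding \<sigma>\<delta> by (simp add: \<delta>_def algebra_simps)
    then show False using \<sigma>(2) by simp
  qed
  moreover have "\<not> (\<sigma> x = z \<and> \<sigma> y = x \<and> \<sigma> z = y)"
  proof
    assume "\<sigma> x = z \<and> \<sigma> y = x \<and> \<sigma> z = y"
    then have "\<sigma> \<delta> = \<delta>" unfolding \<sigma>\<delta> by (simp add: \<delta>_def algebra_simps)
    then show False using \<sigma>(2) by simp
  qed
  ultimately consider "\<sigma> x = y" "\<sigma> y = x" "\<sigma> z = z" | "\<sigma> x = z" "\<sigma> z = x" "\<sigma> y = y" | "\<sigma> y = z" "\<sigma> z = y" "\<sigma> x = x"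
    by blast
  then have "swaps 1 x y \<or> swaps 1 x z \<or> swaps 1 y z"
  proof cases
    case 1
    then have "swaps 1 x y" unfolding swaps_def by (intro bexI[OF _ \<sigma>(1)]) (auto simp: xyz(1)[unfolded One_nat_def])
    then show ?thesis by blast
  next
    case 2
    then have "swaps 1 x z" unfolding swaps_def by (intro bexI[OF _ \<sigma>(1)]) (auto simp: xyz(1)[unfolded One_nat_def])
    then show ?thesis by blast
  next
    case 3
    then have "swaps 1 y z" unfolding swaps_def by (intro bexI[OF _ \<sigma>(1)]) (auto simp: xyz(1)[unfolded One_nat_def])
    then show ?thesis by blast
  qed
  then obtain r s where "r \<in> R (Suc 0)" "s \<in> R (Suc 0)" "r \<noteq> s" "swaps (Suc 0) r s" using xyz by auto
  moreover have "fibre_primitive (Suc 0)" by (rule fibre_primitive_prime) (simp add: d)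
  ultimately show ?thesis using full_if_transposition by simp
qed

end

section \<open>Primitive prime divisors at high levels\<close>

lemma squarefree_part_dvd:
  fixes A B :: int
  assumes "A \<noteq> 0" "\<And>p :: nat. prime p \<Longrightarrow> odd (multiplicity (int p) A) \<Longrightarrow> int p dvd B"
  shows "squarefree_part A dvd B"
proof (cases "B = 0")
  case False
  show ?thesis
  proof (rule multiplicity_le_imp_dvd)
    show "squarefree_part A \<noteq> 0" by simp
    fix p :: int assume p: "prime p"
    then have pos: "p \<ge> 0" by (rule prime_ge_0_int)
    have "prime (nat p)" using p by simp
    then have *: "p dvd B" if "odd (multiplicity p A)" using assms(2)[of "nat p"] that pos by simp
    have "multiplicity p (squarefree_part A) = multiplicity p A mod 2"
      by (rule prime_multiplicity_squarefree_part[OF p])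
    also have "\<dots> \<le> multiplicity p B"
    proof (cases "odd (multiplicity p A)")
      case True
      then have "1 \<le> multiplicity p B" using *[OF True] False p by (intro multiplicity_geI) auto
      then show ?thesis using True by (simp add: odd_iff_mod_2_eq_one)
    qed auto
    finally show "multiplicity p (squarefree_part A) \<le> multiplicity p B" .
  qed
qed simp

lemma diff_dvd_poly_diff:
  fixes x y :: "'a :: comm_ring_1"
  shows "x - y dvd poly p x - poly p y"
proof (induction p)
  case (pCons k p)
  have "poly (pCons k p) x - poly (pCons k p) y = x * (poly p x - poly p y) + (x - y) * poly p y"
    by (simp add: algebra_simps)
  then show ?case using pCons.IH by (simp only: dvd_add dvd_mult dvd_triv_left)
qed simp

section \<open>Divisibility and growth of the critical orbit\<close>

context arboreal
begin

lemma cd_ge: "c * int d \<ge> 3" and a1_ge: "a 1 \<ge> 2"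
proof -
  have c1: "c \<ge> 1" using c_pos by simp
  have "1 * 3 \<le> c * int d" using c1 d3 by (intro mult_mono) auto
  then show "c * int d \<ge> 3" by simp
  have "1 * 2 \<le> c * (int d - 1)" using c1 d3 by (intro mult_mono) auto
  then show "a 1 \<ge> 2" unfolding a_1 by simp
qed

lemma orbit_mod:
  assumes "int p dvd a k"
  shows "int p dvd a (k + j) - a j"
proof (induction j)
  case 0
  then show ?case using assms by (simp add: a_0)
next
  case (Suc j)
  let ?u = "a (k + j)" and ?w = "a j"
  have "a (k + Suc j) - a (Suc j) = poly f ?u - poly f ?w"
    by (simp add: a_def iter_Suc poly_pcompose)
  moreover have "?u - ?w dvd poly f ?u - poly f ?w" by (rule diff_dvd_poly_diff)
  ultimately show ?case using Suc dvd_trans by metis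
qed

text \<open>Modulo \<open>p\<close> the orbit is periodic, with period the least positive
  \<open>k\<close> such that \<open>p\<close> divides \<open>a k\<close>. So \<open>k\<close>
  divides \<open>Suc n\<close>, properly because k \<le> i \<le> n.\<close>

lemma first_divisor:
  assumes p: "int p dvd a i" "1 \<le> i" "i \<le> n" "int p dvd a (Suc n)"
  shows "\<exists>k. 1 \<le> k \<and> k \<le> Suc n div 2 \<and> int p dvd a k"
proof -
  define k where "k = (LEAST k. 1 \<le> k \<and> int p dvd a k)"
  have k: "1 \<le> k \<and> int p dvd a k" unfolding k_def by (rule LeastI[of _ i]) (use p in simp)
  have ki: "k \<le> i" unfolding k_def by (rule Least_le) (use p in simp)
  have mult: "int p dvd a (k * l + j) \<longleftrightarrow> int p dvd a j" for l j
  proof (induction l)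
    case (Suc l)
    have "int p dvd a (k + (k * l + j)) - a (k * l + j)" using k by (intro orbit_mod) simp
    then have "int p dvd a (k * l + j) + (a (k + (k * l + j)) - a (k * l + j)) \<longleftrightarrow> int p dvd a (k * l + j)"
      by (rule dvd_add_left_iff)
    then have "int p dvd a (k + (k * l + j)) \<longleftrightarrow> int p dvd a (k * l + j)" by simp
    then show ?case using Suc by (simp add: add_ac)
  qed simp
  have "int p dvd a (Suc n mod k)" using mult[of "Suc n div k" "Suc n mod k"] p(4) by simp
  moreover have "Suc n mod k < k" using k by simp
  ultimately have "Suc n mod k = 0" using not_less_Least[of "Suc n mod k" "\<lambda>k. 1 \<le> k \<and> int p dvd a k"]
    unfolding k_def[symmetric] by auto
  then obtain l where l: "Suc n = k * l" by auto
  have "l \<noteq> 1" using l ki p(3) by auto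
  then have "l \<ge> 2" using l by (cases l) auto
  then have "k * 2 \<le> Suc n" unfolding l by simp
  then show ?thesis using k by auto
qed

lemma a_2: "a 2 \<le> - a 1"
proof -
  have c1: "c \<ge> 1" and d1: "int d - 1 \<ge> 2" using c_pos d3 by auto
  obtain k where k: "d - 1 = Suc (Suc k)" using d3 by (metis Suc_1 Suc_diff_1 Suc_le_mono add_2_eq_Suc le_Suc_ex less_le_trans numeral_3_eq_3 zero_less_Suc)
  have "a 2 = a 1 ^ (d - 1) * (a 1 - c * int d) + a 1" using a_Suc[of 1] a_1 by (simp add: numeral_2_eq_2)
  also have "a 1 - c * int d = - c" unfolding a_1 by (simp add: algebra_simps)
  finally have e: "a 2 = a 1 - c * a 1 ^ (d - 1)" by simp
  note a1 = a1_ge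
  have "a 1 * 2 \<le> a 1 * a 1" using a1 by (intro mult_left_mono) auto
  also have "\<dots> = a 1 ^ 2" by (simp add: power2_eq_square)
  also have "\<dots> \<le> a 1 ^ (d - 1)" using a1 d3 by (intro power_increasing) auto
  also have "\<dots> \<le> c * a 1 ^ (d - 1)" using c1 a1 by (simp add: mult_le_cancel_right1)
  finally show ?thesis using e by simp
qed

text \<open>Beyond the threshold the factor \<open>a n - c * int d\<close> has absolute value at
  least 3, so the product is at least three times the square of \<open>a n\<close>; the constant
  term costs at most twice that square.\<close>

lemma growth_step:
  assumes "\<bar>a n\<bar> \<ge> 2 * (c * int d)"
  shows "\<bar>a (Suc n)\<bar> \<ge> (a n)\<^sup>2"
proof -
  let ?x = "\<bar>a n\<bar>" and ?q = "c * int d"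
  note q3 = cd_ge
  have x1: "?x \<ge> 1" using assms q3 by linarith
  have h: "\<bar>a n - ?q\<bar> \<ge> ?q" using assms by linarith
  have "?x ^ 2 \<le> ?x ^ (d - 1)" using x1 d3 by (intro power_increasing) auto
  then have "?x ^ 2 * 3 \<le> ?x ^ (d - 1) * \<bar>a n - ?q\<bar>" using h q3 by (intro mult_mono) auto
  then have 1: "3 * ?x ^ 2 \<le> \<bar>a n ^ (d - 1) * (a n - ?q)\<bar>" by (simp add: abs_mult power_abs)
  have 2: "\<bar>c * (int d - 1)\<bar> \<le> ?q" using c_pos d3 by (simp add: abs_mult algebra_simps)
  have "?x * 1 \<le> ?x * ?x" using x1 by (intro mult_left_mono) auto
  then have 3: "?q \<le> 2 * ?x ^ 2" using assms q3 by (simp add: power2_eq_square)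
  have "\<bar>a (Suc n)\<bar> \<ge> \<bar>a n ^ (d - 1) * (a n - ?q)\<bar> - \<bar>c * (int d - 1)\<bar>" unfolding a_Suc by linarith
  then show ?thesis using 1 2 3 by simp
qed

text \<open>\<open>a 1\<close> is below the threshold of \<open>growth_step\<close> and
  \<open>a 2\<close> may be; \<open>a 3\<close> is the first term that always reaches it. The growth
  estimates therefore start at index 3.\<close>

lemma a_3: "\<bar>a 3\<bar> \<ge> 2 * (c * int d)" "\<bar>a 3\<bar> \<ge> \<bar>a 2\<bar>"
proof -
  define q where "q = c * int d"
  have c1: "c \<ge> 1" and d1: "int d - 1 \<ge> 2" using c_pos d3 by auto
  note a1 = a1_ge
  let ?x = "- a 2"
  have x: "?x \<ge> a 1" "?x \<ge> 2" using a_2 a1 by auto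
  have pos: "0 \<le> ?x + q" using x cd_ge[folded q_def] by linarith
  have "?x ^ 2 \<le> ?x ^ (d - 1)" using x d3 by (intro power_increasing) auto
  then have "?x ^ 2 * (?x + q) \<le> ?x ^ (d - 1) * (?x + q)" using pos by (intro mult_right_mono) auto
  moreover have "?x * 2 \<le> ?x * ?x" using x by (intro mult_left_mono) auto
  then have "4 * (?x + q) \<le> ?x ^ 2 * (?x + q)" using pos x(2) unfolding power2_eq_square by (intro mult_right_mono) linarith+
  moreover have "\<bar>a 2 ^ (d - 1) * (a 2 - q)\<bar> = ?x ^ (d - 1) * (?x + q)"
    using x pos by (simp add: abs_mult power_abs)
  ultimately have "4 * (?x + q) \<le> \<bar>a 2 ^ (d - 1) * (a 2 - q)\<bar>" by linarith
  moreover have "a 3 = a 2 ^ (d - 1) * (a 2 - q) + a 1" using a_Suc[of 2] a_1 by (simp add: numeral_3_eq_3 numeral_2_eq_2 q_def)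
  ultimately have m: "\<bar>a 3\<bar> \<ge> 4 * (?x + q) - a 1" using a1 by linarith
  have qpos: "q \<ge> 0" using cd_ge unfolding q_def by linarith
  show "\<bar>a 3\<bar> \<ge> 2 * (c * int d)" 
  proof -
    define y where "y = - a 2"
    have "2 * q \<le> 4 * (y + q) - a 1" using x[folded y_def] qpos by (simp add: algebra_simps)
    then show ?thesis using m unfolding y_def q_def by linarith
  qed
  show "\<bar>a 3\<bar> \<ge> \<bar>a 2\<bar>"
  proof -
    define y where "y = - a 2"
    have "y \<le> 4 * (y + q) - a 1" using x[folded y_def] qpos by (simp add: algebra_simps)
    moreover have "\<bar>a 2\<bar> = y" using x unfolding y_def by simp
    ultimately show ?thesis using m unfolding y_def by linarith
  qed
qed

lemma growth: "\<bar>a (3 + k)\<bar> \<ge> 2 * (c * int d)"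
proof (induction k)
  case (Suc k)
  have "2 * (c * int d) \<ge> 1" using cd_ge by simp
  then have "\<bar>a (3 + k)\<bar> * 1 \<le> \<bar>a (3 + k)\<bar> * \<bar>a (3 + k)\<bar>" using Suc by (intro mult_left_mono) auto
  then have "\<bar>a (3 + k)\<bar> \<le> (a (3 + k))\<^sup>2" by (simp add: power2_eq_square abs_mult_self_eq)
  then show ?case using growth_step[OF Suc] Suc by simp
qed (simp add: a_3)

lemma growth_mono: "\<bar>a (3 + k)\<bar> \<le> \<bar>a (3 + (k + j))\<bar>"
proof (induction j)
  case (Suc j)
  have "2 * (c * int d) \<ge> 1" using cd_ge by simp
  then have "\<bar>a (3 + (k + j))\<bar> * 1 \<le> \<bar>a (3 + (k + j))\<bar> * \<bar>a (3 + (k + j))\<bar>"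
    using growth[of "k + j"] by (intro mult_left_mono) auto
  then have "\<bar>a (3 + (k + j))\<bar> \<le> (a (3 + (k + j)))\<^sup>2" by (simp add: power2_eq_square abs_mult_self_eq)
  also have "\<dots> \<le> \<bar>a (Suc (3 + (k + j)))\<bar>" by (rule growth_step[OF growth])
  finally show ?case using Suc by simp
qed simp

lemma a_le:
  assumes "1 \<le> i" "i \<le> 3 + k"
  shows "\<bar>a i\<bar> \<le> \<bar>a (3 + k)\<bar>"
proof -
  have 3: "\<bar>a 3\<bar> \<le> \<bar>a (3 + k)\<bar>" using growth_mono[of 0 k] by simp
  have a1: "a 1 \<ge> 0" unfolding a_1 using c_pos d3 by simp
  consider "i = 1" | "i = 2" | "i \<ge> 3" using assms by linarith
  then show ?thesis
  proof cases
    case 1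
    have "\<bar>a 1\<bar> \<le> \<bar>a 2\<bar>" using a_2 a1 by linarith
    then show ?thesis unfolding 1 using 3 a_3(2) by linarith
  next
    case 2
    show ?thesis unfolding 2 using 3 a_3(2) by linarith
  next
    case 3
    then show ?thesis using growth_mono[of "i - 3" "3 + k - i"] assms by simp
  qed
qed

lemma a_ge_1: "i \<ge> 1 \<Longrightarrow> \<bar>a i\<bar> \<ge> 1"
proof -
  assume i: "i \<ge> 1"
  have q: "2 * (c * int d) \<ge> 1" using cd_ge by simp
  have a1: "a 1 \<ge> 1" using a1_ge by simp
  consider "i = 1" | "i = 2" | "i \<ge> 3" using i by linarith
  then show ?thesis
  proof cases
    case 1
    show ?thesis unfolding 1 using a1 by linarith
  next
    case 2
    show ?thesis unfolding 2 using a1 a_2 by linarith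
  next
    case 3
    then show ?thesis using growth[of "i - 3"] q by simp
  qed
qed

lemma ln_growth:
  "ln \<bar>real_of_int (a (3 + (k + j)))\<bar> \<ge> 2 ^ j * ln \<bar>real_of_int (a (3 + k))\<bar>"
proof (induction j)
  case (Suc j)
  let ?A = "a (3 + (k + j))"
  have 1: "\<bar>?A\<bar> \<ge> 1" "\<bar>a (Suc (3 + (k + j)))\<bar> \<ge> 1" by (rule a_ge_1; simp)+
  have "2 ^ Suc j * ln \<bar>real_of_int (a (3 + k))\<bar> \<le> 2 * ln \<bar>real_of_int ?A\<bar>" using Suc by simp
  also have "\<dots> = ln (\<bar>real_of_int ?A\<bar> ^ 2)" using 1 by (subst ln_realpow) auto
  also have "\<dots> = ln (real_of_int (?A\<^sup>2))" by simp
  also have "\<dots> \<le> ln (real_of_int \<bar>a (Suc (3 + (k + j)))\<bar>)"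
  proof -
    have "real_of_int (?A\<^sup>2) \<le> real_of_int \<bar>a (Suc (3 + (k + j)))\<bar>"
      unfolding of_int_le_iff by (rule growth_step[OF growth])
    moreover have "0 < real_of_int (?A\<^sup>2)" using 1 by auto
    ultimately show ?thesis by (intro ln_mono) auto
  qed
  finally show ?case by simp
qed simp

lemma no_good_prime_squarefree_part:
  assumes "n \<ge> 1" "\<And>p. \<not> good_prime n p"
  shows "squarefree_part (a (Suc n)) dvd int d * (\<Prod>i\<in>{1..Suc n div 2}. a i)"
proof (rule squarefree_part_dvd)
  show "a (Suc n) \<noteq> 0" using a_ge_1[of "Suc n"] by auto
  fix p :: nat assume p: "prime p" "odd (multiplicity (int p) (a (Suc n)))"
  then have dvd: "int p dvd a (Suc n)" by (metis even_zero not_dvd_imp_multiplicity_0)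
  show "int p dvd int d * (\<Prod>i\<in>{1..Suc n div 2}. a i)"
  proof (cases "p dvd d")
    case False
    then obtain i where "1 \<le> i" "i \<le> n" "int p dvd a i"
      using assms(2)[of p] p by (auto simp: good_prime_def)
    then obtain k where "1 \<le> k" "k \<le> Suc n div 2" "int p dvd a k" using first_divisor dvd by blast
    then have "int p dvd (\<Prod>i\<in>{1..Suc n div 2}. a i)"
      using dvd_prodI[of "{1..Suc n div 2}" k a] by (auto intro: dvd_trans)
    then show ?thesis by simp
  qed simp
qed

end

section \<open>Heights and the uniform bound at high levels\<close>

lemma ht_int_le: "\<bar>x\<bar> \<le> B \<Longrightarrow> B \<ge> 1 \<Longrightarrow> ht_int x \<le> ln (real_of_int B)"
  by (simp add: ht_int_def)

lemma ht_poly_le: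
  assumes "\<And>i. \<bar>coeff f i\<bar> \<le> B" "B \<ge> 1"
  shows "ht_poly f \<le> ln (real_of_int B)"
  unfolding ht_poly_def using assms by (intro Max.boundedI) (auto intro: ht_int_le)

lemma ht_poly_nonneg: "ht_poly f \<ge> 0"
proof -
  have "0 \<le> ht_int (coeff f 0)" by (simp add: ht_int_def)
  also have "\<dots> \<le> ht_poly f" unfolding ht_poly_def by (rule Max_ge) auto
  finally show ?thesis .
qed

context arboreal
begin

lemma coeff_f_le: "\<bar>coeff f i\<bar> \<le> c * int d"
proof -
  have q: "c * int d \<ge> 1" using cd_ge by simp
  have "coeff f i = (if i = d then 1 else if i = d - 1 then - (c * int d) else if i = 0 then c * (int d - 1) else 0)"
    using d3 by (auto simp: phi_def coeff_pCons split: nat.split)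
  then show ?thesis using q c_pos d3 by (auto simp: abs_mult mult_left_mono)
qed

text \<open>With \<open>m = Suc n div 2\<close>, the heights of the curve and of the point
  \<open>a n\<close> are both compared with \<open>ln \<bar>a m\<bar>\<close>, which is at least 1
  and so also absorbs \<open>C2\<close>. It cancels, leaving an inequality free of
  \<open>c\<close>.\<close>

lemma no_good_prime_height:
  assumes n: "n \<ge> 6" and ngp: "\<And>p. \<not> good_prime n p"
    and V: "\<And>g :: int poly. \<And>x y. degree g = d \<Longrightarrow> disc g \<noteq> 0 \<Longrightarrow> y\<^sup>2 = poly g x \<Longrightarrow> ht_int x \<le> C1 * ht_poly g + C2"
    and C: "C1 \<ge> 0" "C2 \<ge> 0"
  shows "2 ^ (n div 2) \<le> C1 * (real n + 2) + C2"
proof -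
  define D where "D = squarefree_part (a (Suc n))"
  define y where "y = square_part (a (Suc n))"
  have Dy: "a (Suc n) = D * y\<^sup>2" unfolding D_def y_def by (rule squarefree_decompose)
  have D0: "D \<noteq> 0" by (simp add: D_def)
  define m where "m = Suc n div 2"
  \<comment> \<open>The bound n \<ge> 6 is what places \<open>m\<close> in the range of the growth
    estimates.\<close>
  have "3 \<le> m" using n unfolding m_def by linarith
  then obtain k where k: "m = 3 + k" using le_Suc_ex by blast
  have nm: "n = m + n div 2" unfolding m_def by linarith
  let ?L = "\<bar>a m\<bar>"
  have L: "?L \<ge> 2 * (c * int d)" using growth[of k] k by simp
  note q3 = cd_ge
  have L6: "?L \<ge> 6" using L q3 by linarith
  have d_le: "int d \<le> ?L" using L q3 c_pos mult_right_mono[of 1 c "int d"] by simp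
  let ?P = "\<Prod>i\<in>{1..m}. a i"
  have "D dvd int d * ?P" unfolding D_def m_def using n by (intro no_good_prime_squarefree_part ngp) simp
  moreover have "int d * ?P \<noteq> 0" using a_ge_1 d3 by fastforce
  ultimately have "\<bar>D\<bar> \<le> \<bar>int d * ?P\<bar>" by (rule dvd_imp_le_int[rotated])
  also have "\<dots> = int d * (\<Prod>i\<in>{1..m}. \<bar>a i\<bar>)" by (simp add: abs_mult abs_prod)
  also have "\<dots> \<le> ?L * (\<Prod>i\<in>{1..m}. ?L)"
    using d_le a_le[of _ k] k by (intro mult_mono prod_mono) (auto intro: prod_nonneg)
  \<comment> \<open>\<open>d\<close> and each of the \<open>m\<close> factors are at most |a m|. The
    exponent is linear in \<open>n\<close>, against the factor \<open>2 ^ (n div 2)\<close> gained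
    between levels \<open>m\<close> and \<open>n\<close>.\<close>
  finally have DL: "\<bar>D\<bar> \<le> ?L ^ (m + 1)" by simp
  let ?g = "smult D f"
  have "\<bar>coeff ?g i\<bar> \<le> ?L ^ (m + 2)" for i
  proof -
    have "\<bar>coeff ?g i\<bar> \<le> ?L ^ (m + 1) * ?L"
      using DL coeff_f_le[of i] L q3 unfolding coeff_smult abs_mult by (intro mult_mono) auto
    then show ?thesis by (simp add: mult.commute)
  qed
  moreover have "1 \<le> ?L ^ (m + 2)" using L6 by (intro one_le_power) simp
  ultimately have "ht_poly ?g \<le> ln (real_of_int (?L ^ (m + 2)))" by (rule ht_poly_le)
  also have "\<dots> = real (m + 2) * ln (real_of_int ?L)" unfolding of_int_power by (rule ln_realpow)
  finally have hg: "ht_poly ?g \<le> real (m + 2) * ln (real_of_int ?L)" .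
  have "degree ?g = d" using D0 degree_f by simp
  moreover have "disc ?g \<noteq> 0"
  proof (rule disc_nonzero)
    show "degree ?g > 0" using D0 degree_f d3 by simp
    fix x :: complex assume "poly (map_poly of_int ?g) x = 0"
    then have "poly (map_poly of_int f) x = 0" using D0 by (simp add: of_int_hom.map_poly_hom_smult)
    then have "x \<in> R 1" by (simp add: R_def ph_def)
    then have "poly (pderiv (map_poly of_int f)) x \<noteq> 0" using R_simple[of x 1] unfolding One_nat_def iter_Suc iter_0 pcompose_idR by blast
    then show "poly (map_poly of_int (pderiv ?g)) x \<noteq> 0"
      using D0 by (simp add: pderiv_smult of_int_hom.map_poly_hom_smult of_int_hom.map_poly_pderiv)
  qed
  moreover have "(D * y)\<^sup>2 = poly ?g (a n)"
  proof -
    have "poly f (a n) = a (Suc n)" by (simp add: a_def iter_Suc poly_pcompose)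
    then show ?thesis using Dy by (simp add: power2_eq_square algebra_simps)
  qed
  ultimately have "ht_int (a n) \<le> C1 * ht_poly ?g + C2" by (rule V)
  also have "\<dots> \<le> C1 * (real (m + 2) * ln (real_of_int ?L)) + C2"
    using hg C by (simp add: mult_left_mono)
  finally have up: "ht_int (a n) \<le> C1 * (real (m + 2) * ln (real_of_int ?L)) + C2" .
  have lnL: "ln (real_of_int ?L) \<ge> 1"
  proof -
    have "exp 1 \<le> (3 :: real)" by (rule exp_le)
    also have "\<dots> \<le> real_of_int ?L" using L6 by linarith
    finally show ?thesis using L6 by (subst ln_ge_iff) auto
  qed
  have "2 ^ (n div 2) * ln (real_of_int ?L) \<le> ln \<bar>real_of_int (a n)\<bar>"
    using ln_growth[where k = k and j = "n div 2"] nm k by (simp add: add.assoc)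
  also have "\<dots> = ht_int (a n)" using a_ge_1[of n] n by (simp add: ht_int_def)
  also note up
  also have "C1 * (real (m + 2) * ln (real_of_int ?L)) + C2 \<le> (C1 * (real n + 2) + C2) * ln (real_of_int ?L)"
  proof -
    have "C1 * real (m + 2) \<le> C1 * (real n + 2)" using C nm by (intro mult_left_mono) auto
    then have "C1 * real (m + 2) * ln (real_of_int ?L) \<le> C1 * (real n + 2) * ln (real_of_int ?L)"
      using lnL by (intro mult_right_mono) auto
    moreover have "C2 * 1 \<le> C2 * ln (real_of_int ?L)" using C lnL by (intro mult_left_mono) auto
    ultimately show ?thesis by (simp add: algebra_simps)
  qed
  finally show ?thesis using lnL by simp
qed

end

text \<open>Absolute values of the constants keep the bound valid, since heights are nonnegative,
  and make it monotone in the height of the polynomial.\<close>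

lemma vojta_nonneg:
  assumes vojta_conj "k \<ge> 3"
  obtains C1 C2 where "C1 \<ge> 0" "C2 \<ge> 0"
   "\<And>g :: int poly. \<And>x y. degree g = k \<Longrightarrow> disc g \<noteq> 0 \<Longrightarrow> y\<^sup>2 = poly g x \<Longrightarrow> ht_int x \<le> C1 * ht_poly g + C2"
proof -
  obtain C1 C2 where C: "\<And>g :: int poly. \<And>x y. degree g = k \<Longrightarrow> disc g \<noteq> 0 \<Longrightarrow> y\<^sup>2 = poly g x \<Longrightarrow> ht_int x \<le> C1 * ht_poly g + C2"
    using assms unfolding vojta_conj_def by blast
  have "ht_int x \<le> \<bar>C1\<bar> * ht_poly g + \<bar>C2\<bar>" if "degree g = k" "disc g \<noteq> 0" "y\<^sup>2 = poly g x" for g x y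
  proof -
    have "C1 * ht_poly g \<le> \<bar>C1\<bar> * ht_poly g" using ht_poly_nonneg by (intro mult_right_mono) auto
    then show ?thesis using C[OF that] by linarith
  qed
  then show ?thesis using that[of "\<bar>C1\<bar>" "\<bar>C2\<bar>"] by simp
qed

text \<open>The bound \<open>N\<close> is independent of \<open>c\<close>, which later leaves the
  same finitely many levels to be examined for all \<open>c\<close> together.\<close>

lemma large_levels:
  assumes vojta_conj "d \<ge> 3"
  obtains N where "\<And>c n. c \<in> B_set d \<Longrightarrow> n \<ge> N \<Longrightarrow> \<exists>p. arboreal.good_prime d c n p"
proof -
  obtain C1 C2 where C: "C1 \<ge> 0" "C2 \<ge> 0"
   "\<And>g :: int poly. \<And>x y. degree g = d \<Longrightarrow> disc g \<noteq> 0 \<Longrightarrow> y\<^sup>2 = poly g x \<Longrightarrow> ht_int x \<le> C1 * ht_poly g + C2"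
    using vojta_nonneg[OF assms] by blast
  have "((\<lambda>n. (C1 * (real n + 2) + C2) / 2 powr (real n / 2 - 1)) \<longlongrightarrow> 0) sequentially"
    by real_asymp
  then have "eventually (\<lambda>n. (C1 * (real n + 2) + C2) / 2 powr (real n / 2 - 1) < 1) sequentially"
    by (rule order_tendstoD) simp
  then have "eventually (\<lambda>n. C1 * (real n + 2) + C2 < 2 powr (real n / 2 - 1)) sequentially"
    by eventually_elim (simp add: divide_less_eq)
  then obtain N0 where N0: "\<And>n. n \<ge> N0 \<Longrightarrow> C1 * (real n + 2) + C2 < 2 powr (real n / 2 - 1)"
    unfolding eventually_sequentially by blast
  show ?thesis
  proof (rule that[of "max N0 6"])
    fix c n assume c: "c \<in> B_set d" and n: "n \<ge> max N0 6"
    interpret arboreal d c by unfold_locales (use assms c in auto)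
    show "\<exists>p. good_prime n p"
    proof (rule ccontr)
      assume "\<not> ?thesis"
      then have "2 ^ (n div 2) \<le> C1 * (real n + 2) + C2"
        using n by (intro no_good_prime_height[OF _ _ C(3) C(1,2)]) auto
      also have "\<dots> < 2 powr (real n / 2 - 1)" using N0 n by simp
      also have "\<dots> \<le> 2 powr real (n div 2)" by (intro powr_mono) linarith+
      also have "\<dots> = 2 ^ (n div 2)" by (simp add: powr_realpow)
      finally show False by simp
    qed
  qed
qed

section \<open>Primitive prime divisors at a fixed level\<close>

text \<open>The critical orbit as a family of polynomials in the parameter \<open>c\<close>.\<close>

fun crit :: "nat \<Rightarrow> nat \<Rightarrow> int poly" where
  "crit d 0 = 0"
| "crit d (Suc n) = crit d n ^ (d - 1) * (crit d n - [:0, int d:]) + [:0, int d - 1:]"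

declare crit.simps(2) [simp del]

lemma (in arboreal) crit_eval: "poly (crit d n) c = a n"
proof (induction n)
  case (Suc n)
  show ?case unfolding a_Suc crit.simps using Suc by (simp add: algebra_simps)
qed (simp add: a_0)

lemma crit_1: "d \<ge> 3 \<Longrightarrow> crit d (Suc 0) = [:0, int d - 1:]"
proof -
  assume "d \<ge> 3"
  then have "(0 :: int poly) ^ (d - 1) = 0" by (intro power_0_left[THEN trans]) simp
  then show ?thesis by (simp only: crit.simps mult_zero_left add_0_left)
qed

text \<open>The form of the leading coefficient shows that it is prime to \<open>d\<close>, which
  \<open>crit_simple_roots\<close> relies on.\<close>

lemma degree_crit:
  assumes d: "d \<ge> 3"
  shows "degree (crit d (Suc n)) = d ^ n \<and> (\<exists>j e. e \<in> {1, -1} \<and> lead_coeff (crit d (Suc n)) = e * (int d - 1) ^ j)"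
proof (induction n)
  case 0
  show ?case unfolding crit_1[OF d] using d by (auto intro!: exI[of _ 1] exI[of _ "1::int"])
next
  case (Suc n)
  let ?A = "crit d (Suc n)"
  define B where "B = ?A - [:0, int d:]"
  obtain j e where je: "e \<in> {1, -1}" "lead_coeff ?A = e * (int d - 1) ^ j" using Suc by blast
  have "lead_coeff ?A \<noteq> 0" unfolding je(2) using je(1) d by auto
  then have A0: "?A \<noteq> 0" by (metis leading_coeff_0_iff)
  \<comment> \<open>For \<open>n = 0\<close> the subtraction changes the leading coefficient: (d -
    1) c - d c = -c. From the next level on it affects lower terms only.\<close>
  have degB: "degree B = d ^ n" and lB: "lead_coeff B = (if n = 0 then -1 else e * (int d - 1) ^ j)"
  proof -
    have "degree B = d ^ n \<and> lead_coeff B = (if n = 0 then -1 else e * (int d - 1) ^ j)"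
    proof (cases "n = 0")
      case True
      have "B = [:0, - 1:]" unfolding B_def True crit_1[OF d] by simp
      then show ?thesis using True by simp
    next
      case False
      then have "d ^ 1 \<le> d ^ n" using d by (intro power_increasing) auto
      then have lt: "degree [:0, int d:] < degree ?A" using Suc d by simp
      have "degree B = degree ?A" unfolding B_def diff_conv_add_uminus using lt by (intro degree_add_eq_left) (simp only: degree_minus)
      moreover have "coeff B (degree ?A) = lead_coeff ?A"
        using lt unfolding B_def by (simp only: coeff_diff coeff_eq_0 diff_zero)
      ultimately show ?thesis using Suc je False by simp
    qed
    then show "degree B = d ^ n" "lead_coeff B = (if n = 0 then -1 else e * (int d - 1) ^ j)" by auto
  qed
  have B0: "B \<noteq> 0" using lB je d by (auto split: if_splits)
  define P where "P = ?A ^ (d - 1) * B"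
  have degP: "degree P = d ^ Suc n"
  proof -
    have "degree P = (d - 1) * d ^ n + d ^ n"
      unfolding P_def using A0 B0 Suc degB by (simp add: degree_mult_eq degree_power_eq)
    also have "\<dots> = d ^ Suc n" using d by (cases d) auto
    finally show ?thesis .
  qed
  have lP: "lead_coeff P = (e * (int d - 1) ^ j) ^ (d - 1) * lead_coeff B"
    unfolding P_def lead_coeff_mult lead_coeff_power je(2) ..
  have d1: "d ^ Suc n > 1" by (rule one_less_power) (use d in simp_all)
  have lt: "degree [:0, int d - 1:] < degree P" using degP d1 d by simp
  have dA: "degree (crit d (Suc (Suc n))) = d ^ Suc n"
    unfolding crit.simps(2)[of d "Suc n"] B_def[symmetric] P_def[symmetric] using lt degP by (subst degree_add_eq_left) auto
  have "lead_coeff (crit d (Suc (Suc n))) = lead_coeff P"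
    unfolding crit.simps(2)[of d "Suc n"] B_def[symmetric] P_def[symmetric] using lead_coeff_add_le[OF lt] by (simp only: add.commute)
  also have "\<dots> = (if n = 0 then - (e ^ (d - 1)) else e ^ (d - 1) * e) * (int d - 1) ^ (j * (d - 1) + (if n = 0 then 0 else j))"
    unfolding lP lB by (simp add: power_mult_distrib power_add power_mult)
  finally have l: "lead_coeff (crit d (Suc (Suc n))) = (if n = 0 then - (e ^ (d - 1)) else e ^ (d - 1) * e) * (int d - 1) ^ (j * (d - 1) + (if n = 0 then 0 else j))" .
  have "(if n = 0 then - (e ^ (d - 1)) else e ^ (d - 1) * e) \<in> {1, -1}"
    using je(1) by (cases "even (d - 1)") auto
  then show ?case using dA l by blast
qed

lemma crit_nz: "d \<ge> 3 \<Longrightarrow> crit d (Suc n) \<noteq> 0"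
  using degree_crit[of d n] by auto

text \<open>The \<open>d\<close>-th power and the term with coefficient \<open>d\<close> both have
  derivative divisible by \<open>d\<close>; only the linear summand survives modulo
  \<open>d\<close>.\<close>

lemma pderiv_crit: "\<exists>W. pderiv (crit d (Suc n)) = smult (int d) W + [:int d - 1:]" if d: "d \<ge> 3"
proof -
  obtain e where e: "d - 1 = Suc e" using d by (cases "d - 1") auto
  have de: "d = Suc (Suc e)" using e by simp
  let ?A = "crit d n"
  have "crit d (Suc n) = ?A ^ d - smult (int d) ([:0, 1:] * ?A ^ (d - 1)) + [:0, int d - 1:]"
    unfolding crit.simps e unfolding de by (simp add: algebra_simps)
  then have "pderiv (crit d (Suc n)) = smult (int d) (?A ^ (d - 1) * pderiv ?A) - smult (int d) (pderiv ([:0, 1:] * ?A ^ (d - 1))) + [:int d - 1:]"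
    using pderiv_power_Suc[of ?A "d - 1"] d
    by (simp add: pderiv_add pderiv_diff pderiv_smult pderiv_pCons del: mult_pCons_left)
  then have "pderiv (crit d (Suc n)) = smult (int d) (?A ^ (d - 1) * pderiv ?A - pderiv ([:0, 1:] * ?A ^ (d - 1))) + [:int d - 1:]"
    by (simp only: smult_diff_right)
  then show ?thesis by blast
qed

lemma algebraic_int_scaled_ipoly:
  fixes x :: complex
  assumes "algebraic_int (of_int l * x)"
  shows "algebraic_int (of_int l ^ degree W * poly (map_poly of_int W) x)"
proof -
  have "of_int l ^ degree W * poly (map_poly of_int W) x
    = (\<Sum>i\<le>degree W. of_int (coeff W i) * (of_int l ^ (degree W - i) * (of_int l * x) ^ i))"
  proof -
    have "of_int l ^ degree W = of_int l ^ (degree W - i) * (of_int l :: complex) ^ i" if "i \<le> degree W" for i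
      using that by (simp flip: power_add)
    then show ?thesis by (auto simp: poly_altdef sum_distrib_left power_mult_distrib mult_ac intro!: sum.cong)
  qed
  also have "algebraic_int \<dots>"
  proof -
    have "algebraic_int (\<Sum>i\<in>I. of_int (coeff W i) * (of_int l ^ (degree W - i) * (of_int l * x) ^ i))" for I
      by (induction I rule: infinite_finite_induct)
         (auto intro!: algebraic_int_ring algebraic_int_power assms)
    then show ?thesis .
  qed
  finally show ?thesis .
qed

text \<open>The derivative is \<open>-1\<close> modulo \<open>d\<close>, while the leading coefficient is prime to \<open>d\<close>.\<close>

lemma crit_simple_roots:
  fixes x :: complex
  assumes d: "d \<ge> 3" and x: "poly (map_poly of_int (crit d (Suc n))) x = 0"
  shows "poly (map_poly of_int (pderiv (crit d (Suc n)))) x \<noteq> 0"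
proof
  assume x': "poly (map_poly of_int (pderiv (crit d (Suc n)))) x = 0"
  obtain W where W: "pderiv (crit d (Suc n)) = smult (int d) W + [:int d - 1:]" using pderiv_crit[OF d] by blast
  obtain j e where je: "e \<in> {1, -1}" "lead_coeff (crit d (Suc n)) = e * (int d - 1) ^ j" using degree_crit[OF d] by blast
  define l where "l = e * (int d - 1) ^ j"
  have "algebraic_int (of_int l * x)"
    using algebraic_times_lead_coeff[OF x crit_nz[OF d]] by (simp only: je(2) l_def)
  then have "algebraic_int (of_int l ^ degree W * poly (map_poly of_int W) x)" by (rule algebraic_int_scaled_ipoly)
  \<comment> \<open>At a multiple root \<open>W\<close> takes the value (1 - d) / d. Scaled by a
    power of \<open>l\<close> it would have to be an integer, which is impossible as
    \<open>l\<close> and \<open>d - 1\<close> are prime to \<open>d\<close>.\<close>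
  moreover have dW: "of_nat d * poly (map_poly of_int W) x = of_int (1 - int d)"
    using x' unfolding W by (simp add: of_int_poly_hom.hom_add of_int_hom.map_poly_hom_smult of_int_hom.map_poly_pCons_hom algebra_simps)
  have e: "of_int l ^ degree W * poly (map_poly of_int W) x = of_rat (of_int (l ^ degree W * (1 - int d)) / of_nat d)"
  proof -
    have "poly (map_poly of_int W) x = of_int (1 - int d) / of_nat d" using dW d by (simp add: field_simps)
    then show ?thesis by (simp add: of_rat_divide of_rat_mult of_rat_power of_rat_diff)
  qed
  ultimately have "of_int l ^ degree W * poly (map_poly of_int W) x \<in> \<int>"
    using rational_algebraic_int_is_int by (metis Rats_of_rat)
  then obtain k where "of_int l ^ degree W * poly (map_poly of_int W) x = of_int k" by (elim Ints_cases)
  then have "of_int l ^ degree W * (of_nat d * poly (map_poly of_int W) x) = of_int (int d * k)" by simp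
  then have "complex_of_int (l ^ degree W * (1 - int d)) = of_int (int d * k)" unfolding dW by simp
  then have eq: "l ^ degree W * (1 - int d) = int d * k" by (simp only: of_int_eq_iff)
  have cop: "coprime (int d) (int d - 1)"
  proof (rule coprimeI)
    fix k assume "k dvd int d" "k dvd int d - 1"
    then have "k dvd int d - (int d - 1)" by (rule dvd_diff)
    then show "is_unit k" by simp
  qed
  have "coprime (int d) (1 - int d)" using cop by (metis coprime_minus_right_iff minus_diff_eq)
  moreover have "coprime (int d) l"
    unfolding l_def using cop je(1) by auto
  ultimately have "coprime (int d) (l ^ degree W * (1 - int d))" by simp
  then have "coprime (int d) (int d * k)" unfolding eq .
  then have "is_unit (int d)" by (metis coprime_common_divisor dvd_refl dvd_triv_left)
  then show False using d by simp
qed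

lemma rat_poly_clear_denominators:
  fixes p :: "rat poly"
  obtains N :: int and P :: "int poly" where "N \<noteq> 0" "map_poly of_int P = smult (of_int N) p"
proof -
  have "\<exists>N :: int. N \<noteq> 0 \<and> (\<exists>P :: int poly. map_poly of_int P = smult (of_int N) p)"
  proof (induction p)
    case 0
    show ?case by (rule exI[of _ 1]) (auto intro!: exI[of _ 0])
  next
    case (pCons r p)
    then obtain N :: int and P :: "int poly" where NP: "N \<noteq> 0" "map_poly of_int P = smult (of_int N) p" by blast
    obtain u v where uv: "r = of_int u / of_int v" "v \<noteq> 0" using quotient_of_div[of r] quotient_of_denom_pos[of r]
      by (metis old.prod.exhaust less_irrefl)
    have "map_poly of_int (pCons (N * u) (smult v P)) = smult (of_int (N * v)) (pCons r p)"
      using uv NP(2) by (simp add: of_int_hom.map_poly_pCons_hom of_int_hom.map_poly_hom_smult mult_ac)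
    then show ?case using NP(1) uv(2) by (intro exI[of _ "N * v"]) auto
  qed
  then show ?thesis using that by blast
qed

lemma degree_prod_crit:
  assumes "d \<ge> 3"
  shows "degree (\<Prod>i<n. crit d (Suc i)) = (\<Sum>i<n. d ^ i)"
  using assms degree_crit crit_nz by (subst degree_prod_eq_sum_degree) auto

text \<open>The sum bounds the degree of the part shared with the earlier members, so that the
  remaining factor has degree at least 3, as the conjecture demands. For d = 3, n = 1 the comparison
  would be 1 + 3 against 3.\<close>

lemma crit_degree_gap:
  fixes d :: nat
  assumes d: "d \<ge> 3" and n: "n \<ge> 1" "d \<noteq> 3 \<or> n \<noteq> 1"
  shows "(\<Sum>i<n. d ^ i) + 3 \<le> d ^ n"
proof (cases "n = 1")
  case True
  then show ?thesis using n d by simp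
next
  case False
  have "2 * (\<Sum>i<n. d ^ i) + 1 \<le> d ^ n" for n
  proof (induction n)
    case (Suc n)
    have "3 * d ^ n \<le> d ^ Suc n" using d by simp
    then show ?case using Suc by (simp del: power_Suc)
  qed simp
  then have "2 * (\<Sum>i<n. d ^ i) + 1 \<le> d ^ n" .
  moreover have "d ^ 2 \<le> d ^ n" using False n d by (intro power_increasing) auto
  moreover have "3 ^ 2 \<le> d ^ 2" using d by (intro power_mono) auto
  ultimately show ?thesis by simp
qed


text \<open>
  For fixed \<open>n\<close>, removing from \<open>crit d (n + 1)\<close> its common factors with the earlier members leaves a
  polynomial \<open>H\<close> in \<open>c\<close> with simple roots; a primitive prime of odd multiplicity fails to exist only if
  \<open>H c\<close> is a square up to one of finitely many factors.
\<close>

lemma primitive_part: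
  assumes d: "d \<ge> 3" and n: "n \<ge> 1" "d \<noteq> 3 \<or> n \<noteq> 1"
  obtains H :: "int poly" and B :: int where
    "degree H \<ge> 3" "B \<noteq> 0"
    "\<And>x :: complex. poly (map_poly of_int H) x = 0 \<Longrightarrow> poly (map_poly of_int (pderiv H)) x \<noteq> 0"
    "\<And>c. c \<in> B_set d \<Longrightarrow> poly H c \<noteq> 0"
    "\<And>c p. c \<in> B_set d \<Longrightarrow> prime p \<Longrightarrow> odd (multiplicity (int p) (poly H c)) \<Longrightarrow> \<not> int p dvd B \<Longrightarrow>
       arboreal.good_prime d c n p"
proof -
  let ?A = "crit d (Suc n)" and ?E = "\<Prod>i<n. crit d (Suc i)"
  define A E where "A = (map_poly of_int ?A :: rat poly)" and "E = (map_poly of_int ?E :: rat poly)"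
  have A0: "A \<noteq> 0" using crit_nz[OF d] by (simp add: A_def)
  have E0: "E \<noteq> 0" using crit_nz[OF d] by (simp add: E_def)
  define g where "g = gcd A E"
  have g0: "g \<noteq> 0" using A0 by (simp add: g_def)
  obtain h where h: "A = g * h" unfolding g_def by (meson dvd_def gcd_dvd1)
  obtain k where k: "E = g * k" unfolding g_def by (meson dvd_def gcd_dvd2)
  have h0: "h \<noteq> 0" using A0 h by auto
  let ?C = "\<lambda>p :: rat poly. map_poly of_rat p :: complex poly"
  have CA: "?C A = map_poly of_int ?A" unfolding A_def by (rule rat_of_int_poly)
  have simple: "poly (?C (pderiv A)) x \<noteq> 0" if "poly (?C A) x = 0" for x
    using crit_simple_roots[OF d, of n x] that
    by (simp add: CA of_rat_hom.map_poly_pderiv of_int_hom.map_poly_pderiv)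
  \<comment> \<open>\<open>A = g * h\<close> has simple roots, so \<open>g\<close> and
    \<open>h\<close> have no common root. A common root of \<open>h\<close> and \<open>E\<close>
    would be one of \<open>A\<close> and \<open>E\<close>, hence of \<open>g\<close>; this makes
    \<open>h\<close> prime to all of \<open>E\<close>.\<close>
  have hg: "poly (?C h) x \<noteq> 0 \<or> poly (?C g) x \<noteq> 0" and h_simple: "poly (?C h) x = 0 \<longrightarrow> poly (?C (pderiv h)) x \<noteq> 0" for x
    using simple[of x] unfolding h
    by (auto simp: of_rat_poly_hom.hom_mult of_rat_poly_hom.hom_add of_rat_hom.map_poly_pderiv pderiv_mult)
  have "coprime h E"
  proof (rule ccontr)
    assume "\<not> coprime h E"
    then have "\<not> is_unit (gcd h E)" by (simp only: is_unit_gcd not_False_eq_True)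
    moreover have "gcd h E \<noteq> 0" using h0 by simp
    ultimately have deg: "degree (gcd h E) \<noteq> 0" using is_unit_iff_degree by blast
    then have "\<not> constant (poly (?C (gcd h E)))" by (simp add: constant_degree)
    then obtain x where x: "poly (?C (gcd h E)) x = 0" using fundamental_theorem_of_algebra by blast
    have dvd0: "poly (?C q) x = 0" if dvd: "gcd h E dvd q" for q
    proof -
      obtain q' where "q = gcd h E * q'" using dvd by blast
      then show ?thesis using x by (simp only: of_rat_poly_hom.hom_mult poly_mult mult_zero_left)
    qed
    have hx: "poly (?C h) x = 0" and Ex: "poly (?C E) x = 0" using dvd0 by simp_all
    obtain u w where uw: "u * A + w * E = g" unfolding g_def using bezout_coefficients_fst_snd by metis
    have "poly (?C A) x = 0" unfolding h using hx by (simp add: of_rat_poly_hom.hom_mult)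
    then have "poly (?C (u * A + w * E)) x = 0" using Ex by (simp add: of_rat_poly_hom.hom_mult of_rat_poly_hom.hom_add)
    then have "poly (?C g) x = 0" by (simp only: uw)
    then show False using hg[of x] hx by simp
  qed
  then obtain u w where uw: "u * h + w * E = 1"
    by (metis bezout_coefficients_fst_snd coprime_imp_gcd_eq_1)
  obtain N1 H where H: "N1 \<noteq> 0" "map_poly of_int H = smult (of_int N1) h" using rat_poly_clear_denominators by blast
  obtain N2 G where G: "N2 \<noteq> 0" "map_poly of_int G = smult (of_int N2) g" using rat_poly_clear_denominators by blast
  obtain N3 U where U: "N3 \<noteq> 0" "map_poly of_int U = smult (of_int N3) u" using rat_poly_clear_denominators by blast
  obtain N4 W where W: "N4 \<noteq> 0" "map_poly of_int W = smult (of_int N4) w" using rat_poly_clear_denominators by blast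
  obtain N5 K where K: "N5 \<noteq> 0" "map_poly of_int K = smult (of_int N5) k" using rat_poly_clear_denominators by blast
  have inj: "P = Q" if "(map_poly of_int P :: rat poly) = map_poly of_int Q" for P Q
    using that by (simp add: of_int_hom.eq_iff)
  have 1: "smult (N1 * N2) ?A = G * H"
    by (rule inj) (simp add: of_int_poly_hom.hom_mult of_int_hom.map_poly_hom_smult H G A_def[symmetric] h mult_ac)
  have 2: "smult (N4) (U * H) + smult (N1 * N3) (W * ?E) = [:N1 * N3 * N4:]"
  proof (rule inj)
    have "map_poly of_int (smult (N4) (U * H) + smult (N1 * N3) (W * ?E)) = smult (of_int (N1 * N3 * N4)) (u * h + w * E)"
      by (simp add: of_int_poly_hom.hom_mult of_int_poly_hom.hom_add of_int_hom.map_poly_hom_smult H U W E_def[symmetric] smult_add_right mult_ac)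
    then show "(map_poly of_int (smult (N4) (U * H) + smult (N1 * N3) (W * ?E)) :: rat poly) = map_poly of_int [:N1 * N3 * N4:]"
      unfolding uw by (simp add: of_int_hom.map_poly_pCons_hom)
  qed
  have 3: "smult (N2 * N5) ?E = G * K"
    by (rule inj) (simp add: of_int_poly_hom.hom_mult of_int_hom.map_poly_hom_smult K G E_def[symmetric] k mult_ac)
  \<comment> \<open>\<open>B\<close> collects \<open>d\<close> and all cleared denominators; at
    primes not dividing it, the integer identities may be used like the rational ones.\<close>
  define B where "B = int d * (N1 * N2 * N3 * N4 * N5)"
  have B0: "B \<noteq> 0" using d H G U W K by (simp add: B_def)
  show ?thesis
  proof (rule that[of H B])
    have "degree g \<le> degree E" unfolding g_def using E0 by (intro dvd_imp_degree_le) auto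
    also have "degree E = (\<Sum>i<n. d ^ i)" using degree_prod_crit[OF d] by (simp add: E_def)
    finally have "degree g + 3 \<le> d ^ n" using crit_degree_gap[OF d n] by simp
    moreover have "d ^ n = degree A" using degree_crit[OF d, of n] by (simp add: A_def)
    moreover have "degree A = degree g + degree h" unfolding h using g0 h0 by (rule degree_mult_eq)
    moreover have "degree h = degree (map_poly of_int H :: rat poly)" unfolding H(2) using H(1) by simp
    moreover have "degree (map_poly of_int H :: rat poly) = degree H" by simp
    ultimately show "degree H \<ge> 3" by linarith
  next
    fix x :: complex assume x: "poly (map_poly of_int H) x = 0"
    have CH: "(map_poly of_int H :: complex poly) = smult (of_int N1) (?C h)"
      unfolding rat_of_int_poly[symmetric] H(2) by (simp add: of_rat_hom.map_poly_hom_smult)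
    then show "poly (map_poly of_int (pderiv H)) x \<noteq> 0"
      using x H(1) h_simple[of x] by (simp add: of_int_hom.map_poly_pderiv of_rat_hom.map_poly_pderiv pderiv_smult)
  next
    fix c assume c: "c \<in> B_set d"
    interpret arboreal d c by unfold_locales (use d c in auto)
    have A: "poly ?A c = a (Suc n)" by (rule crit_eval)
    have a0: "a (Suc n) \<noteq> 0" using a_ge_1[of "Suc n"] by auto
    have e1: "N1 * N2 * a (Suc n) = poly G c * poly H c" using arg_cong[OF 1, of "\<lambda>p. poly p c"] by (simp only: poly_smult poly_mult A)
    then show Hc0: "poly H c \<noteq> 0" using a0 H G by auto
    fix p assume p: "prime p" "odd (multiplicity (int p) (poly H c))" "\<not> int p dvd B"
    have pd: "\<not> p dvd d" and pN: "\<not> int p dvd N1" "\<not> int p dvd N2" "\<not> int p dvd N3" "\<not> int p dvd N4" "\<not> int p dvd N5"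
      using p(3) by (auto simp: B_def)
    have prime_p: "prime (int p)" using p(1) by simp
    have pH: "int p dvd poly H c" using p(2) by (metis even_zero not_dvd_imp_multiplicity_0)
    have Ec: "poly ?E c = (\<Prod>i<n. a (Suc i))" by (simp only: poly_prod crit_eval)
    \<comment> \<open>By the Bezout identity \<open>2\<close>, such a prime divides no earlier
      \<open>a i\<close>. Then identity \<open>3\<close> makes \<open>poly G c\<close> prime to
      \<open>p\<close>, and identity \<open>1\<close> gives \<open>a (Suc n)\<close> the same
      multiplicity as \<open>poly H c\<close>.\<close>
    have pE: "\<not> int p dvd poly ?E c"
    proof
      assume "int p dvd poly ?E c"
      then have "int p dvd N4 * (poly U c * poly H c) + N1 * N3 * (poly W c * poly ?E c)" using pH by simp
      also have "\<dots> = N1 * N3 * N4" using arg_cong[OF 2, of "\<lambda>p. poly p c"] by simp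
      finally show False using pN prime_p by (simp add: prime_dvd_mult_iff)
    qed
    have e3: "N2 * N5 * poly ?E c = poly G c * poly K c" using arg_cong[OF 3, of "\<lambda>p. poly p c"] by (simp only: poly_smult poly_mult)
    have pG: "\<not> int p dvd poly G c"
    proof
      assume "int p dvd poly G c"
      then have "int p dvd N2 * N5 * poly ?E c" unfolding e3 by simp
      then show False using pN pE prime_p by (simp add: prime_dvd_mult_iff)
    qed
    have Gc0: "poly G c \<noteq> 0" using pG by auto
    have "multiplicity (int p) (N1 * N2 * a (Suc n)) = multiplicity (int p) (a (Suc n))"
      using pN prime_p a0 H(1) G(1) by (simp add: prime_elem_multiplicity_mult_distrib not_dvd_imp_multiplicity_0)
    moreover have "multiplicity (int p) (poly G c * poly H c) = multiplicity (int p) (poly H c)"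
      using pG prime_p Gc0 Hc0 by (simp add: prime_elem_multiplicity_mult_distrib not_dvd_imp_multiplicity_0)
    ultimately have "odd (multiplicity (int p) (a (Suc n)))" using p(2) e1 by simp
    moreover have "\<not> int p dvd a i" if i1: "i \<in> {1..n}" for i
    proof
      assume i: "int p dvd a i"
      obtain j where j: "i = Suc j" "j < n" using i1 by (cases i) auto
      have "a (Suc j) dvd (\<Prod>i<n. a (Suc i))" by (rule dvd_prodI) (use j in auto)
      then show False using i j pE Ec dvd_trans by metis
    qed
    ultimately show "good_prime n p" using p(1) pd by (simp add: good_prime_def)
  qed (rule B0)
qed

text \<open>The squarefree part of \<open>poly H c\<close> divides the fixed \<open>B\<close>, so
  only finitely many curves Y^2 = D H(X) occur, and the maximum \<open>T\<close> of their heights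
  bounds \<open>c\<close>.\<close>

lemma finite_no_good_prime:
  assumes V: vojta_conj and d: "d \<ge> 3" and n: "n \<ge> 1" "d \<noteq> 3 \<or> n \<noteq> 1"
  shows "finite {c \<in> B_set d. \<forall>p. \<not> arboreal.good_prime d c n p}"
proof -
  obtain H :: "int poly" and B :: int where H: "degree H \<ge> 3" "B \<noteq> 0"
    "\<And>x :: complex. poly (map_poly of_int H) x = 0 \<Longrightarrow> poly (map_poly of_int (pderiv H)) x \<noteq> 0"
    "\<And>c. c \<in> B_set d \<Longrightarrow> poly H c \<noteq> 0"
    "\<And>c p. c \<in> B_set d \<Longrightarrow> prime p \<Longrightarrow> odd (multiplicity (int p) (poly H c)) \<Longrightarrow> \<not> int p dvd B \<Longrightarrow>
       arboreal.good_prime d c n p"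
    using primitive_part[OF d n] by metis
  obtain C1 C2 where C: "C1 \<ge> 0" "C2 \<ge> 0"
   "\<And>g :: int poly. \<And>x y. degree g = degree H \<Longrightarrow> disc g \<noteq> 0 \<Longrightarrow> y\<^sup>2 = poly g x \<Longrightarrow> ht_int x \<le> C1 * ht_poly g + C2"
    using vojta_nonneg[OF V H(1)] by blast
  define Ds where "Ds = {D. D dvd B}"
  have finD: "finite Ds" unfolding Ds_def using H(2) by (rule finite_divisors_int)
  define T where "T = Max ((\<lambda>D. ht_poly (smult D H)) ` Ds)"
  have "{c \<in> B_set d. \<forall>p. \<not> arboreal.good_prime d c n p} \<subseteq> {0..\<lfloor>exp (C1 * T + C2)\<rfloor>}"
  proof
    fix c assume "c \<in> {c \<in> B_set d. \<forall>p. \<not> arboreal.good_prime d c n p}"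
    then have c: "c \<in> B_set d" and ngp: "\<And>p. \<not> arboreal.good_prime d c n p" by auto
    have c0: "c > 0" using c by (simp add: B_set_def)
    define D where "D = squarefree_part (poly H c)"
    define y where "y = square_part (poly H c)"
    have Dy: "poly H c = D * y\<^sup>2" unfolding D_def y_def by (rule squarefree_decompose)
    have D0: "D \<noteq> 0" by (simp add: D_def)
    have "D dvd B" unfolding D_def using H(4,5)[OF c] ngp by (intro squarefree_part_dvd) blast+
    then have DD: "D \<in> Ds" by (simp add: Ds_def)
    let ?g = "smult D H"
    have "degree ?g = degree H" using D0 by simp
    moreover have "disc ?g \<noteq> 0"
    proof (rule disc_nonzero)
      show "degree ?g > 0" using D0 H(1) by simp
      fix x :: complex assume "poly (map_poly of_int ?g) x = 0"
      then have "poly (map_poly of_int H) x = 0" using D0 by (simp add: of_int_hom.map_poly_hom_smult)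
      then show "poly (map_poly of_int (pderiv ?g)) x \<noteq> 0"
        using H(3) D0 by (simp add: pderiv_smult of_int_hom.map_poly_hom_smult)
    qed
    moreover have "(D * y)\<^sup>2 = poly ?g c" using Dy by (simp add: power2_eq_square mult_ac)
    ultimately have "ht_int c \<le> C1 * ht_poly ?g + C2" by (rule C(3))
    also have "\<dots> \<le> C1 * T + C2"
      unfolding T_def using C(1) finD DD by (intro add_right_mono mult_left_mono Max_ge) auto
    finally have "ln (real_of_int c) \<le> C1 * T + C2" using c0 by (simp add: ht_int_def)
    then have "real_of_int c \<le> exp (C1 * T + C2)" using c0 by (metis exp_le_cancel_iff exp_ln of_int_0_less_iff)
    then show "c \<in> {0..\<lfloor>exp (C1 * T + C2)\<rfloor>}" using c0 by (simp add: le_floor_iff)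
  qed
  then show ?thesis by (rule finite_subset) simp
qed

theorem theorem1p4:
  fixes d :: nat
  assumes "vojta_conj"
    and "d \<ge> 3"
    and "prime d \<or> (\<exists>q::nat. prime q \<and> q dvd (d - 1) \<and> coprime (d - 1) (multiplicity q (d - 1)))"
  shows "(\<forall>c\<in>B_set d. finite_index (gal_tree (phi d c)) (tree_Aut (phi d c)))
       \<and> finite {c \<in> B_set d. gal_tree (phi d c) \<noteq> tree_Aut (phi d c)}"
proof -
  obtain N where N: "\<And>c n. c \<in> B_set d \<Longrightarrow> n \<ge> N \<Longrightarrow> \<exists>p. arboreal.good_prime d c n p"
    using large_levels[OF assms(1,2)] by blast
  have loc: "arboreal d c" if "c \<in> B_set d" for c using assms(2) that by unfold_locales
  have full: "arboreal.full d c n" if c: "c \<in> B_set d" and n: "n > 0" and p: "arboreal.good_prime d c n p" for c n p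
  proof -
    interpret arboreal d c by (rule loc[OF c])
    obtain m where m: "n = Suc m" using n by (cases n) auto
    obtain r s where "r \<in> R n" "s \<in> R n" "r \<noteq> s" "swaps n r s"
      using transposition_exists[of n p] n p by auto
    moreover have "fibre_primitive (Suc m)"
      using assms(3) fibre_primitive_prime fibre_primitive_case2 by blast
    ultimately show ?thesis using full_if_transposition unfolding m by blast
  qed
  have "finite_index (gal_tree (phi d c)) (tree_Aut (phi d c))" if c: "c \<in> B_set d" for c
  proof -
    interpret arboreal d c by (rule loc[OF c])
    have "full n" if "n > N" for n using full[OF c] N[OF c, of n] that by auto
    then show ?thesis by (rule finite_index_if_eventually_full)
  qed
  moreover have "finite {c \<in> B_set d. gal_tree (phi d c) \<noteq> tree_Aut (phi d c)}"
  proof -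
    \<comment> \<open>Levels from \<open>N\<close> on are full for every \<open>c\<close>, so an
      exceptional \<open>c\<close> already fails at one of the levels 1 to N - 1, each of which has
      finitely many exceptions.\<close>
    define X where "X = (\<lambda>n. {c \<in> B_set d. \<not> arboreal.full d c n})"
    have "finite (X n)" if n: "n \<ge> 1" for n
    proof (cases "d = 3 \<and> n = 1")
      case True
      then have "X n = {}" using arboreal.full_cubic[OF loc] by (auto simp: X_def)
      then show ?thesis by simp
    next
      case False
      have "X n \<subseteq> {c \<in> B_set d. \<forall>p. \<not> arboreal.good_prime d c n p}" using full n by (auto simp: X_def)
      then show ?thesis using finite_no_good_prime[OF assms(1,2) n] False finite_subset by blast
    qed
    then have "finite (\<Union>n\<in>{1..<N}. X n)" by auto
    moreover have "{c \<in> B_set d. gal_tree (phi d c) \<noteq> tree_Aut (phi d c)} \<subseteq> (\<Union>n\<in>{1..<N}. X n)"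
    proof
      fix c assume c: "c \<in> {c \<in> B_set d. gal_tree (phi d c) \<noteq> tree_Aut (phi d c)}"
      then have cB: "c \<in> B_set d" by simp
      obtain n where n: "n > 0" "\<not> arboreal.full d c n" using arboreal.gal_tree_eq[OF loc[OF cB]] c by blast
      then have "\<not> n \<ge> N" using full[OF cB] N[OF cB] by blast
      then show "c \<in> (\<Union>n\<in>{1..<N}. X n)" using n cB by (auto simp: X_def)
    qed
    ultimately show ?thesis by (rule finite_subset[rotated])
  qed
  ultimately show ?thesis by blast
qed

end
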